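(* Let $P$ be a finitely generated operad over a field $\Bbbk$ of characteristic zero with a finite Gröbner basis. Suppose that either (i) $P$ is non-symmetric and the numbers $\dim P(n)$ are bounded by some polynomial in $n$; or (ii) $P$ is a shuffle regular symmetric operad (with respect to its finite Gröbner basis) and the dimensions $\dim P(n)$ are bounded by an exponential function $a^n$ for some $a>1$. Then the ordinary generating series $G_P(z)=\sum_{n\ge1}\dim P(n)\,z^n$ is a rational function.
   Context: $\Bbbk$ is a field of characteristic zero. Non-symmetric case. A non-symmetric (linear) operad $P$ is a collection of vector spaces $P(n)$, $n\ge1$, with an identity in $P(1)$ and partial compositions $\circ_i:P(n)\otimes P(m)\to P(n+m-1)$ satisfying the usual axioms. For a set $\Upsilon=\bigsqcup_{n\ge1}\Upsilon_n$ of generators ($\Upsilon_n$ the $n$-ary ones), the free non-symmetric operad $F(\Upsilon)$ has as basis the tree monomials: planar rooted trees in which each vertex has at least one input and each vertex with $n$ inputs is labeled by an element of $\Upsilon_n$ (the trivial tree is the identity); composition is grafting. $v$ is divisible by $w$ if $v$ contains a connected planar labeled subtree isomorphic to $w$ (its root need not be the root of $v$). Symmetric case. A shuffle monomial of arity $n$ is a planar rooted tree with $n$ leaves in which each vertex has at least one input and each vertex with $k$ inputs is labeled by an element of $\Upsilon_k$ (the set of $k$-ary generators), and whose leaves are in addition labeled bijectively by $1,\dots,n$ such that at every vertex the minimal leaf labels reachable through its inputs increase from left to right. Shuffle monomials form a basis of the free shuffle operad $\mathcal F(\Upsilon)$; shuffle compositions are graftings with any relabeling of leaves that keeps the relative order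 of the leaves of the grafted tree and of the leaves of the lower tree (the grafted tree being represented by its minimal leaf) and yields a shuffle monomial. A connected subtree $u$ of $v$ becomes a shuffle tree by assigning to each input of $u$ the minimum of the leaves of $v$ reached through it; $v$ is divisible by $w$ if some such $u$ is isomorphic to $w$ as a labeled tree by an isomorphism preserving the order of the leaves. A symmetric operad is considered as a shuffle operad (forgetting the symmetric group actions) and presented as $\mathcal F(\Upsilon)/C$, where $\Upsilon$ is a linear basis of the generating symmetric collection. In both cases: an admissible order is a total well-order on the monomials of each arity compatible with (shuffle) compositions; the leading monomial of a nonzero element is its largest monomial; a Gröbner basis of the ideal $C$ of relations is a subset $G\subset C$ such that the leading monomial of every nonzero element of $C$ is divisible by the leading monomial of some element of $G$; it is reduced if leading coefficients are $1$ and no monomial occurring in an element of $G$ is divisible by the leading monomial of another element of $G$. "Finite Gröbner basis" means that $\Upsilon$ and $G$ are finite for some admissible order. The planar skeleton of a shuffle monomial is obtained by erasing the leaf labels; a set $M$ of shuffle monomials is shuffle regular if with each $m\in M$ it contains all shuffle monomials with the same planar skeleton; $P$ is shuffle regular if the set of leading monomials of its reduced Gröbner basis is shuffle regular. *)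

theory Defs
  imports
    Complex_Main
    "HOL-Library.Poly_Mapping"
    "HOL-Combinatorics.Permutations"
    "HOL-Computational_Algebra.Polynomial_FPS"
begin

section \<open>Collections of vector spaces and operads\<close>

text \<open>
  A collection of vector spaces is a family of subspaces of one ambient vector space; every family
  is of this form (take the direct sum as the ambient space). Since the components of different
  arities may overlap, all structure maps carry the arities of their arguments. Only arities
  \<open>n \<ge> 1\<close> are ever looked at.
\<close>

record ('k, 'v) collection =
  lin_scale :: "'k \<Rightarrow> 'v \<Rightarrow> 'v"
  graded_part :: "nat \<Rightarrow> 'v set"

locale linear_collection =
  fixes V :: "('k::field, 'v::ab_group_add, 'z) collection_scheme"
  assumes vector_space: "vector_space (lin_scale V)"
    and subspace: "n \<ge> 1 \<Longrightarrow> module.subspace (lin_scale V) (graded_part V n)"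

definition dim_part :: "('k::field, 'v::ab_group_add, 'z) collection_scheme \<Rightarrow> nat \<Rightarrow> nat"
  where "dim_part V n = vector_space.dim (lin_scale V) (graded_part V n)"

text \<open>Needed since the library's dimension of an infinite-dimensional space is \<open>0\<close>.\<close>

definition finite_dimensional_part ::
    "('k::field, 'v::ab_group_add, 'z) collection_scheme \<Rightarrow> nat \<Rightarrow> bool"
  where "finite_dimensional_part V n \<longleftrightarrow>
    (\<exists>B. finite B \<and> B \<subseteq> graded_part V n \<and> module.span (lin_scale V) B = graded_part V n)"

definition collection_hom ::
    "('k::field, 'v::ab_group_add, 'y) collection_scheme \<Rightarrow>
     ('k, 'w::ab_group_add, 'z) collection_scheme \<Rightarrow> (nat \<Rightarrow> 'v \<Rightarrow> 'w) \<Rightarrow> bool"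
  where "collection_hom V W \<phi> \<longleftrightarrow> (\<forall>n\<ge>1.
    (\<forall>x\<in>graded_part V n. \<phi> n x \<in> graded_part W n) \<and>
    (\<forall>x\<in>graded_part V n. \<forall>y\<in>graded_part V n. \<phi> n (x + y) = \<phi> n x + \<phi> n y) \<and>
    (\<forall>c. \<forall>x\<in>graded_part V n. \<phi> n (lin_scale V c x) = lin_scale W c (\<phi> n x)))"

definition surjective_on_parts ::
    "('k, 'v, 'y) collection_scheme \<Rightarrow> ('k, 'w, 'z) collection_scheme \<Rightarrow> (nat \<Rightarrow> 'v \<Rightarrow> 'w) \<Rightarrow> bool"
  where "surjective_on_parts V W \<phi> \<longleftrightarrow> (\<forall>n\<ge>1. \<phi> n ` graded_part V n = graded_part W n)"

definition kernel_part ::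
    "('k, 'v, 'y) collection_scheme \<Rightarrow> (nat \<Rightarrow> 'v \<Rightarrow> 'w::zero) \<Rightarrow> nat \<Rightarrow> 'v set"
  where "kernel_part V \<phi> n = {x \<in> graded_part V n. \<phi> n x = 0}"

text \<open>\<open>op_comp P n m i x y\<close> is the partial composition of \<open>x\<close> in \<open>P(n)\<close> and \<open>y\<close> in \<open>P(m)\<close>, the output of
  \<open>y\<close> being plugged into the \<open>i\<close>-th input of \<open>x\<close>.\<close>

record ('k, 'v) ns_operad = "('k, 'v) collection" +
  op_unit :: "'v"
  op_comp :: "nat \<Rightarrow> nat \<Rightarrow> nat \<Rightarrow> 'v \<Rightarrow> 'v \<Rightarrow> 'v"

locale ns_operad = linear_collection P
  for P :: "('k::field, 'v::ab_group_add, 'z) ns_operad_scheme" +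
  assumes unit_closed: "op_unit P \<in> graded_part P 1"
    and comp_closed:
      "\<lbrakk>1 \<le> i; i \<le> n; 1 \<le> m; x \<in> graded_part P n; y \<in> graded_part P m\<rbrakk>
        \<Longrightarrow> op_comp P n m i x y \<in> graded_part P (n + m - 1)"
    and comp_add_left:
      "\<lbrakk>1 \<le> i; i \<le> n; 1 \<le> m; x \<in> graded_part P n; x' \<in> graded_part P n; y \<in> graded_part P m\<rbrakk>
        \<Longrightarrow> op_comp P n m i (x + x') y = op_comp P n m i x y + op_comp P n m i x' y"
    and comp_add_right:
      "\<lbrakk>1 \<le> i; i \<le> n; 1 \<le> m; x \<in> graded_part P n; y \<in> graded_part P m; y' \<in> graded_part P m\<rbrakk>
        \<Longrightarrow> op_comp P n m i x (y + y') = op_comp P n m i x y + op_comp P n m i x y'"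
    and comp_scale_left:
      "\<lbrakk>1 \<le> i; i \<le> n; 1 \<le> m; x \<in> graded_part P n; y \<in> graded_part P m\<rbrakk>
        \<Longrightarrow> op_comp P n m i (lin_scale P c x) y = lin_scale P c (op_comp P n m i x y)"
    and comp_scale_right:
      "\<lbrakk>1 \<le> i; i \<le> n; 1 \<le> m; x \<in> graded_part P n; y \<in> graded_part P m\<rbrakk>
        \<Longrightarrow> op_comp P n m i x (lin_scale P c y) = lin_scale P c (op_comp P n m i x y)"
    and unit_left:
      "\<lbrakk>1 \<le> n; x \<in> graded_part P n\<rbrakk> \<Longrightarrow> op_comp P 1 n 1 (op_unit P) x = x"
    and unit_right:
      "\<lbrakk>1 \<le> i; i \<le> n; x \<in> graded_part P n\<rbrakk> \<Longrightarrow> op_comp P n 1 i x (op_unit P) = x"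
    and sequential_assoc:
      "\<lbrakk>1 \<le> i; i \<le> n; 1 \<le> j; j \<le> m; 1 \<le> l;
        x \<in> graded_part P n; y \<in> graded_part P m; z \<in> graded_part P l\<rbrakk>
        \<Longrightarrow> op_comp P (n + m - 1) l (i + j - 1) (op_comp P n m i x y) z =
            op_comp P n (m + l - 1) i x (op_comp P m l j y z)"
    and parallel_assoc:
      "\<lbrakk>1 \<le> i; i < j; j \<le> n; 1 \<le> m; 1 \<le> l;
        x \<in> graded_part P n; y \<in> graded_part P m; z \<in> graded_part P l\<rbrakk>
        \<Longrightarrow> op_comp P (n + m - 1) l (j + m - 1) (op_comp P n m i x y) z =
            op_comp P (n + l - 1) m i (op_comp P n l j x z) y"

text \<open>Actions of the symmetric groups are written as left actions by relabelling: in
  \<open>\<rho> n \<sigma> x\<close> the input \<open>i\<close> of \<open>x\<close> has become the input \<open>\<sigma> i\<close>, i.e. for multilinear maps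
  \<open>(\<rho> n \<sigma> f)(v\<^sub>1, \<dots>, v\<^sub>n) = f(v\<^bsub>\<sigma> 1\<^esub>, \<dots>, v\<^bsub>\<sigma> n\<^esub>)\<close>. The customary right action of \<open>\<sigma>\<close> is the action
  of the inverse of \<open>\<sigma>\<close> here.\<close>

locale symmetric_collection = linear_collection V
  for V :: "('k::field, 'v::ab_group_add, 'z) collection_scheme" +
  fixes \<rho> :: "nat \<Rightarrow> (nat \<Rightarrow> nat) \<Rightarrow> 'v \<Rightarrow> 'v"
  assumes act_closed:
      "\<lbrakk>1 \<le> n; \<sigma> permutes {1..n}; x \<in> graded_part V n\<rbrakk> \<Longrightarrow> \<rho> n \<sigma> x \<in> graded_part V n"
    and act_add:
      "\<lbrakk>1 \<le> n; \<sigma> permutes {1..n}; x \<in> graded_part V n; y \<in> graded_part V n\<rbrakk>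
        \<Longrightarrow> \<rho> n \<sigma> (x + y) = \<rho> n \<sigma> x + \<rho> n \<sigma> y"
    and act_scale:
      "\<lbrakk>1 \<le> n; \<sigma> permutes {1..n}; x \<in> graded_part V n\<rbrakk>
        \<Longrightarrow> \<rho> n \<sigma> (lin_scale V c x) = lin_scale V c (\<rho> n \<sigma> x)"
    and act_id: "\<lbrakk>1 \<le> n; x \<in> graded_part V n\<rbrakk> \<Longrightarrow> \<rho> n id x = x"
    and act_comp:
      "\<lbrakk>1 \<le> n; \<sigma> permutes {1..n}; \<tau> permutes {1..n}; x \<in> graded_part V n\<rbrakk>
        \<Longrightarrow> \<rho> n (\<sigma> \<circ> \<tau>) x = \<rho> n \<sigma> (\<rho> n \<tau> x)"

text \<open>In the composition of \<open>x\<close> and \<open>y\<close> at \<open>i\<close>, with \<open>y\<close> of arity \<open>m\<close>, the input \<open>j\<close> of \<open>x\<close> (\<open>j \<noteq> i\<close>) and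
  the input \<open>k\<close> of \<open>y\<close> become the inputs \<open>outer_input m i j\<close> and \<open>inner_input i k\<close>.\<close>

definition outer_input :: "nat \<Rightarrow> nat \<Rightarrow> nat \<Rightarrow> nat"
  where "outer_input m i j = (if j < i then j else j + m - 1)"

definition inner_input :: "nat \<Rightarrow> nat \<Rightarrow> nat"
  where "inner_input i k = i + k - 1"

locale symmetric_operad = ns_operad P + symmetric_collection P \<rho>
  for P :: "('k::field, 'v::ab_group_add, 'z) ns_operad_scheme"
    and \<rho> :: "nat \<Rightarrow> (nat \<Rightarrow> nat) \<Rightarrow> 'v \<Rightarrow> 'v" +
  assumes equivariant:
    "\<lbrakk>1 \<le> i; i \<le> n; 1 \<le> m; x \<in> graded_part P n; y \<in> graded_part P m;
      \<sigma> permutes {1..n}; \<tau> permutes {1..m}; \<pi> permutes {1..n + m - 1};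
      \<And>j. \<lbrakk>1 \<le> j; j \<le> n; j \<noteq> i\<rbrakk> \<Longrightarrow> \<pi> (outer_input m i j) = outer_input m (\<sigma> i) (\<sigma> j);
      \<And>k. \<lbrakk>1 \<le> k; k \<le> m\<rbrakk> \<Longrightarrow> \<pi> (inner_input i k) = inner_input (\<sigma> i) (\<tau> k)\<rbrakk>
      \<Longrightarrow> op_comp P n m (\<sigma> i) (\<rho> n \<sigma> x) (\<rho> m \<tau> y) = \<rho> (n + m - 1) \<pi> (op_comp P n m i x y)"

definition equivariant_hom ::
    "('k::field, 'v::ab_group_add, 'y) collection_scheme \<Rightarrow> (nat \<Rightarrow> (nat \<Rightarrow> nat) \<Rightarrow> 'v \<Rightarrow> 'v) \<Rightarrow>
     ('k, 'w::ab_group_add, 'z) collection_scheme \<Rightarrow> (nat \<Rightarrow> (nat \<Rightarrow> nat) \<Rightarrow> 'w \<Rightarrow> 'w) \<Rightarrow>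
     (nat \<Rightarrow> 'v \<Rightarrow> 'w) \<Rightarrow> bool"
  where "equivariant_hom V \<rho> W \<rho>' \<psi> \<longleftrightarrow> collection_hom V W \<psi> \<and>
    (\<forall>n\<ge>1. \<forall>\<sigma>. \<sigma> permutes {1..n} \<longrightarrow> (\<forall>x\<in>graded_part V n. \<psi> n (\<rho> n \<sigma> x) = \<rho>' n \<sigma> (\<psi> n x)))"

definition ns_operad_hom ::
    "('k::field, 'v::ab_group_add, 'y) ns_operad_scheme \<Rightarrow>
     ('k, 'w::ab_group_add, 'z) ns_operad_scheme \<Rightarrow> (nat \<Rightarrow> 'v \<Rightarrow> 'w) \<Rightarrow> bool"
  where "ns_operad_hom P Q \<phi> \<longleftrightarrow> collection_hom P Q \<phi> \<and>
    \<phi> 1 (op_unit P) = op_unit Q \<and>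
    (\<forall>n m i x y. 1 \<le> i \<and> i \<le> n \<and> 1 \<le> m \<and> x \<in> graded_part P n \<and> y \<in> graded_part P m \<longrightarrow>
      \<phi> (n + m - 1) (op_comp P n m i x y) = op_comp Q n m i (\<phi> n x) (\<phi> m y))"


section \<open>Shuffle compositions\<close>

text \<open>The \<open>k\<close>-th smallest element of \<open>S\<close>, counting from \<open>1\<close>.\<close>

definition nth_smallest :: "nat set \<Rightarrow> nat \<Rightarrow> nat"
  where "nth_smallest S k = sorted_list_of_set S ! (k - 1)"

text \<open>
  A shuffle composition of arities \<open>n\<close> and \<open>m\<close> is determined by the set \<open>B\<close> of labels in
  \<open>{1..n + m - 1}\<close> which the leaves of the upper tree (arity \<open>m\<close>) get. Since relative orders are kept
  and the upper tree is represented by its minimal leaf, its leaf \<open>k\<close> gets the \<open>k\<close>-th smallest element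
  of \<open>B\<close>, and the leaf \<open>j\<close> of the lower tree gets the \<open>j\<close>-th smallest element of
  \<open>lower_labels n m B\<close>, the leaf labelled by \<open>Min B\<close> being the one replaced by the upper tree. In
  particular the position of the composition is \<open>Min B\<close>, and the labels below \<open>Min B\<close> do not change.
\<close>

definition shuffle_index :: "nat \<Rightarrow> nat \<Rightarrow> nat set set"
  where "shuffle_index n m = {B. B \<subseteq> {1..n + m - 1} \<and> card B = m}"

definition lower_labels :: "nat \<Rightarrow> nat \<Rightarrow> nat set \<Rightarrow> nat set"
  where "lower_labels n m B = insert (Min B) ({1..n + m - 1} - B)"

record ('k, 'v) shuffle_operad = "('k, 'v) collection" +
  sh_unit :: "'v"
  sh_comp :: "nat \<Rightarrow> nat \<Rightarrow> nat set \<Rightarrow> 'v \<Rightarrow> 'v \<Rightarrow> 'v"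

definition shuffle_operad_hom ::
    "('k::field, 'v::ab_group_add, 'y) shuffle_operad_scheme \<Rightarrow>
     ('k, 'w::ab_group_add, 'z) shuffle_operad_scheme \<Rightarrow> (nat \<Rightarrow> 'v \<Rightarrow> 'w) \<Rightarrow> bool"
  where "shuffle_operad_hom P Q \<phi> \<longleftrightarrow> collection_hom P Q \<phi> \<and>
    \<phi> 1 (sh_unit P) = sh_unit Q \<and>
    (\<forall>n m B x y. 1 \<le> n \<and> 1 \<le> m \<and> B \<in> shuffle_index n m \<and>
        x \<in> graded_part P n \<and> y \<in> graded_part P m \<longrightarrow>
      \<phi> (n + m - 1) (sh_comp P n m B x y) = sh_comp Q n m B (\<phi> n x) (\<phi> m y))"

text \<open>A symmetric operad as a shuffle operad: compose at \<open>i = Min B\<close> and then relabel the inputs. The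
  permutation sends \<open>outer_input m i j\<close> to the label of \<open>j\<close> and \<open>inner_input i k\<close> to the label of \<open>k\<close>.\<close>

definition shuffle_relabelling :: "nat \<Rightarrow> nat \<Rightarrow> nat set \<Rightarrow> nat \<Rightarrow> nat"
  where "shuffle_relabelling n m B p =
    (let i = Min B in
      if p < i then p
      else if p < i + m then nth_smallest B (p - i + 1)
      else if p < n + m then nth_smallest (lower_labels n m B) (p - m + 1)
      else p)"

definition shuffle_operad_of ::
    "('k, 'v, 'z) ns_operad_scheme \<Rightarrow> (nat \<Rightarrow> (nat \<Rightarrow> nat) \<Rightarrow> 'v \<Rightarrow> 'v) \<Rightarrow> ('k, 'v) shuffle_operad"
  where "shuffle_operad_of P \<rho> =
    \<lparr>lin_scale = lin_scale P, graded_part = graded_part P, sh_unit = op_unit P,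
     sh_comp = (\<lambda>n m B x y.
       \<rho> (n + m - 1) (shuffle_relabelling n m B) (op_comp P n m (Min B) x y))\<rparr>"


section \<open>Tree monomials\<close>

text \<open>Planar rooted trees with vertices labelled in \<open>'g\<close> and leaves labelled in \<open>'l\<close>; non-symmetric
  monomials and planar skeletons have \<open>'l = unit\<close>, shuffle monomials have \<open>'l = nat\<close>.\<close>

datatype ('g, 'l) ptree = Leaf 'l | Node 'g "('g, 'l) ptree list"

fun leaves :: "('g, 'l) ptree \<Rightarrow> 'l list" where
  "leaves (Leaf a) = [a]"
| "leaves (Node g ts) = concat (map leaves ts)"

fun subtrees :: "('g, 'l) ptree \<Rightarrow> ('g, 'l) ptree set" where
  "subtrees (Leaf a) = {Leaf a}"
| "subtrees (Node g ts) = insert (Node g ts) (\<Union>t\<in>set ts. subtrees t)"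

text \<open>\<open>\<Gamma> n\<close> is the set of \<open>n\<close>-ary generators. A label occurring in several \<open>\<Gamma> n\<close> stands for several
  generators, told apart by the number of inputs of the vertex.\<close>

fun labelled_by :: "(nat \<Rightarrow> 'g set) \<Rightarrow> ('g, 'l) ptree \<Rightarrow> bool" where
  "labelled_by \<Gamma> (Leaf a) \<longleftrightarrow> True"
| "labelled_by \<Gamma> (Node g ts) \<longleftrightarrow>
     ts \<noteq> [] \<and> g \<in> \<Gamma> (length ts) \<and> (\<forall>t\<in>set ts. labelled_by \<Gamma> t)"

definition finitely_many_generators :: "(nat \<Rightarrow> 'g set) \<Rightarrow> bool"
  where "finitely_many_generators \<Gamma> \<longleftrightarrow> finite (SIGMA n:{1..}. \<Gamma> n)"

definition min_leaf :: "('g, nat) ptree \<Rightarrow> nat"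
  where "min_leaf t = Min (set (leaves t))"

fun shuffle_ordered :: "('g, nat) ptree \<Rightarrow> bool" where
  "shuffle_ordered (Leaf a) \<longleftrightarrow> True"
| "shuffle_ordered (Node g ts) \<longleftrightarrow>
     sorted_wrt (<) (map min_leaf ts) \<and> (\<forall>t\<in>set ts. shuffle_ordered t)"

definition ns_monomials :: "(nat \<Rightarrow> 'g set) \<Rightarrow> nat \<Rightarrow> ('g, unit) ptree set"
  where "ns_monomials \<Gamma> n = {t. labelled_by \<Gamma> t \<and> length (leaves t) = n}"

definition shuffle_monomials :: "(nat \<Rightarrow> 'g set) \<Rightarrow> nat \<Rightarrow> ('g, nat) ptree set"
  where "shuffle_monomials \<Gamma> n =
    {t. labelled_by \<Gamma> t \<and> distinct (leaves t) \<and> set (leaves t) = {1..n} \<and> shuffle_ordered t}"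

definition skeleton :: "('g, 'l) ptree \<Rightarrow> ('g, unit) ptree"
  where "skeleton t = map_ptree id (\<lambda>_. ()) t"

text \<open>\<open>ns_graft i s t\<close> replaces the \<open>i\<close>-th leaf of \<open>s\<close> from the left by \<open>t\<close>.\<close>

fun ns_graft :: "nat \<Rightarrow> ('g, unit) ptree \<Rightarrow> ('g, unit) ptree \<Rightarrow> ('g, unit) ptree"
  and ns_graft_list ::
    "nat \<Rightarrow> ('g, unit) ptree list \<Rightarrow> ('g, unit) ptree \<Rightarrow> ('g, unit) ptree list" where
  "ns_graft i (Leaf a) t = t"
| "ns_graft i (Node g ss) t = Node g (ns_graft_list i ss t)"
| "ns_graft_list i [] t = []"
| "ns_graft_list i (s # ss) t =
     (if i \<le> length (leaves s) then ns_graft i s t # ss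
      else s # ns_graft_list (i - length (leaves s)) ss t)"

fun replace_leaves :: "('l \<Rightarrow> ('g, 'm) ptree) \<Rightarrow> ('g, 'l) ptree \<Rightarrow> ('g, 'm) ptree" where
  "replace_leaves f (Leaf a) = f a"
| "replace_leaves f (Node g ts) = Node g (map (replace_leaves f) ts)"

definition shuffle_graft ::
    "nat \<Rightarrow> nat \<Rightarrow> nat set \<Rightarrow> ('g, nat) ptree \<Rightarrow> ('g, nat) ptree \<Rightarrow> ('g, nat) ptree"
  where "shuffle_graft n m B s t =
    replace_leaves
      (\<lambda>j. if j = Min B then map_ptree id (nth_smallest B) t
           else Leaf (nth_smallest (lower_labels n m B) j)) s"

text \<open>\<open>rooted_cut lab u v\<close>: \<open>u\<close> is a connected subtree of \<open>v\<close> containing the root of \<open>v\<close>, the input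
  of \<open>u\<close> at which a subtree \<open>w\<close> of \<open>v\<close> is cut off being labelled by \<open>lab w\<close>.\<close>

inductive rooted_cut ::
    "(('g, 'l) ptree \<Rightarrow> 'l) \<Rightarrow> ('g, 'l) ptree \<Rightarrow> ('g, 'l) ptree \<Rightarrow> bool"
  for lab :: "('g, 'l) ptree \<Rightarrow> 'l" where
  cut: "rooted_cut lab (Leaf (lab v)) v"
| keep: "list_all2 (rooted_cut lab) us vs \<Longrightarrow> rooted_cut lab (Node g us) (Node g vs)"
monos list.rel_mono

definition connected_subtree ::
    "(('g, 'l) ptree \<Rightarrow> 'l) \<Rightarrow> ('g, 'l) ptree \<Rightarrow> ('g, 'l) ptree \<Rightarrow> bool"
  where "connected_subtree lab u v \<longleftrightarrow> (\<exists>s\<in>subtrees v. rooted_cut lab u s)"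

definition ns_divides :: "('g, unit) ptree \<Rightarrow> ('g, unit) ptree \<Rightarrow> bool"
  where "ns_divides w v \<longleftrightarrow> connected_subtree (\<lambda>_. ()) w v"

definition order_isomorphic :: "('g, nat) ptree \<Rightarrow> ('g, nat) ptree \<Rightarrow> bool"
  where "order_isomorphic w u \<longleftrightarrow>
    (\<exists>f. strict_mono_on (set (leaves w)) f \<and> u = map_ptree id f w)"

definition shuffle_divides :: "('g, nat) ptree \<Rightarrow> ('g, nat) ptree \<Rightarrow> bool"
  where "shuffle_divides w v \<longleftrightarrow> (\<exists>u. connected_subtree min_leaf u v \<and> order_isomorphic w u)"


section \<open>Free operads\<close>

definition scale_poly_mapping :: "'k::semiring_0 \<Rightarrow> ('a \<Rightarrow>\<^sub>0 'k) \<Rightarrow> ('a \<Rightarrow>\<^sub>0 'k)"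
  where "scale_poly_mapping c f = Poly_Mapping.map ((*) c) f"

definition bilinear_extension ::
    "('a \<Rightarrow> 'b \<Rightarrow> 'c) \<Rightarrow> ('a \<Rightarrow>\<^sub>0 'k::semiring_0) \<Rightarrow> ('b \<Rightarrow>\<^sub>0 'k) \<Rightarrow> ('c \<Rightarrow>\<^sub>0 'k)"
  where "bilinear_extension h f g =
    (\<Sum>s\<in>Poly_Mapping.keys f. \<Sum>t\<in>Poly_Mapping.keys g.
      Poly_Mapping.single (h s t) (Poly_Mapping.lookup f s * Poly_Mapping.lookup g t))"

definition free_ns_operad ::
    "(nat \<Rightarrow> 'g set) \<Rightarrow> ('k::field, ('g, unit) ptree \<Rightarrow>\<^sub>0 'k) ns_operad"
  where "free_ns_operad \<Gamma> =
    \<lparr>lin_scale = scale_poly_mapping,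
     graded_part = (\<lambda>n. {f. Poly_Mapping.keys f \<subseteq> ns_monomials \<Gamma> n}),
     op_unit = Poly_Mapping.single (Leaf ()) 1,
     op_comp = (\<lambda>n m i. bilinear_extension (ns_graft i))\<rparr>"

definition free_shuffle_operad ::
    "(nat \<Rightarrow> 'g set) \<Rightarrow> ('k::field, ('g, nat) ptree \<Rightarrow>\<^sub>0 'k) shuffle_operad"
  where "free_shuffle_operad \<Gamma> =
    \<lparr>lin_scale = scale_poly_mapping,
     graded_part = (\<lambda>n. {f. Poly_Mapping.keys f \<subseteq> shuffle_monomials \<Gamma> n}),
     sh_unit = Poly_Mapping.single (Leaf 1) 1,
     sh_comp = (\<lambda>n m B. bilinear_extension (shuffle_graft n m B))\<rparr>"

text \<open>A presentation of \<open>P\<close> as a quotient of a free operad is a surjective morphism from the free operad;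
  the ideal of relations is its kernel.\<close>

definition ns_presentation ::
    "(nat \<Rightarrow> 'g set) \<Rightarrow> ('k::field, 'v::ab_group_add) ns_operad \<Rightarrow>
     (nat \<Rightarrow> (('g, unit) ptree \<Rightarrow>\<^sub>0 'k) \<Rightarrow> 'v) \<Rightarrow> bool"
  where "ns_presentation \<Gamma> P \<phi> \<longleftrightarrow>
    ns_operad_hom (free_ns_operad \<Gamma>) P \<phi> \<and> surjective_on_parts (free_ns_operad \<Gamma>) P \<phi>"

definition shuffle_corolla :: "nat \<Rightarrow> 'g \<Rightarrow> ('g, nat) ptree"
  where "shuffle_corolla n g = Node g (map Leaf [1..<n + 1])"

text \<open>The generating symmetric collection \<open>(E, \<epsilon>)\<close> comes with an equivariant map \<open>\<psi>\<close> to \<open>P\<close>, and the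
  generators are a linear basis of it.\<close>

definition symmetric_presentation ::
    "('k::field, 'e::ab_group_add) collection \<Rightarrow> (nat \<Rightarrow> (nat \<Rightarrow> nat) \<Rightarrow> 'e \<Rightarrow> 'e) \<Rightarrow>
     (nat \<Rightarrow> 'e set) \<Rightarrow> (nat \<Rightarrow> 'e \<Rightarrow> 'v) \<Rightarrow>
     ('k, 'v::ab_group_add) ns_operad \<Rightarrow> (nat \<Rightarrow> (nat \<Rightarrow> nat) \<Rightarrow> 'v \<Rightarrow> 'v) \<Rightarrow>
     (nat \<Rightarrow> (('e, nat) ptree \<Rightarrow>\<^sub>0 'k) \<Rightarrow> 'v) \<Rightarrow> bool"
  where "symmetric_presentation E \<epsilon> \<Gamma> \<psi> P \<rho> \<phi> \<longleftrightarrow>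
    symmetric_collection E \<epsilon> \<and>
    (\<forall>n\<ge>1. \<not> module.dependent (lin_scale E) (\<Gamma> n) \<and>
            module.span (lin_scale E) (\<Gamma> n) = graded_part E n) \<and>
    equivariant_hom E \<epsilon> P \<rho> \<psi> \<and>
    shuffle_operad_hom (free_shuffle_operad \<Gamma>) (shuffle_operad_of P \<rho>) \<phi> \<and>
    surjective_on_parts (free_shuffle_operad \<Gamma>) (shuffle_operad_of P \<rho>) \<phi> \<and>
    (\<forall>n\<ge>1. \<forall>g\<in>\<Gamma> n. \<phi> n (Poly_Mapping.single (shuffle_corolla n g) 1) = \<psi> n g)"


section \<open>Admissible orders and Groebner bases\<close>

text \<open>An order is a single reflexive relation \<open>r\<close> (\<open>(s, t) \<in> r\<close> meaning \<open>s \<le> t\<close>) of which only the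
  restrictions to the sets of monomials of a fixed arity matter.\<close>

definition well_ordered_by_arity :: "(nat \<Rightarrow> 'm set) \<Rightarrow> ('m \<times> 'm) set \<Rightarrow> bool"
  where "well_ordered_by_arity M r \<longleftrightarrow> (\<forall>n\<ge>1. well_order_on (M n) (r \<inter> M n \<times> M n))"

definition ns_admissible_order ::
    "(nat \<Rightarrow> 'g set) \<Rightarrow> (('g, unit) ptree \<times> ('g, unit) ptree) set \<Rightarrow> bool"
  where "ns_admissible_order \<Gamma> r \<longleftrightarrow> well_ordered_by_arity (ns_monomials \<Gamma>) r \<and>
    (\<forall>n m i s s' t t'. 1 \<le> i \<and> i \<le> n \<and> 1 \<le> m \<and>
        s \<in> ns_monomials \<Gamma> n \<and> s' \<in> ns_monomials \<Gamma> n \<and> (s, s') \<in> r \<and>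
        t \<in> ns_monomials \<Gamma> m \<and> t' \<in> ns_monomials \<Gamma> m \<and> (t, t') \<in> r \<longrightarrow>
      (ns_graft i s t, ns_graft i s' t') \<in> r)"

definition shuffle_admissible_order ::
    "(nat \<Rightarrow> 'g set) \<Rightarrow> (('g, nat) ptree \<times> ('g, nat) ptree) set \<Rightarrow> bool"
  where "shuffle_admissible_order \<Gamma> r \<longleftrightarrow> well_ordered_by_arity (shuffle_monomials \<Gamma>) r \<and>
    (\<forall>n m B s s' t t'. 1 \<le> n \<and> 1 \<le> m \<and> B \<in> shuffle_index n m \<and>
        s \<in> shuffle_monomials \<Gamma> n \<and> s' \<in> shuffle_monomials \<Gamma> n \<and> (s, s') \<in> r \<and>
        t \<in> shuffle_monomials \<Gamma> m \<and> t' \<in> shuffle_monomials \<Gamma> m \<and> (t, t') \<in> r \<longrightarrow>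
      (shuffle_graft n m B s t, shuffle_graft n m B s' t') \<in> r)"

definition leading_monomial :: "('m \<times> 'm) set \<Rightarrow> ('m \<Rightarrow>\<^sub>0 'k::zero) \<Rightarrow> 'm"
  where "leading_monomial r f =
    (THE m. m \<in> Poly_Mapping.keys f \<and> (\<forall>m'\<in>Poly_Mapping.keys f. (m', m) \<in> r))"

definition groebner_basis ::
    "('m \<Rightarrow> 'm \<Rightarrow> bool) \<Rightarrow> ('m \<times> 'm) set \<Rightarrow> (nat \<Rightarrow> ('m \<Rightarrow>\<^sub>0 'k::zero) set) \<Rightarrow> ('m \<Rightarrow>\<^sub>0 'k) set \<Rightarrow> bool"
  where "groebner_basis divides r C G \<longleftrightarrow>
    G \<subseteq> (\<Union>n\<in>{1..}. C n) \<and>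
    (\<forall>n\<ge>1. \<forall>f\<in>C n. f \<noteq> 0 \<longrightarrow>
      (\<exists>g\<in>G. g \<noteq> 0 \<and> divides (leading_monomial r g) (leading_monomial r f)))"

definition reduced_groebner_basis ::
    "('m \<Rightarrow> 'm \<Rightarrow> bool) \<Rightarrow> ('m \<times> 'm) set \<Rightarrow> (nat \<Rightarrow> ('m \<Rightarrow>\<^sub>0 'k::zero_neq_one) set) \<Rightarrow>
     ('m \<Rightarrow>\<^sub>0 'k) set \<Rightarrow> bool"
  where "reduced_groebner_basis divides r C G \<longleftrightarrow>
    groebner_basis divides r C G \<and>
    (\<forall>g\<in>G. g \<noteq> 0 \<and> Poly_Mapping.lookup g (leading_monomial r g) = 1) \<and>
    (\<forall>g\<in>G. \<forall>h\<in>G. h \<noteq> g \<longrightarrow>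
      (\<forall>m\<in>Poly_Mapping.keys g. \<not> divides (leading_monomial r h) m))"

definition shuffle_regular :: "(nat \<Rightarrow> 'g set) \<Rightarrow> ('g, nat) ptree set \<Rightarrow> bool"
  where "shuffle_regular \<Gamma> M \<longleftrightarrow>
    (\<forall>m\<in>M. \<forall>n\<ge>1. \<forall>m'\<in>shuffle_monomials \<Gamma> n. skeleton m' = skeleton m \<longrightarrow> m' \<in> M)"


section \<open>Growth and generating series\<close>

definition dims_bounded_by ::
    "('k::field, 'v::ab_group_add, 'z) collection_scheme \<Rightarrow> (nat \<Rightarrow> real) \<Rightarrow> bool"
  where "dims_bounded_by V b \<longleftrightarrow>
    (\<forall>n\<ge>1. finite_dimensional_part V n \<and> real (dim_part V n) \<le> b n)"

definition generating_series ::
    "('k::field, 'v::ab_group_add, 'z) collection_scheme \<Rightarrow> rat fps"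
  where "generating_series V = Abs_fps (\<lambda>n. if n = 0 then 0 else of_nat (dim_part V n))"

definition rational_series :: "'a::field fps \<Rightarrow> bool"
  where "rational_series F \<longleftrightarrow> (\<exists>p q. q \<noteq> 0 \<and> F * fps_of_poly q = fps_of_poly p)"

end

theory Submission
  imports Defs
begin

text \<open>
  By the linear algebra of Groebner bases, \<open>dim P(n)\<close> is the number of normal monomials of arity \<open>n\<close>. Whether
  a tree avoids finitely many patterns depends only on the truncations of its subtrees at a fixed
  depth, so the (skeletons of) normal monomials form a regular tree language, graded by arity. A
  production in which the class of the root recurs at two children would yield exponentially many trees,
  so in the non-symmetric case the generating functions of each strongly connected component of
  classes satisfy a linear system over those of lower components, and rationality follows by
  elimination.

  In the shuffle regular case every skeleton is counted with the number of its shuffle labellings. Now a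
  recursive child yields a factorial growth of this number unless it is the last child and all its
  siblings have arity \<open>1\<close>; such productions are again linear, and the non-recursive ones amount to
  shuffle products of power series, which preserve rationality.
\<close>

section \<open>Rational power series\<close>

unbundle fps_syntax

text \<open>The obstacle inside a component are unary vertices: they put constant terms into the
  matrix of the linear system, which might then be singular. But a cycle of unary vertices would
  give infinitely many trees of one arity, contrary to finite dimensionality; so constant terms
  occur only along an acyclic relation. Both cases share one argument through a factor
  \<open>c n m\<close>, attached to a child of arity \<open>n\<close> with siblings of total arity
  \<open>m\<close> on its right: constantly 1 for planar trees, \<open>block_choices n m\<close> for
  shuffle labellings, where the child gets the least available label and \<open>n - 1\<close> of the
  other \<open>n + m - 1\<close>. Removing that label turns the convolution into the shuffle
  product, i.e. the product of exponential generating functions; it preserves rationality because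
  the shifts of a rational series have a finite-dimensional span and the shift obeys the Leibniz
  rule. The exceptional role of the last child has the same source: \<open>block_choices n 0\<close>
  and \<open>block_choices 1 m\<close> are 1, whereas otherwise some factor is at least the arity of
  the recursive child.\<close>

lemma rational_series_of_poly: "rational_series (fps_of_poly p)"
  unfolding rational_series_def by (rule exI[of _ p], rule exI[of _ 1]) simp

lemma rational_series_0: "rational_series 0"
  using rational_series_of_poly[of 0] by simp

lemma rational_series_1: "rational_series 1"
  using rational_series_of_poly[of 1] by simp

lemma rational_series_const: "rational_series (fps_const c)"
  using rational_series_of_poly[of "[:c:]"] by (simp add: fps_of_poly_const)

lemma rational_series_X: "rational_series fps_X"
  using rational_series_of_poly[of "[:0, 1:]"] by (simp add: fps_of_poly_fps_X)

lemma rational_series_add: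
  assumes "rational_series F" "rational_series G" shows "rational_series (F + G)"
proof -
  obtain p q p' q' where "q \<noteq> 0" "F * fps_of_poly q = fps_of_poly p"
      "q' \<noteq> 0" "G * fps_of_poly q' = fps_of_poly p'"
    using assms unfolding rational_series_def by blast
  moreover have "(F + G) * fps_of_poly (q * q') =
      (F * fps_of_poly q) * fps_of_poly q' + (G * fps_of_poly q') * fps_of_poly q"
    by (simp add: fps_of_poly_mult algebra_simps)
  ultimately have "(F + G) * fps_of_poly (q * q') = fps_of_poly (p * q' + p' * q)" "q * q' \<noteq> 0"
    by (simp_all add: fps_of_poly_mult fps_of_poly_add)
  then show ?thesis unfolding rational_series_def by blast
qed

lemma rational_series_mult:
  assumes "rational_series F" "rational_series G" shows "rational_series (F * G)"
proof -
  obtain p q p' q' where "q \<noteq> 0" "F * fps_of_poly q = fps_of_poly p"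
      "q' \<noteq> 0" "G * fps_of_poly q' = fps_of_poly p'"
    using assms unfolding rational_series_def by blast
  moreover have "(F * G) * fps_of_poly (q * q') =
      (F * fps_of_poly q) * (G * fps_of_poly q')"
    by (simp add: fps_of_poly_mult algebra_simps)
  ultimately have "(F * G) * fps_of_poly (q * q') = fps_of_poly (p * p')" "q * q' \<noteq> 0"
    by (simp_all add: fps_of_poly_mult)
  then show ?thesis unfolding rational_series_def by blast
qed

lemma rational_series_inverse:
  fixes F :: "'a::field fps"
  assumes "rational_series F" "F $ 0 \<noteq> 0" shows "rational_series (inverse F)"
proof -
  obtain p q where q: "q \<noteq> 0" "F * fps_of_poly q = fps_of_poly p"
    using assms unfolding rational_series_def by blast
  have F: "inverse F * F = 1" using assms(2) by (simp add: inverse_mult_eq_1)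
  have "inverse F * fps_of_poly p = (inverse F * F) * fps_of_poly q"
    by (simp flip: q(2) add: mult.assoc)
  then have *: "inverse F * fps_of_poly p = fps_of_poly q" using F by simp
  then have "p \<noteq> 0" using q(1) by auto
  then show ?thesis unfolding rational_series_def using * by blast
qed

lemma rational_series_sum:
  "(\<And>i. i \<in> I \<Longrightarrow> rational_series (F i)) \<Longrightarrow> rational_series (sum F I)"
  by (induction I rule: infinite_finite_induct) (auto intro: rational_series_0 rational_series_add)

lemma rational_series_prod_list:
  "(\<And>F. F \<in> set Fs \<Longrightarrow> rational_series F) \<Longrightarrow> rational_series (prod_list Fs)"
  by (induction Fs) (auto intro: rational_series_1 rational_series_mult)

text \<open>Gaussian elimination. The relation \<open>R\<close> makes the matrix of constant terms strictly triangular, so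
  that all pivots \<open>1 - A x x\<close> are invertible power series.\<close>

lemma rational_linear_system:
  fixes y b :: "'i \<Rightarrow> 'a::field fps"
  assumes "finite K" "trans R" "irrefl R"
    and "\<And>i. i \<in> K \<Longrightarrow> y i = (\<Sum>j\<in>K. A i j * y j) + b i"
    and "\<And>i j. i \<in> K \<Longrightarrow> j \<in> K \<Longrightarrow> rational_series (A i j)"
    and "\<And>i. i \<in> K \<Longrightarrow> rational_series (b i)"
    and "\<And>i j. i \<in> K \<Longrightarrow> j \<in> K \<Longrightarrow> A i j $ 0 \<noteq> 0 \<Longrightarrow> (j, i) \<in> R"
    and "i \<in> K"
  shows "rational_series (y i)"
  using assms
proof (induction K arbitrary: A b i rule: finite_induct)
  case (insert x K)
  note eq = insert.prems(3) and ratA = insert.prems(4) and ratb = insert.prems(5)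
    and low = insert.prems(6)
  define u where "u = inverse (1 - A x x)"
  have "A x x $ 0 = 0" using low[of x x] \<open>irrefl R\<close> by (auto simp: irrefl_def)
  then have u0: "(1 - A x x) $ 0 \<noteq> 0" by simp
  have "rational_series (1 + fps_const (- 1) * A x x)"
    using ratA[of x x]
    by (intro rational_series_add rational_series_mult rational_series_1 rational_series_const) auto
  also have "1 + fps_const (- 1) * A x x = 1 - A x x" by (simp flip: fps_const_neg)
  finally have ratu: "rational_series u" unfolding u_def
    using u0 by (rule rational_series_inverse)
  have uu: "u * (1 - A x x) = 1" unfolding u_def using u0 by (rule inverse_mult_eq_1)
  have "(1 - A x x) * y x = (\<Sum>j\<in>K. A x j * y j) + b x"
    using eq[of x] insert.hyps by (simp add: algebra_simps)
  then have "u * (1 - A x x) * y x = u * ((\<Sum>j\<in>K. A x j * y j) + b x)"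
    by (simp add: mult.assoc)
  then have yx: "y x = u * ((\<Sum>j\<in>K. A x j * y j) + b x)" using uu by simp
  \<comment> \<open>The solved \<open>y x\<close> is substituted into the other equations. A new
    constant term at \<open>i\<close>, \<open>j\<close> needs those of \<open>A i x\<close> and
    \<open>A x j\<close>, so transitivity of \<open>R\<close> keeps the matrix triangular.\<close>
  define A' where "A' i j = A i j + A i x * u * A x j" for i j
  define b' where "b' i = b i + A i x * u * b x" for i
  have all: "rational_series (y i)" if "i \<in> K" for i
  proof (rule insert.IH[where A = A' and b = b'])
    fix i assume i: "i \<in> K"
    have "y i = A i x * y x + (\<Sum>j\<in>K. A i j * y j) + b i"
      using eq[of i] i insert.hyps by simp
    also have "A i x * y x = (\<Sum>j\<in>K. A i x * u * A x j * y j) + A i x * u * b x"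
      by (subst yx) (simp add: algebra_simps sum_distrib_left)
    finally show "y i = (\<Sum>j\<in>K. A' i j * y j) + b' i"
      by (simp add: A'_def b'_def algebra_simps sum.distrib)
    show "rational_series (b' i)"
      unfolding b'_def using i ratb ratA ratu
      by (auto intro!: rational_series_add rational_series_mult)
  next
    fix i j assume ij: "i \<in> K" "j \<in> K"
    then show "rational_series (A' i j)"
      unfolding A'_def using ratA ratu by (auto intro!: rational_series_add rational_series_mult)
    assume "A' i j $ 0 \<noteq> 0"
    then consider "A i j $ 0 \<noteq> 0" | "A i x $ 0 \<noteq> 0" "A x j $ 0 \<noteq> 0"
      by (cases "A i j $ 0 = 0") (auto simp: A'_def)
    then show "(j, i) \<in> R"
    proof cases
      case 2
      then have "(x, i) \<in> R" "(j, x) \<in> R" using low ij by auto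
      then show ?thesis using \<open>trans R\<close> by (meson transD)
    qed (use low ij in auto)
  qed (use that insert.prems in auto)
  show ?case
  proof (cases "i = x")
    case True
    have "rational_series (u * ((\<Sum>j\<in>K. A x j * y j) + b x))"
      using ratu ratA ratb all
      by (intro rational_series_mult rational_series_add rational_series_sum) auto
    then show ?thesis using True yx by simp
  qed (use all insert.prems in auto)
qed auto

text \<open>A finite family whose span is closed under the shift: writing each series as its
  constant term plus \<open>fps_X\<close> times its shift makes all coefficients of the linear
  system divisible by \<open>fps_X\<close>, so the empty relation serves as
  \<open>R\<close>.\<close>

lemma rational_shift_closed:
  fixes y :: "'i \<Rightarrow> 'a::field fps"
  assumes "finite K" and "\<And>i. i \<in> K \<Longrightarrow> fps_shift 1 (y i) = (\<Sum>j\<in>K. fps_const (c i j) * y j)"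
    and "i \<in> K"
  shows "rational_series (y i)"
proof (rule rational_linear_system[where R = "{}" and K = K and A = "\<lambda>i j. fps_X * fps_const (c i j)"
        and b = "\<lambda>i. fps_const (y i $ 0)"])
  fix i assume i: "i \<in> K"
  have "y i = fps_X * fps_shift 1 (y i) + fps_const (y i $ 0)"
    by (rule fps_ext) (simp add: fps_X_mult_nth)
  then show "y i = (\<Sum>j\<in>K. fps_X * fps_const (c i j) * y j) + fps_const (y i $ 0)"
    using assms(2)[OF i] by (simp add: sum_distrib_left mult.assoc)
qed (use assms in \<open>auto simp: trans_def irrefl_def
      intro!: rational_series_mult rational_series_X rational_series_const\<close>)

text \<open>The coefficients of \<open>F * q = p\<close> beyond the degree of \<open>p\<close> give
  a recurrence: finitely many shifts of \<open>F\<close> span all of them. This is the converse of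
  \<open>rational_shift_closed\<close>.\<close>

lemma rational_series_recurrence:
  fixes F :: "'a::field fps"
  assumes "rational_series F"
  obtains N c where "N > 0" "fps_shift N F = (\<Sum>j<N. fps_const (c j) * fps_shift j F)"
proof -
  obtain p q where q: "q \<noteq> 0" "F * fps_of_poly q = fps_of_poly p"
    using assms unfolding rational_series_def by blast
  \<comment> \<open>The denominator may vanish at 0, so the recurrence is normalised by its lowest
    nonzero coefficient.\<close>
  define k where "k = (LEAST i. coeff q i \<noteq> 0)"
  obtain i where "coeff q i \<noteq> 0" using q(1) by (auto simp: poly_eq_iff)
  then have k: "coeff q k \<noteq> 0" unfolding k_def by (rule LeastI)
  have less: "coeff q i = 0" if "i < k" for i using not_less_Least[of i "\<lambda>i. coeff q i \<noteq> 0"] that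
    by (auto simp: k_def)
  have kd: "k \<le> degree q" using k by (rule le_degree)
  \<comment> \<open>With this choice \<open>m + N + k\<close> exceeds \<open>degree p\<close>, and
    for \<open>i < m\<close> the index \<open>m + N + k - i\<close> exceeds
    \<open>degree q\<close>.\<close>
  define N where "N = degree p + degree q + 1 - k"
  have rec: "F $ (m + N) = (\<Sum>j<N. (- coeff q (N + k - j) / coeff q k) * F $ (m + j))" for m
  proof -
    have "(\<Sum>i=0..m + N + k. F $ i * coeff q (m + N + k - i)) = fps_of_poly p $ (m + N + k)"
      by (simp flip: q(2) add: fps_mult_nth)
    also have "\<dots> = 0" using kd by (auto simp: N_def intro!: coeff_eq_0)
    also have "(\<Sum>i=0..m + N + k. F $ i * coeff q (m + N + k - i)) =
        (\<Sum>i\<in>{m..m + N}. F $ i * coeff q (m + N + k - i))"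
    proof (rule sum.mono_neutral_right)
      show "\<forall>i\<in>{0..m + N + k} - {m..m + N}. F $ i * coeff q (m + N + k - i) = 0"
      proof
        fix i assume "i \<in> {0..m + N + k} - {m..m + N}"
        then consider "i < m" | "m + N < i" "i \<le> m + N + k" by fastforce
        then show "F $ i * coeff q (m + N + k - i) = 0"
        proof cases
          case 1 then show ?thesis using kd by (auto simp: N_def intro!: coeff_eq_0)
        next
          case 2 then show ?thesis by (auto intro!: less)
        qed
      qed
    qed auto
    also have "\<dots> = (\<Sum>j\<in>{..N}. F $ (m + j) * coeff q (N + k - j))"
      by (rule sum.reindex_bij_witness[of _ "\<lambda>j. m + j" "\<lambda>i. i - m"]) (auto simp: algebra_simps)
    also have "\<dots> = (\<Sum>j<N. F $ (m + j) * coeff q (N + k - j)) + F $ (m + N) * coeff q k"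
      by (simp flip: lessThan_Suc_atMost)
    finally have "F $ (m + N) * coeff q k = - (\<Sum>j<N. F $ (m + j) * coeff q (N + k - j))"
      by (simp add: add_eq_0_iff)
    then have "F $ (m + N) = - (\<Sum>j<N. F $ (m + j) * coeff q (N + k - j)) / coeff q k"
      using k by (simp add: field_simps)
    then show ?thesis by (simp add: sum_divide_distrib sum_negf mult.commute)
  qed
  show ?thesis
  proof (rule that[of N "\<lambda>j. - coeff q (N + k - j) / coeff q k"])
    show "N > 0" using kd by (simp add: N_def)
    show "fps_shift N F = (\<Sum>j<N. fps_const (- coeff q (N + k - j) / coeff q k) * fps_shift j F)"
      by (rule fps_ext) (simp add: rec fps_sum_nth)
  qed
qed

text \<open>The product of exponential generating functions, transported back to ordinary
  ones.\<close>

definition shuffle_product :: "'a::field_char_0 fps \<Rightarrow> 'a fps \<Rightarrow> 'a fps" where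
  "shuffle_product F G = Abs_fps (\<lambda>n. \<Sum>i\<le>n. of_nat (n choose i) * F $ i * G $ (n - i))"

text \<open>On exponential generating functions the shift is the derivative, so this is the Leibniz
  rule.\<close>

lemma shuffle_product_shift:
  fixes F G :: "'a::field_char_0 fps"
  shows "fps_shift 1 (shuffle_product F G) =
    shuffle_product (fps_shift 1 F) G + shuffle_product F (fps_shift 1 G)"
proof -
  define egf where "egf F = Abs_fps (\<lambda>n. F $ n / fact n)" for F :: "'a fps"
  define ogf where "ogf F = Abs_fps (\<lambda>n. F $ n * fact n)" for F :: "'a fps"
  have prod: "shuffle_product F G = ogf (egf F * egf G)" for F G
    by (rule fps_ext) (auto simp: shuffle_product_def ogf_def egf_def fps_mult_nth sum_distrib_right
        atLeast0AtMost binomial_fact intro!: sum.cong)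
  have egf: "egf (fps_shift 1 F) = fps_deriv (egf F)" for F
    by (rule fps_ext) (simp add: egf_def del: of_nat_Suc)
  have ogf: "fps_shift 1 (ogf F) = ogf (fps_deriv F)" for F
    by (rule fps_ext) (simp add: ogf_def algebra_simps)
  have "ogf (F + G) = ogf F + ogf G" for F G
    by (rule fps_ext) (simp add: ogf_def algebra_simps)
  then show ?thesis unfolding prod ogf egf by (simp add: algebra_simps)
qed

lemma shuffle_product_sum:
  "shuffle_product (\<Sum>k\<in>K. fps_const (c k) * F k) G =
    (\<Sum>k\<in>K. fps_const (c k) * shuffle_product (F k) G)"
  "shuffle_product G (\<Sum>k\<in>K. fps_const (c k) * F k) =
    (\<Sum>k\<in>K. fps_const (c k) * shuffle_product G (F k))"
  by (rule fps_ext, simp add: shuffle_product_def fps_sum_nth sum_distrib_left sum_distrib_right,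
      subst sum.swap, simp add: mult_ac)+

text \<open>The shuffle products of shifts of \<open>F\<close> with shifts of \<open>G\<close> have
  a finite-dimensional span, which by the Leibniz rule is closed under the shift.\<close>

lemma rational_series_shuffle_product:
  fixes F G :: "'a::field_char_0 fps"
  assumes "rational_series F" "rational_series G"
  shows "rational_series (shuffle_product F G)"
proof -
  obtain N c where N: "N > 0" "fps_shift N F = (\<Sum>j<N. fps_const (c j) * fps_shift j F)"
    using rational_series_recurrence[OF assms(1)] by blast
  obtain M d where M: "M > 0" "fps_shift M G = (\<Sum>j<M. fps_const (d j) * fps_shift j G)"
    using rational_series_recurrence[OF assms(2)] by blast
  \<comment> \<open>The companion matrix of a recurrence of length \<open>N\<close>: the action of
    the shift on the first \<open>N\<close> shifts.\<close>
  define C where "C N c i j = (if Suc i = N then c j else if j = Suc i then 1 else 0)"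
    for N i j :: nat and c :: "nat \<Rightarrow> 'a"
  have shift: "fps_shift 1 (fps_shift i F) = (\<Sum>j<N. fps_const (C N c i j) * fps_shift j F)"
    if "i < N" "fps_shift N F = (\<Sum>j<N. fps_const (c j) * fps_shift j F)" for i N c and F :: "'a fps"
  proof (cases "Suc i = N")
    case False
    then have "(\<Sum>j<N. fps_const (C N c i j) * fps_shift j F) =
        (\<Sum>j<N. if j = Suc i then fps_shift j F else 0)"
      by (intro sum.cong) (auto simp: C_def)
    then show ?thesis using that False by (simp add: fps_eq_iff)
  qed (use that in \<open>auto simp add: C_def fps_eq_iff\<close>)
  define h where "h = (\<lambda>(i, j). shuffle_product (fps_shift i F) (fps_shift j G))"
  define K where "K = {..<N} \<times> {..<M}"
  \<comment> \<open>The Kronecker sum of the two companion matrices.\<close>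
  define e where "e = (\<lambda>(i, j) (k, l).
    (if l = j then C N c i k else 0) + (if k = i then C M d j l else 0))"
  have "rational_series (h (0, 0))"
  proof (rule rational_shift_closed[where K = K and c = e])
    fix x assume "x \<in> K"
    then obtain i j where x: "x = (i, j)" "i < N" "j < M" by (auto simp: K_def)
    have "(\<Sum>y\<in>K. fps_const (e x y) * h y) = (\<Sum>k<N. \<Sum>l<M. fps_const (e x (k, l)) * h (k, l))"
      by (simp add: K_def sum.cartesian_product)
    also have "\<dots> = (\<Sum>k<N. \<Sum>l<M. if l = j then fps_const (C N c i k) * h (k, l) else 0) +
        (\<Sum>k<N. \<Sum>l<M. if k = i then fps_const (C M d j l) * h (k, l) else 0)"
      unfolding sum.distrib[symmetric]
      by (intro sum.cong refl) (auto simp: e_def x algebra_simps simp flip: fps_const_add)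
    also have "(\<Sum>k<N. \<Sum>l<M. if k = i then fps_const (C M d j l) * h (k, l) else 0) =
        (\<Sum>l<M. fps_const (C M d j l) * h (i, l))"
      using x by (subst sum.swap) simp
    also have "(\<Sum>k<N. \<Sum>l<M. if l = j then fps_const (C N c i k) * h (k, l) else 0) =
        (\<Sum>k<N. fps_const (C N c i k) * h (k, j))"
      using x by simp
    finally show "fps_shift 1 (h x) = (\<Sum>y\<in>K. fps_const (e x y) * h y)"
      unfolding x h_def prod.case shuffle_product_shift
      by (simp add: shift[OF x(2) N(2), unfolded One_nat_def]
          shift[OF x(3) M(2), unfolded One_nat_def] shuffle_product_sum)
  qed (use N M in \<open>auto simp: K_def\<close>)
  then show ?thesis by (simp add: h_def)
qed


section \<open>Contexts and weights of trees\<close>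

text \<open>A context is encoded by its filling function, so that nesting contexts is composition
  and no tree with a hole is needed.\<close>

inductive one_hole :: "(('g, 'l) ptree \<Rightarrow> ('g, 'l) ptree) \<Rightarrow> bool" where
  one_hole_id: "one_hole (\<lambda>t. t)"
| one_hole_Node: "one_hole C \<Longrightarrow> one_hole (\<lambda>t. Node g (us @ C t # vs))"

lemma one_hole_comp: "one_hole C \<Longrightarrow> one_hole D \<Longrightarrow> one_hole (\<lambda>t. C (D t))"
  by (induction rule: one_hole.induct) (auto intro: one_hole.intros)

lemma one_hole_leaves:
  assumes "one_hole C" obtains as bs where "\<And>t. leaves (C t) = as @ leaves t @ bs"
proof -
  from assms have "\<exists>as bs. \<forall>t. leaves (C t) = as @ leaves t @ bs"
  proof induction
    case one_hole_id
    show ?case by (rule exI[of _ "[]"], rule exI[of _ "[]"]) simp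
  next
    case (one_hole_Node C g us vs)
    then obtain as bs where *: "\<And>t. leaves (C t) = as @ leaves t @ bs" by blast
    show ?case
      by (rule exI[of _ "concat (map leaves us) @ as"], rule exI[of _ "bs @ concat (map leaves vs)"])
        (simp add: *)
  qed
  then show ?thesis using that by blast
qed

lemma one_hole_size: assumes "one_hole C" obtains k where "\<And>t. size (C t) = size t + k"
proof -
  from assms have "\<exists>k. \<forall>t. size (C t) = size t + k"
  proof induction
    case one_hole_id
    show ?case by (rule exI[of _ 0]) simp
  next
    case (one_hole_Node C g us vs)
    then obtain k where *: "\<And>t. size (C t) = size t + k" by blast
    show ?case
      by (rule exI[of _ "k + 2 + size_list size us + size_list size vs"]) (simp add: *)
  qed
  then show ?thesis using that by blast
qed

lemma one_hole_inj: "one_hole C \<Longrightarrow> C s = C t \<Longrightarrow> s = t"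
  by (induction arbitrary: s t rule: one_hole.induct) auto

abbreviation arity :: "('g, 'l) ptree \<Rightarrow> nat" where "arity t \<equiv> length (leaves t)"

lemma one_hole_arity: assumes "one_hole C" obtains k where "\<And>t. arity (C t) = arity t + k"
proof -
  obtain as bs where "\<And>t. leaves (C t) = as @ leaves t @ bs"
    using one_hole_leaves[OF assms] by blast
  then show ?thesis using that[of "length as + length bs"] by simp
qed

lemma leaves_neq_Nil: "labelled_by \<Gamma> t \<Longrightarrow> leaves t \<noteq> []"
proof (induction t)
  case (Node g ts)
  then show ?case by (cases ts) auto
qed simp

lemma arity_ge_1: "labelled_by \<Gamma> t \<Longrightarrow> arity t \<ge> 1"
  using leaves_neq_Nil[of \<Gamma> t] by (cases "leaves t") auto

text \<open>The pairs are the arities and weights of the trees of a forest. The second argument of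
  \<open>c\<close> is the total arity of what follows, because the labels of a tree are chosen among
  those of the whole remaining forest.\<close>

fun list_weight :: "(nat \<Rightarrow> nat \<Rightarrow> nat) \<Rightarrow> (nat \<times> nat) list \<Rightarrow> nat" where
  "list_weight c [] = 1"
| "list_weight c ((n, w) # ps) = c n (sum_list (map fst ps)) * w * list_weight c ps"

fun weight :: "(nat \<Rightarrow> nat \<Rightarrow> nat) \<Rightarrow> ('g, 'l) ptree \<Rightarrow> nat" where
  "weight c (Leaf a) = 1"
| "weight c (Node g ts) = list_weight c (map (\<lambda>t. (arity t, weight c t)) ts)"

text \<open>The first argument governs the way in which the trees of the forest are combined, the second one
  the weights of the trees themselves.\<close>

definition forest_weight ::
    "(nat \<Rightarrow> nat \<Rightarrow> nat) \<Rightarrow> (nat \<Rightarrow> nat \<Rightarrow> nat) \<Rightarrow> ('g, 'l) ptree list \<Rightarrow> nat" where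
  "forest_weight c' c ts = list_weight c' (map (\<lambda>t. (arity t, weight c t)) ts)"

abbreviation forest_arity :: "('g, 'l) ptree list \<Rightarrow> nat" where
  "forest_arity ts \<equiv> sum_list (map arity ts)"

lemma forest_weight_simps [simp]:
  "forest_weight c' c [] = 1"
  "forest_weight c' c (t # ts) =
    c' (arity t) (forest_arity ts) * weight c t * forest_weight c' c ts"
  by (simp_all add: forest_weight_def comp_def)

lemma weight_Node: "weight c (Node g ts) = forest_weight c c ts"
  by (simp add: forest_weight_def)

declare weight.simps(2) [simp del]


section \<open>Languages of trees defined by a finite congruence\<close>

text \<open>\<open>st\<close> is the run of a deterministic bottom-up tree automaton: label and
  states of the children decide membership of a vertex and its state. Since \<open>L\<close> is
  closed under children, states matter on \<open>L\<close> only. \<open>finite_arity\<close> is what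
  finite dimensionality provides.\<close>

locale tree_language =
  fixes L :: "('g, unit) ptree set" and st :: "('g, unit) ptree \<Rightarrow> 'q"
  assumes finite_states: "finite (st ` L)"
    and children: "Node g ts \<in> L \<Longrightarrow> ts \<noteq> [] \<and> set ts \<subseteq> L"
    and congruence:
      "\<lbrakk>Node g ts \<in> L; set ts' \<subseteq> L; map st ts' = map st ts\<rbrakk>
        \<Longrightarrow> Node g ts' \<in> L \<and> st (Node g ts') = st (Node g ts)"
    and finite_labels: "finite {(g, length ts) |g ts. Node g ts \<in> L}"
    and finite_arity: "finite {t \<in> L. arity t = n}"
begin

definition step :: "('q \<times> 'q) set" where
  "step = {(st t, st (Node g ts)) |g ts t. Node g ts \<in> L \<and> t \<in> set ts}"

text \<open>These steps add no leaf; in the linear system of a component only their entries can have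
  a constant term.\<close>

definition unary_step :: "('q \<times> 'q) set" where
  "unary_step = {(st t, st (Node g [t])) |g t. Node g [t] \<in> L}"

definition part :: "'q \<Rightarrow> nat \<Rightarrow> ('g, unit) ptree set" where
  "part X n = {t \<in> L. st t = X \<and> arity t = n}"

definition forests :: "'q list \<Rightarrow> nat \<Rightarrow> ('g, unit) ptree list set" where
  "forests Xs n = {ts. set ts \<subseteq> L \<and> map st ts = Xs \<and> forest_arity ts = n}"

text \<open>The rules of a grammar: by \<open>congruence\<close> a production can be expanded by
  every forest in \<open>L\<close> with these states.\<close>

definition productions :: "'q \<Rightarrow> ('g \<times> 'q list) set" where
  "productions X = {(g, map st ts) |g ts. Node g ts \<in> L \<and> st (Node g ts) = X}"

definition gf :: "(nat \<Rightarrow> nat \<Rightarrow> nat) \<Rightarrow> 'q \<Rightarrow> rat fps" where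
  "gf c X = Abs_fps (\<lambda>n. of_nat (\<Sum>t\<in>part X n. weight c t))"

definition forest_gf ::
    "(nat \<Rightarrow> nat \<Rightarrow> nat) \<Rightarrow> (nat \<Rightarrow> nat \<Rightarrow> nat) \<Rightarrow> 'q list \<Rightarrow> rat fps" where
  "forest_gf c' c Xs = Abs_fps (\<lambda>n. of_nat (\<Sum>ts\<in>forests Xs n. forest_weight c' c ts))"

lemma child_closed: "Node g ts \<in> L \<Longrightarrow> t \<in> set ts \<Longrightarrow> t \<in> L"
  using children by blast

lemma labelled: "t \<in> L \<Longrightarrow> labelled_by (\<lambda>_. UNIV) t"
proof (induction t)
  case (Node g ts)
  then show ?case using children[OF Node.prems] by auto
qed simp

lemma arity_pos: "t \<in> L \<Longrightarrow> arity t \<ge> 1"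
  using labelled arity_ge_1 by blast

lemma replace_child:
  assumes "Node g (us @ t # vs) \<in> L" "s \<in> L" "st s = st t"
  shows "Node g (us @ s # vs) \<in> L \<and> st (Node g (us @ s # vs)) = st (Node g (us @ t # vs))"
  using congruence[OF assms(1), of "us @ s # vs"] children[OF assms(1)] assms by auto

text \<open>Each edge of \<open>step\<close> comes from a vertex of some tree in \<open>L\<close>.
  Freezing its other children gives a context, which by \<open>congruence\<close> accepts every tree
  in state \<open>Y\<close>, not just the original child.\<close>

lemma step_context:
  assumes "(Y, X) \<in> step\<^sup>*"
  obtains C where "one_hole C" "\<And>t. t \<in> L \<Longrightarrow> st t = Y \<Longrightarrow> C t \<in> L \<and> st (C t) = X"
proof -
  from assms have "\<exists>C. one_hole C \<and> (\<forall>t\<in>L. st t = Y \<longrightarrow> C t \<in> L \<and> st (C t) = X)"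
  proof (induction rule: rtrancl_induct)
    case base
    show ?case by (rule exI[of _ "\<lambda>t. t"]) (auto intro: one_hole_id)
  next
    case (step Z X)
    then obtain C where C: "one_hole C" "\<And>t. t \<in> L \<Longrightarrow> st t = Y \<Longrightarrow> C t \<in> L \<and> st (C t) = Z"
      by blast
    from step(2) obtain g ts t where t: "Node g ts \<in> L" "t \<in> set ts" "Z = st t" "X = st (Node g ts)"
      by (auto simp: step_def)
    then obtain us vs where ts: "ts = us @ t # vs" by (meson split_list)
    have "Node g (us @ C s # vs) \<in> L \<and> st (Node g (us @ C s # vs)) = X" if "s \<in> L" "st s = Y" for s
      using replace_child[of g us t vs "C s"] C(2)[OF that] t ts by simp
    then show ?case using one_hole_Node[OF C(1), of g us vs] by blast
  qed
  then show ?thesis using that by blast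
qed

text \<open>As before, with contexts that add no leaf. The size is recorded because the arity no
  longer tells the iterates of a context apart.\<close>

lemma unary_step_context:
  assumes "(Y, X) \<in> unary_step\<^sup>+"
  obtains C k where "k > 0" "\<And>t. t \<in> L \<Longrightarrow> st t = Y \<Longrightarrow>
    C t \<in> L \<and> st (C t) = X \<and> arity (C t) = arity t \<and> size (C t) = size t + k"
proof -
  from assms have "\<exists>C k. k > 0 \<and> (\<forall>t\<in>L. st t = Y \<longrightarrow>
    C t \<in> L \<and> st (C t) = X \<and> arity (C t) = arity t \<and> size (C t) = size t + k)"
  proof (induction rule: trancl_induct)
    case (base X)
    then obtain g t where t: "Node g [t] \<in> L" "Y = st t" "X = st (Node g [t])"
      by (auto simp: unary_step_def)
    then show ?case using replace_child[of g "[]" t "[]"]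
      by (intro exI[of _ "\<lambda>s. Node g [s]"] exI[of _ "2"]) auto
  next
    case (step Z X)
    then obtain C k where C: "k > 0" "\<And>t. t \<in> L \<Longrightarrow> st t = Y \<Longrightarrow> 
      C t \<in> L \<and> st (C t) = Z \<and> arity (C t) = arity t \<and> size (C t) = size t + k"
      by blast
    from step(2) obtain g t where t: "Node g [t] \<in> L" "Z = st t" "X = st (Node g [t])"
      by (auto simp: unary_step_def)
    then show ?case using replace_child[of g "[]" t "[]"] C
      by (intro exI[of _ "\<lambda>s. Node g [C s]"] exI[of _ "k + 2"]) auto
  qed
  then show ?thesis using that by blast
qed

text \<open>A cycle of unary vertices could be repeated arbitrarily often without changing the arity.\<close>

lemma irrefl_unary_step: "irrefl (unary_step\<^sup>+)"
proof (rule irreflI, rule notI)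
  fix X assume X: "(X, X) \<in> unary_step\<^sup>+"
  from X have "X \<in> Domain unary_step" by (metis DomainI trancl_domain)
  then obtain t where t: "t \<in> L" "st t = X" using children by (force simp: unary_step_def)
  obtain C k where C: "k > 0" "\<And>t. t \<in> L \<Longrightarrow> st t = X \<Longrightarrow>
    C t \<in> L \<and> st (C t) = X \<and> arity (C t) = arity t \<and> size (C t) = size t + k"
    using unary_step_context[OF X] by blast
  have it: "(C ^^ n) t \<in> L \<and> st ((C ^^ n) t) = X \<and> arity ((C ^^ n) t) = arity t \<and>
      size ((C ^^ n) t) = size t + n * k" for n
    by (induction n) (auto simp: t C)
  have "inj (\<lambda>n. (C ^^ n) t)"
  proof (rule injI)
    fix m n assume "(C ^^ m) t = (C ^^ n) t"
    then have "size t + m * k = size t + n * k" using it by metis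
    then show "m = n" using C(1) by simp
  qed
  moreover have "range (\<lambda>n. (C ^^ n) t) \<subseteq> {s \<in> L. arity s = arity t}" using it by auto
  ultimately show False
    using finite_arity[of "arity t"] by (meson finite_subset infinite_UNIV_nat finite_imageD)
qed

section \<open>Generating functions of states and forests\<close>

lemma finite_part: "finite (part X n)"
  using finite_arity[of n] by (rule rev_finite_subset) (auto simp: part_def)

lemma forests_Nil: "forests [] n = (if n = 0 then {[]} else {})"
  by (auto simp: forests_def)

lemma forests_Cons:
  "bij_betw (\<lambda>(i, t, ts). t # ts) (SIGMA i:{..n}. part X i \<times> forests Xs (n - i)) (forests (X # Xs) n)"
  by (rule bij_betw_byWitness[where f' = "\<lambda>ts. (arity (hd ts), hd ts, tl ts)"])
    (auto simp: part_def forests_def)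

lemma finite_forests: "finite (forests Xs n)"
proof (induction Xs arbitrary: n)
  case (Cons X Xs)
  have "finite (SIGMA i:{..n}. part X i \<times> forests Xs (n - i))"
    by (intro finite_SigmaI finite_cartesian_product) (auto simp: finite_part Cons)
  then show ?case using bij_betw_finite[OF forests_Cons] by blast
qed (simp add: forests_Nil)

lemma forest_gf_Nil: "forest_gf c' c [] = 1"
  by (rule fps_ext) (simp add: forest_gf_def forests_Nil)

text \<open>This is the Cauchy product if \<open>c'\<close> is constantly 1, and a shifted shuffle
  product if it is \<open>block_choices\<close>.\<close>

lemma forest_gf_Cons:
  "forest_gf c' c (X # Xs) =
    Abs_fps (\<lambda>n. \<Sum>i\<le>n. of_nat (c' i (n - i)) * gf c X $ i * forest_gf c' c Xs $ (n - i))"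
proof (rule fps_ext)
  fix n
  have "(\<Sum>ts\<in>forests (X # Xs) n. forest_weight c' c ts) =
    (\<Sum>(i, t, ts)\<in>(SIGMA i:{..n}. part X i \<times> forests Xs (n - i)). forest_weight c' c (t # ts))"
    by (subst sum.reindex_bij_betw[OF forests_Cons, symmetric]) (simp add: case_prod_unfold)
  also have "\<dots> = (\<Sum>i\<le>n. \<Sum>p\<in>part X i \<times> forests Xs (n - i). forest_weight c' c (fst p # snd p))"
    by (subst sum.Sigma) (auto simp: case_prod_unfold finite_part finite_forests)
  also have "\<dots> = (\<Sum>i\<le>n. \<Sum>p\<in>part X i \<times> forests Xs (n - i).
      c' i (n - i) * (weight c (fst p) * forest_weight c' c (snd p)))"
    by (intro sum.cong refl) (auto simp: part_def forests_def)
  also have "\<dots> = (\<Sum>i\<le>n. c' i (n - i) *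
      ((\<Sum>t\<in>part X i. weight c t) * (\<Sum>ts\<in>forests Xs (n - i). forest_weight c' c ts)))"
    by (simp add: sum_product sum.cartesian_product case_prod_unfold del: sum_distrib_left
        flip: sum_distrib_left[where r = "c' _ _"])
  finally have eq: "(\<Sum>ts\<in>forests (X # Xs) n. forest_weight c' c ts) = \<dots>" .
  show "forest_gf c' c (X # Xs) $ n = Abs_fps
      (\<lambda>n. \<Sum>i\<le>n. of_nat (c' i (n - i)) * gf c X $ i * forest_gf c' c Xs $ (n - i)) $ n"
    unfolding forest_gf_def gf_def fps_nth_Abs_fps eq by (simp add: mult.assoc)
qed

lemma forest_gf_prod: "forest_gf (\<lambda>_ _. 1) c Xs = prod_list (map (gf c) Xs)"
  by (induction Xs)
    (auto simp: forest_gf_Nil forest_gf_Cons fps_eq_iff fps_mult_nth atLeast0AtMost)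

lemma gf_0: "gf c X $ 0 = 0"
  using arity_pos by (fastforce simp: gf_def part_def intro!: sum.neutral)

lemma finite_productions: "finite (productions X)"
proof -
  let ?S = "\<Union>p\<in>{(g, length ts) |g ts. Node g ts \<in> L}.
      {fst p} \<times> {Xs. set Xs \<subseteq> st ` L \<and> length Xs = snd p}"
  have "productions X \<subseteq> ?S"
  proof
    fix p assume "p \<in> productions X"
    then obtain g ts where p: "p = (g, map st ts)" "Node g ts \<in> L" by (auto simp: productions_def)
    show "p \<in> ?S"
      by (rule UN_I[of "(g, length ts)"]) (use p child_closed[OF p(2)] in auto)
  qed
  moreover have "finite ?S"
    by (intro finite_UN_I finite_labels finite_cartesian_product finite_lists_length_eq
        finite_states) auto
  ultimately show ?thesis by (rule finite_subset)
qed

text \<open>Unique decomposition at the root; \<open>congruence\<close> ensures that every forest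
  with the states of a production really occurs below that root.\<close>

lemma gf_eq:
  "gf c X = (if Leaf () \<in> L \<and> st (Leaf ()) = X then fps_X else 0) +
    (\<Sum>p\<in>productions X. forest_gf c c (snd p))"
proof (rule fps_ext)
  fix n
  let ?N = "{t \<in> part X n. \<exists>g ts. t = Node g ts}"
  let ?l = "{t \<in> part X n. t = Leaf ()}"
  have "bij_betw (\<lambda>(p, ts). Node (fst p) ts) (SIGMA p:productions X. forests (snd p) n) ?N"
  proof (rule bij_betw_byWitness[where
        f' = "\<lambda>t. case t of Node g ts \<Rightarrow> ((g, map st ts), ts) | Leaf a \<Rightarrow> undefined"])
    show "(\<lambda>(p, ts). Node (fst p) ts) ` (SIGMA p:productions X. forests (snd p) n) \<subseteq> ?N"
    proof (clarsimp simp: productions_def forests_def part_def)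
      fix g ts us assume "Node g us \<in> L" "set ts \<subseteq> L" "map st ts = map st us"
      then show "Node g ts \<in> L \<and> st (Node g ts) = st (Node g us) \<and>
        length (concat (map leaves ts)) = forest_arity ts"
        using congruence by (auto simp: length_concat comp_def)
    qed
    show "(\<lambda>t. case t of Leaf a \<Rightarrow> undefined | Node g ts \<Rightarrow> ((g, map st ts), ts)) ` ?N
      \<subseteq> (SIGMA p:productions X. forests (snd p) n)"
      by (auto simp: productions_def forests_def part_def length_concat comp_def
          intro: child_closed)
  qed (auto simp: forests_def)
  from sum.reindex_bij_betw[OF this, of "weight c", symmetric]
  have "(\<Sum>t\<in>?N. weight c t) =
      (\<Sum>x\<in>(SIGMA p:productions X. forests (snd p) n). forest_weight c c (snd x))"
    by (simp add: case_prod_unfold weight_Node)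
  also have "\<dots> = (\<Sum>p\<in>productions X. \<Sum>ts\<in>forests (snd p) n. forest_weight c c ts)"
    by (subst sum.Sigma) (auto simp: case_prod_unfold finite_productions finite_forests)
  finally have N: "(\<Sum>t\<in>?N. weight c t) = \<dots>" .
  have "part X n = ?l \<union> ?N" by (auto simp: part_def) (metis old.unit.exhaust ptree.exhaust)
  then have "(\<Sum>t\<in>part X n. weight c t) = (\<Sum>t\<in>?l. weight c t) + (\<Sum>t\<in>?N. weight c t)"
    using finite_part[of X n] by (subst sum.union_disjoint[symmetric]) auto
  also have "?l = (if Leaf () \<in> L \<and> st (Leaf ()) = X \<and> n = 1 then {Leaf ()} else {})"
    by (auto simp: part_def)
  finally have "(\<Sum>t\<in>part X n. weight c t) =
      (if Leaf () \<in> L \<and> st (Leaf ()) = X \<and> n = 1 then 1 else 0) + (\<Sum>t\<in>?N. weight c t)"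
    by auto
  then show "gf c X $ n = ((if Leaf () \<in> L \<and> st (Leaf ()) = X then fps_X else 0) +
    (\<Sum>p\<in>productions X. forest_gf c c (snd p))) $ n"
    by (simp add: gf_def forest_gf_def N fps_sum_nth flip: of_nat_sum)
qed

lemma step_if_production:
  assumes "(g, Xs) \<in> productions X" "Y \<in> set Xs"
  shows "(Y, X) \<in> step"
  using assms unfolding productions_def step_def by force

lemma production_closed: "(g, Xs) \<in> productions X \<Longrightarrow> Y \<in> set Xs \<Longrightarrow> Y \<in> st ` L"
  using child_closed by (auto simp: productions_def)

text \<open>By \<open>congruence\<close> every forest in \<open>L\<close> with states
  \<open>Xs\<close> is the list of children of a tree in \<open>L\<close> with root label
  \<open>g\<close>, so agreement of the weights on such lists suffices.\<close>

lemma forest_gf_cong: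
  assumes "(g, Xs) \<in> productions X"
    and "\<And>ts. Node g ts \<in> L \<Longrightarrow> map st ts = Xs \<Longrightarrow> forest_weight c' c ts = forest_weight c'' c ts"
  shows "forest_gf c' c Xs = forest_gf c'' c Xs"
proof -
  obtain ts where ts: "Node g ts \<in> L" "Xs = map st ts"
    using assms(1) by (auto simp: productions_def)
  show ?thesis
    unfolding forest_gf_def
    using assms(2) congruence[OF ts(1)] ts(2)
    by (intro arg_cong[where f = Abs_fps] ext arg_cong[where f = of_nat] sum.cong)
      (auto simp: forests_def)
qed

text \<open>The states are treated along the preorder given by \<open>step\<close>: the generating functions of one strongly
  connected component satisfy a linear system over those of the lower components, because a production
  has at most one child in the component of its root.\<close>

lemma rational_gf:
  assumes conv: "\<And>F G :: rat fps. rational_series F \<Longrightarrow> rational_series G \<Longrightarrow> F $ 0 = 0 \<Longrightarrow>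
      rational_series (Abs_fps (\<lambda>n. \<Sum>i\<le>n. of_nat (c i (n - i)) * F $ i * G $ (n - i)))"
    and weight: "\<And>g us t vs. Node g (us @ t # vs) \<in> L \<Longrightarrow>
      (st (Node g (us @ t # vs)), st t) \<in> step\<^sup>* \<Longrightarrow>
      forest_weight c c (us @ t # vs) = forest_weight (\<lambda>_ _. 1) c (us @ t # vs)"
    and unique: "\<And>g us t vs u. Node g (us @ t # vs) \<in> L \<Longrightarrow>
      (st (Node g (us @ t # vs)), st t) \<in> step\<^sup>* \<Longrightarrow> u \<in> set us \<union> set vs \<Longrightarrow>
      (st (Node g (us @ t # vs)), st u) \<notin> step\<^sup>*"
    and "X \<in> st ` L"
  shows "rational_series (gf c X)"
  using \<open>X \<in> st ` L\<close>
\<comment> \<open>The measure counts the states at or below \<open>X\<close>. It drops strictly on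
  leaving the component downwards, because \<open>X\<close> itself is lost.\<close>
proof (induction "card {Y \<in> st ` L. (Y, X) \<in> step\<^sup>*}" arbitrary: X rule: less_induct)
  case less
  define K where "K = {Z \<in> st ` L. (Z, X) \<in> step\<^sup>* \<and> (X, Z) \<in> step\<^sup>*}"
  \<comment> \<open>Affine in the generating functions of the component, with rational coefficients;
    constant terms are confined to \<open>unary_step\<^sup>+\<close>, the acyclic relation used for
    the elimination.\<close>
  define linear where "linear Z F \<longleftrightarrow> (\<exists>A b. (\<forall>Y\<in>K. rational_series (A Y)) \<and> rational_series b \<and>
      (\<forall>Y\<in>K. A Y $ 0 \<noteq> 0 \<longrightarrow> (Y, Z) \<in> unary_step\<^sup>+) \<and> F = (\<Sum>Y\<in>K. A Y * gf c Y) + b)" for Z F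
  have "finite K" using finite_states by (simp add: K_def)
  have linear_rational: "linear Z F" if "rational_series F" for Z F
    unfolding linear_def
    by (rule exI[of _ "\<lambda>_. 0"], rule exI[of _ F]) (auto simp: that rational_series_0)
  have linear_add: "linear Z (F + G)" if F: "linear Z F" and G: "linear Z G" for Z F G
  proof -
    from F obtain A b where A: "\<forall>Y\<in>K. rational_series (A Y)" "rational_series b"
      "\<forall>Y\<in>K. A Y $ 0 \<noteq> 0 \<longrightarrow> (Y, Z) \<in> unary_step\<^sup>+" "F = (\<Sum>Y\<in>K. A Y * gf c Y) + b"
      unfolding linear_def by blast
    from G obtain A' b' where A': "\<forall>Y\<in>K. rational_series (A' Y)" "rational_series b'"
      "\<forall>Y\<in>K. A' Y $ 0 \<noteq> 0 \<longrightarrow> (Y, Z) \<in> unary_step\<^sup>+" "G = (\<Sum>Y\<in>K. A' Y * gf c Y) + b'"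
      unfolding linear_def by blast
    have "\<forall>Y\<in>K. (A Y + A' Y) $ 0 \<noteq> 0 \<longrightarrow> (Y, Z) \<in> unary_step\<^sup>+"
      using A(3) A'(3) by (metis add_0 fps_add_nth)
    then show ?thesis unfolding linear_def using A A'
      by (intro exI[of _ "\<lambda>Y. A Y + A' Y"] exI[of _ "b + b'"])
        (auto simp: rational_series_add algebra_simps sum.distrib)
  qed
  have linear_sum: "linear Z (sum F I)" if "\<And>i. i \<in> I \<Longrightarrow> linear Z (F i)"
    for Z I and F :: "'g \<times> 'q list \<Rightarrow> rat fps"
    using that by (induction I rule: infinite_finite_induct)
      (auto intro: linear_add linear_rational rational_series_0)
  have lower: "rational_series (gf c Y)"
    if "Z \<in> K" "(g, Xs) \<in> productions Z" "Y \<in> set Xs" "(Z, Y) \<notin> step\<^sup>*" for Y Z g Xs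
  proof -
    have Y: "Y \<in> st ` L" "(Y, Z) \<in> step" using production_closed step_if_production that by auto
    have X: "X \<in> {W \<in> st ` L. (W, X) \<in> step\<^sup>*}" using less.prems by auto
    have "{W \<in> st ` L. (W, Y) \<in> step\<^sup>*} \<subseteq> {W \<in> st ` L. (W, X) \<in> step\<^sup>*}"
      using Y \<open>Z \<in> K\<close> by (auto simp: K_def intro: rtrancl_trans)
    moreover have "X \<notin> {W \<in> st ` L. (W, Y) \<in> step\<^sup>*}"
      using that \<open>Z \<in> K\<close> by (auto simp: K_def intro: rtrancl_trans)
    ultimately have "{W \<in> st ` L. (W, Y) \<in> step\<^sup>*} \<subset> {W \<in> st ` L. (W, X) \<in> step\<^sup>*}"
      using X by blast
    then have "card {W \<in> st ` L. (W, Y) \<in> step\<^sup>*} < card {W \<in> st ` L. (W, X) \<in> step\<^sup>*}"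
      using finite_states by (intro psubset_card_mono) auto
    then show ?thesis using less.hyps Y by blast
  qed
  have linear_production: "linear Z (forest_gf c c Xs)"
    if Z: "Z \<in> K" and p: "(g, Xs) \<in> productions Z" for Z g Xs
  proof (cases "\<exists>Y\<in>set Xs. (Z, Y) \<in> step\<^sup>*")
    case False
    then have "\<forall>Y\<in>set Xs. rational_series (gf c Y)" using lower[OF Z p] by blast
    then have "rational_series (forest_gf c c Xs)"
      by (induction Xs) (auto simp: forest_gf_Nil forest_gf_Cons rational_series_1 gf_0 intro!: conv)
    then show ?thesis by (rule linear_rational)
  next
    case True
    then obtain As Y Bs where Xs: "Xs = As @ Y # Bs" "(Z, Y) \<in> step\<^sup>*" by (meson split_list)
    \<comment> \<open>The hypotheses speak of single trees; \<open>congruence\<close> gives every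
      tree that expands the production the root state \<open>Z\<close>, so they hold for the
      production as a whole.\<close>
    have node: "forest_weight c c ts = forest_weight (\<lambda>_ _. 1) c ts \<and>
        (\<forall>W\<in>set As \<union> set Bs. (Z, W) \<notin> step\<^sup>*)"
      if ts: "Node g ts \<in> L" "map st ts = Xs" for ts
    proof -
      from p obtain ts' where ts': "Node g ts' \<in> L" "Xs = map st ts'" "st (Node g ts') = Z"
        by (auto simp: productions_def)
      have st: "st (Node g ts) = Z"
        using congruence[OF ts'(1), of ts] ts ts' child_closed[OF ts(1)] by auto
      obtain us t vs where split: "ts = us @ t # vs" "map st us = As" "st t = Y" "map st vs = Bs"
        using ts(2) Xs(1) by (auto simp: map_eq_append_conv)
      show ?thesis
        using weight[of g us t vs] unique[of g us t vs] ts(1) st Xs(2) split by auto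
    qed
    have "\<forall>W\<in>set As \<union> set Bs. (Z, W) \<notin> step\<^sup>*" using p node by (auto simp: productions_def)
    then have rat: "\<forall>W\<in>set (As @ Bs). rational_series (gf c W)"
      using lower[OF Z p] Xs by auto
    define a where "a = prod_list (map (gf c) (As @ Bs))"
    have "rational_series a"
      unfolding a_def using rat by (intro rational_series_prod_list) auto
    have "Y \<in> K"
      using Z Xs(2) step_if_production[OF p, of Y] production_closed[OF p, of Y] Xs(1)
      by (auto simp: K_def intro: rtrancl_trans r_into_rtrancl)
    \<comment> \<open>Every tree has a leaf, so a sibling contributes a series without constant
      term; a constant term of the product means that there is no sibling.\<close>
    have Y: "(Y, Z) \<in> unary_step\<^sup>+" if "a $ 0 \<noteq> 0"
    proof -
      have "As @ Bs = []" using that by (cases "As @ Bs") (auto simp: a_def gf_0)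
      then have "Xs = [Y]" using Xs by simp
      then show ?thesis using p by (auto simp: productions_def unary_step_def)
    qed
    have "forest_gf c c Xs = forest_gf (\<lambda>_ _. 1) c Xs" using forest_gf_cong[OF p] node by blast
    also have "\<dots> = a * gf c Y" by (simp add: forest_gf_prod Xs a_def mult_ac del: One_nat_def)
    also have "\<dots> = (\<Sum>W\<in>K. (if W = Y then a else 0) * gf c W) + 0"
      using \<open>Y \<in> K\<close> \<open>finite K\<close> by (simp add: if_distrib[of "\<lambda>x. x * _"] cong: if_cong)
    finally show ?thesis unfolding linear_def
      using \<open>rational_series a\<close> Y rational_series_0
      by (intro exI[of _ "\<lambda>W. if W = Y then a else 0"] exI[of _ 0]) auto
  qed
  have "linear Z (gf c Z)" if Z: "Z \<in> K" for Z
  proof (subst gf_eq, intro linear_add linear_sum)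
    show "linear Z (if Leaf () \<in> L \<and> st (Leaf ()) = Z then fps_X else 0)"
      by (intro linear_rational) (auto simp: rational_series_X rational_series_0)
    show "linear Z (forest_gf c c (snd p))" if "p \<in> productions Z" for p
      using linear_production[OF Z, of "fst p" "snd p"] that by simp
  qed
  then obtain A b where "\<forall>Z\<in>K. (\<forall>Y\<in>K. rational_series (A Z Y)) \<and> rational_series (b Z) \<and>
      (\<forall>Y\<in>K. A Z Y $ 0 \<noteq> 0 \<longrightarrow> (Y, Z) \<in> unary_step\<^sup>+) \<and> gf c Z = (\<Sum>Y\<in>K. A Z Y * gf c Y) + b Z"
    unfolding linear_def by metis
  then show ?case
    using \<open>finite K\<close> less.prems irrefl_unary_step
    by (intro rational_linear_system[of K "unary_step\<^sup>+" "gf c" A b X])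
      (auto simp: K_def)
qed

lemma rational_total_gf:
  assumes "\<And>X. X \<in> st ` L \<Longrightarrow> rational_series (gf c X)"
  shows "rational_series (Abs_fps (\<lambda>n. of_nat (\<Sum>t\<in>{t \<in> L. arity t = n}. weight c t)) :: rat fps)"
proof -
  have "(\<Sum>t\<in>{t \<in> L. arity t = n}. weight c t) = (\<Sum>X\<in>st ` L. \<Sum>t\<in>part X n. weight c t)" for n
  proof -
    have "{t \<in> L. arity t = n} = (\<Union>X\<in>st ` L. part X n)" by (auto simp: part_def)
    moreover have "(\<Sum>t\<in>(\<Union>X\<in>st ` L. part X n). weight c t) =
        (\<Sum>X\<in>st ` L. \<Sum>t\<in>part X n. weight c t)"
      by (rule sum.UNION_disjoint[OF finite_states])
        (use finite_part in simp, auto simp: part_def)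
    ultimately show ?thesis by simp
  qed
  then have "Abs_fps (\<lambda>n. of_nat (\<Sum>t\<in>{t \<in> L. arity t = n}. weight c t)) =
      (\<Sum>X\<in>st ` L. gf c X)"
    by (auto simp: fps_eq_iff gf_def fps_sum_nth simp flip: of_nat_sum)
  then show ?thesis using assms by (simp add: rational_series_sum)
qed

text \<open>Both children can be led back to the state of the root. The current tree is plugged in
  at one of the two places and a fixed tree at the other, so every round offers a binary choice
  while the arity grows by a constant.\<close>

lemma exponential_growth:
  assumes node: "Node g (us @ a # vs @ b # ws) \<in> L"
    and a: "(st (Node g (us @ a # vs @ b # ws)), st a) \<in> step\<^sup>*"
    and b: "(st (Node g (us @ a # vs @ b # ws)), st b) \<in> step\<^sup>*"
  obtains p q where "\<And>k. 2 ^ k \<le> card {t \<in> L. arity t = p + k * q}"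
proof -
  let ?t = "Node g (us @ a # vs @ b # ws)"
  define X where "X = st ?t"
  obtain C where C: "one_hole C" "\<And>t. t \<in> L \<Longrightarrow> st t = X \<Longrightarrow> C t \<in> L \<and> st (C t) = st a"
    using step_context[OF a] X_def by blast
  obtain D where D: "one_hole D" "\<And>t. t \<in> L \<Longrightarrow> st t = X \<Longrightarrow> D t \<in> L \<and> st (D t) = st b"
    using step_context[OF b] X_def by blast
  define f where "f s t = Node g (us @ C s # vs @ D t # ws)" for s t
  have f: "f s t \<in> L \<and> st (f s t) = X" if "s \<in> L" "st s = X" "t \<in> L" "st t = X" for s t
    unfolding f_def X_def using C(2)[of s] D(2)[of t] that child_closed[OF node]
    by (intro congruence[OF node]) auto
  have f_inj: "s = s' \<and> t = t'" if "f s t = f s' t'" for s t s' t'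
  proof -
    have "C s = C s'" "D t = D t'" using that by (simp_all add: f_def)
    then show ?thesis using one_hole_inj C(1) D(1) by blast
  qed
  obtain k l where kl: "\<And>t. size (C t) = size t + k" "\<And>t. size (D t) = size t + l"
    using one_hole_size C(1) D(1) by metis
  have f_size: "size s < size (f s t)" "size t < size (f s t)" for s t
    by (simp_all add: f_def kl)
  obtain k l where kl: "\<And>t. arity (C t) = arity t + k" "\<And>t. arity (D t) = arity t + l"
    using one_hole_arity C(1) D(1) by metis
  define e where "e = forest_arity us + forest_arity vs + forest_arity ws + k + l"
  have f_arity: "arity (f s t) = arity s + arity t + e" for s t
    by (simp add: f_def e_def kl length_concat comp_def)
  define r where "r = Node g (us @ a # vs @ b # ws)"
  \<comment> \<open>The start is \<open>f r r\<close> and not \<open>r\<close>: the growing tree is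
    then always larger than \<open>r\<close>, and the place where \<open>r\<close> stands reveals
    the bit.\<close>
  define h where "h = rec_list (f r r) (\<lambda>x (xs :: bool list) s. if x then f s r else f r s)"
  have h: "h [] = f r r" "h (x # xs) = (if x then f (h xs) r else f r (h xs))" for x xs
    by (simp_all add: h_def)
  have t: "r \<in> L" "st r = X" using node by (simp_all add: X_def r_def)
  have h_L: "h xs \<in> L \<and> st (h xs) = X" for xs
    by (induction xs) (simp_all add: h f t)
  have h_arity: "arity (h xs) = 2 * arity r + e + length xs * (arity r + e)" for xs
    by (induction xs) (simp_all add: h f_arity)
  have h_size: "size r < size (h xs)" for xs
  proof (induction xs)
    case (Cons x xs)
    have "size (h xs) < size (h (x # xs))" by (simp add: h f_size)
    then show ?case using Cons by linarith
  qed (simp add: h f_size)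
  have h_inj: "xs = ys" if "length xs = length ys" "h xs = h ys" for xs ys
    using that
  proof (induction xs ys rule: list_induct2)
    case (Cons x xs y ys)
    have "h xs \<noteq> r" "h ys \<noteq> r" using h_size by (metis less_irrefl)+
    then have "x = y \<and> h xs = h ys"
      using Cons.prems f_inj[of "h xs" r "h ys" r] f_inj[of "h xs" r r "h ys"]
        f_inj[of r "h xs" "h ys" r] f_inj[of r "h xs" r "h ys"]
      by (auto simp: h split: if_splits)
    then show ?case using Cons.IH by simp
  qed simp
  have "2 ^ k \<le> card {t \<in> L. arity t = (2 * arity r + e) + k * (arity r + e)}" for k
  proof -
    let ?W = "{xs :: bool list. set xs \<subseteq> UNIV \<and> length xs = k}"
    have "2 ^ k = card ?W" by (subst card_lists_length_eq) auto
    also have "\<dots> = card (h ` ?W)" using h_inj by (intro card_image[symmetric] inj_onI) auto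
    also have "\<dots> \<le> card {t \<in> L. arity t = (2 * arity r + e) + k * (arity r + e)}"
      using h_L h_arity finite_arity by (intro card_mono) auto
    finally show ?thesis .
  qed
  then show ?thesis using that by blast
qed

end


section \<open>Weights counting shuffle labellings\<close>

text \<open>The number of label sets for a subtree of arity \<open>m\<close> whose siblings to the
  right take \<open>n\<close> labels: the least label is forced, since minima increase from left to
  right, and \<open>m - 1\<close> of the others are free.\<close>

definition block_choices :: "nat \<Rightarrow> nat \<Rightarrow> nat" where
  "block_choices m n = (m + n - 1) choose (m - 1)"

lemma binomial_ge_Suc: "a \<ge> 1 \<Longrightarrow> (a + b) choose a \<ge> b + 1"
proof (induction a)
  case (Suc a)
  then show ?case by (cases "a = 0") (auto simp: Suc_le_eq)
qed simp

text \<open>The last two bounds cause the factorial growth: a left sibling of arity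
  \<open>m \<ge> 2\<close> has at least as many choices as there are labels to its right, and a
  child of arity \<open>m\<close> with something to its right has at least \<open>m\<close>.\<close>

lemma block_choices_ge:
  "m \<ge> 1 \<Longrightarrow> block_choices m n \<ge> 1"
  "m \<ge> 2 \<Longrightarrow> block_choices m n \<ge> n"
  "m \<ge> 1 \<Longrightarrow> n \<ge> 1 \<Longrightarrow> block_choices m n \<ge> m"
proof -
  assume "m \<ge> 1"
  then show "block_choices m n \<ge> 1" by (simp add: block_choices_def Suc_le_eq)
next
  assume "m \<ge> 2"
  then have "m - 1 \<ge> 1" "m - 1 + n = m + n - 1" by auto
  then show "block_choices m n \<ge> n"
    using binomial_ge_Suc[of "m - 1" n] by (simp add: block_choices_def)
next
  assume "m \<ge> 1" "n \<ge> 1"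
  moreover from this have "(m + n - 1) choose (m - 1) = (m + n - 1) choose n"
    by (subst binomial_symmetric) auto
  ultimately show "block_choices m n \<ge> m"
    using binomial_ge_Suc[of n "m - 1"] by (simp add: block_choices_def add.commute)
qed

lemma block_choices_1 [simp]: "block_choices (Suc 0) n = 1" "m \<ge> 1 \<Longrightarrow> block_choices m 0 = 1"
  by (simp_all add: block_choices_def)

abbreviation shuffle_weight :: "('g, 'l) ptree \<Rightarrow> nat" where
  "shuffle_weight \<equiv> weight block_choices"

abbreviation shuffle_forest_weight :: "('g, 'l) ptree list \<Rightarrow> nat" where
  "shuffle_forest_weight \<equiv> forest_weight block_choices block_choices"

lemma shuffle_weight_pos: "labelled_by \<Gamma> t \<Longrightarrow> shuffle_weight t \<ge> 1"
proof (induction t)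
  case (Node g ts)
  then have "\<forall>t\<in>set ts. shuffle_weight t \<ge> 1 \<and> arity t \<ge> 1"
    using arity_ge_1[of \<Gamma>] by auto
  then have "shuffle_forest_weight ts \<ge> 1"
    by (induction ts) (use block_choices_ge(1) in \<open>auto simp: Suc_le_eq\<close>)
  then show ?case by (simp add: weight_Node)
qed simp

context tree_language
begin

lemma weight_pos: "t \<in> L \<Longrightarrow> shuffle_weight t \<ge> 1"
  using labelled shuffle_weight_pos by blast

lemma forest_weight_pos:
  "set ts \<subseteq> L \<Longrightarrow> shuffle_forest_weight ts \<ge> 1"
  by (induction ts) (use block_choices_ge(1) arity_pos weight_pos in \<open>auto simp: Suc_le_eq\<close>)

lemma forest_arity_pos: "set ts \<subseteq> L \<Longrightarrow> ts \<noteq> [] \<Longrightarrow> forest_arity ts \<ge> 1"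
  using arity_pos by (cases ts) force+

text \<open>If something stands to the right of \<open>t\<close>, the factor of \<open>t\<close> is
  at least its arity. If a sibling to the left has arity at least 2, its factor is at least the
  total arity to its right, which includes that of \<open>t\<close>. All other factors are at least
  1.\<close>

lemma forest_weight_ge:
  assumes "set us \<union> set vs \<subseteq> L" "t \<in> L"
  shows "shuffle_forest_weight (us @ t # vs) \<ge> shuffle_weight t *
    (if vs \<noteq> [] \<or> (\<exists>u\<in>set us. arity u \<ge> 2) then arity t else 1)"
  using assms
proof (induction us)
  case Nil
  have "block_choices (arity t) (forest_arity vs) \<ge> (if vs \<noteq> [] then arity t else 1)"
    using block_choices_ge forest_arity_pos[of vs] arity_pos[of t] Nil by auto
  moreover have "shuffle_forest_weight vs \<ge> 1"
    using forest_weight_pos[of vs] Nil by auto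
  ultimately have "(if vs \<noteq> [] then arity t else 1) * shuffle_weight t * 1 \<le>
      block_choices (arity t) (forest_arity vs) * shuffle_weight t *
      shuffle_forest_weight vs"
    by (intro mult_mono) auto
  then show ?case by (auto simp: mult.commute)
next
  case (Cons u us)
  let ?w = "shuffle_forest_weight (us @ t # vs)"
  have IH: "?w \<ge> shuffle_weight t *
    (if vs \<noteq> [] \<or> (\<exists>u\<in>set us. arity u \<ge> 2) then arity t else 1)" using Cons by simp
  have u: "shuffle_weight u \<ge> 1" "arity u \<ge> 1" using weight_pos arity_pos Cons.prems by auto
  have eq: "shuffle_forest_weight ((u # us) @ t # vs) =
      block_choices (arity u) (forest_arity (us @ t # vs)) * shuffle_weight u * ?w"
    by simp
  show ?case
  proof (cases "arity u \<ge> 2")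
    case True
    have "shuffle_weight t * 1 \<le> shuffle_weight t *
        (if vs \<noteq> [] \<or> (\<exists>u\<in>set us. arity u \<ge> 2) then arity t else 1)"
      using arity_pos[of t] Cons.prems by (intro mult_left_mono) auto
    then have "shuffle_weight t * 1 \<le> ?w" using IH by linarith
    moreover have "arity t \<le> block_choices (arity u) (forest_arity (us @ t # vs))"
      using block_choices_ge(2)[OF True, of "forest_arity (us @ t # vs)"] by simp
    ultimately have "arity t * 1 * (shuffle_weight t * 1) \<le>
        block_choices (arity u) (forest_arity (us @ t # vs)) * shuffle_weight u * ?w"
      using u by (intro mult_mono) auto
    then show ?thesis unfolding eq using True by (simp add: mult.commute)
  next
    case False
    then have cond: "(\<exists>v\<in>set (u # us). arity v \<ge> 2) \<longleftrightarrow> (\<exists>v\<in>set us. arity v \<ge> 2)" by simp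
    have "1 * 1 * ?w \<le> block_choices (arity u) (forest_arity (us @ t # vs)) *
        shuffle_weight u * ?w"
      using u block_choices_ge(1) by (intro mult_mono) auto
    then show ?thesis unfolding eq cond using IH by linarith
  qed
qed

lemma weight_context_ge:
  assumes "one_hole C" "C t \<in> L"
  shows "shuffle_weight (C t) \<ge> shuffle_weight t \<and> t \<in> L"
  using assms
proof induction
  case (one_hole_Node C g us vs)
  note L = child_closed[OF one_hole_Node.prems]
  then have "C t \<in> L" by simp
  then have "shuffle_weight t \<le> shuffle_weight (C t)" "t \<in> L"
    using one_hole_Node.IH by auto
  moreover have "shuffle_weight (C t) \<le>
      shuffle_forest_weight (us @ C t # vs)"
  proof -
    have "shuffle_weight (C t) * 1 \<le> shuffle_weight (C t) *
        (if vs \<noteq> [] \<or> (\<exists>u\<in>set us. arity u \<ge> 2) then arity (C t) else 1)"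
      using arity_pos[OF \<open>C t \<in> L\<close>] by (intro mult_left_mono) auto
    also have "\<dots> \<le> shuffle_forest_weight (us @ C t # vs)"
      using L by (intro forest_weight_ge) auto
    finally show ?thesis by simp
  qed
  ultimately show ?case by (simp add: weight_Node)
qed simp

text \<open>One round through the context multiplies the weight by at least the current arity and
  raises the arity by at least 1, so \<open>k\<close> rounds collect a factorial.\<close>

lemma factorial_growth:
  assumes node: "Node g (us @ a # vs) \<in> L"
    and a: "(st (Node g (us @ a # vs)), st a) \<in> step\<^sup>*"
    and bad: "vs \<noteq> [] \<or> (\<exists>u\<in>set us. arity u \<ge> 2)"
  obtains p q where
    "\<And>k. fact k \<le> (\<Sum>t\<in>{t \<in> L. arity t = p + k * q}. shuffle_weight t)"
proof -
  let ?t = "Node g (us @ a # vs)"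
  define X where "X = st ?t"
  obtain C where C: "one_hole C" "\<And>t. t \<in> L \<Longrightarrow> st t = X \<Longrightarrow> C t \<in> L \<and> st (C t) = st a"
    using step_context[OF a] X_def by blast
  define f where "f s = Node g (us @ C s # vs)" for s
  have f: "f s \<in> L \<and> st (f s) = X" if "s \<in> L" "st s = X" for s
    unfolding f_def X_def using C(2)[of s] that by (intro replace_child[OF node]) auto
  obtain k where k: "\<And>t. arity (C t) = arity t + k" using one_hole_arity C(1) by metis
  define e where "e = forest_arity us + forest_arity vs + k"
  \<comment> \<open>Either alternative of \<open>bad\<close> provides a sibling, whose leaves make
    the arity grow in each round.\<close>
  have "us \<noteq> [] \<or> vs \<noteq> []" using bad by auto
  then have "e \<ge> 1" using forest_arity_pos[of us] forest_arity_pos[of vs] child_closed[OF node]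
    by (auto simp: e_def subset_iff)
  have f_arity: "arity (f s) = arity s + e" for s
    by (simp add: f_def e_def k length_concat comp_def)
  have f_weight: "shuffle_weight (f s) \<ge> shuffle_weight s * arity s"
    if "s \<in> L" "st s = X" for s
  proof -
    have "C s \<in> L" using C that by blast
    have "shuffle_weight s * arity s \<le> shuffle_weight (C s) * arity (C s)"
      using weight_context_ge[OF C(1) \<open>C s \<in> L\<close>] k by (intro mult_mono) auto
    also have "\<dots> \<le> shuffle_weight (f s)"
      using forest_weight_ge[of us vs "C s"] bad \<open>C s \<in> L\<close> child_closed[OF node]
      by (auto simp: f_def weight_Node)
    finally show ?thesis .
  qed
  have t: "?t \<in> L" "st ?t = X" using node by (simp_all add: X_def)
  have it: "(f ^^ k) ?t \<in> L \<and> st ((f ^^ k) ?t) = X \<and> arity ((f ^^ k) ?t) = arity ?t + k * e \<and>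
      fact k \<le> shuffle_weight ((f ^^ k) ?t)" for k
  proof (induction k)
    case 0
    then show ?case using t weight_pos[OF t(1)] by (simp del: leaves.simps)
  next
    case (Suc k)
    let ?s = "(f ^^ k) ?t"
    have "k * 1 \<le> k * e" using \<open>e \<ge> 1\<close> by (intro mult_left_mono) auto
    then have "Suc k \<le> arity ?s" using Suc arity_pos[OF t(1)] by linarith
    then have "fact k * Suc k \<le> shuffle_weight ?s * arity ?s"
      using Suc by (intro mult_mono) auto
    also have "\<dots> \<le> shuffle_weight (f ?s)" using Suc f_weight by blast
    finally show ?case using Suc f[of ?s] by (simp add: f_arity mult.commute del: leaves.simps)
  qed
  have "fact k \<le> (\<Sum>t\<in>{t \<in> L. arity t = arity ?t + k * e}. shuffle_weight t)" for k
  proof -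
    have "fact k \<le> shuffle_weight ((f ^^ k) ?t)" using it by blast
    also have "\<dots> \<le> (\<Sum>t\<in>{t \<in> L. arity t = arity ?t + k * e}. shuffle_weight t)"
      using it[of k] finite_arity[of "arity ?t + k * e"] by (intro member_le_sum) auto
    finally show ?thesis .
  qed
  then show ?thesis using that by blast
qed

end


section \<open>Leading monomials and dimensions\<close>

abbreviation keys :: "('a \<Rightarrow>\<^sub>0 'b::zero) \<Rightarrow> 'a set" where "keys \<equiv> Poly_Mapping.keys"

lemma well_ordered_by_arityD:
  assumes "well_ordered_by_arity M r" "n \<ge> 1"
  shows "x \<in> M n \<Longrightarrow> (x, x) \<in> r"
    and "x \<in> M n \<Longrightarrow> y \<in> M n \<Longrightarrow> (x, y) \<in> r \<Longrightarrow> (y, x) \<in> r \<Longrightarrow> x = y"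
    and "x \<in> M n \<Longrightarrow> y \<in> M n \<Longrightarrow> (x, y) \<in> r \<or> (y, x) \<in> r"
    and "x \<in> M n \<Longrightarrow> y \<in> M n \<Longrightarrow> z \<in> M n \<Longrightarrow> (x, y) \<in> r \<Longrightarrow> (y, z) \<in> r \<Longrightarrow> (x, z) \<in> r"
    and "wf {(x, y). x \<in> M n \<and> y \<in> M n \<and> (x, y) \<in> r \<and> x \<noteq> y}"
proof -
  let ?r = "r \<inter> M n \<times> M n"
  have wo: "well_order_on (M n) ?r" using assms by (auto simp: well_ordered_by_arity_def)
  then have lin: "refl_on (M n) ?r" "trans ?r" "antisym ?r" "total_on (M n) ?r" "wf (?r - Id)"
    by (auto simp: well_order_on_def linear_order_on_def partial_order_on_def preorder_on_def)
  show "x \<in> M n \<Longrightarrow> (x, x) \<in> r" using lin(1) by (auto simp: refl_on_def)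
  show "x \<in> M n \<Longrightarrow> y \<in> M n \<Longrightarrow> (x, y) \<in> r \<Longrightarrow> (y, x) \<in> r \<Longrightarrow> x = y"
    using lin(3) by (auto simp: antisym_def)
  show "x \<in> M n \<Longrightarrow> y \<in> M n \<Longrightarrow> (x, y) \<in> r \<or> (y, x) \<in> r"
    using lin(1,4) by (cases "x = y") (auto simp: total_on_def refl_on_def)
  show "x \<in> M n \<Longrightarrow> y \<in> M n \<Longrightarrow> z \<in> M n \<Longrightarrow> (x, y) \<in> r \<Longrightarrow> (y, z) \<in> r \<Longrightarrow> (x, z) \<in> r"
    using lin(2) by (meson IntD1 IntI SigmaI transD)
  have "{(x, y). x \<in> M n \<and> y \<in> M n \<and> (x, y) \<in> r \<and> x \<noteq> y} = ?r - Id" by auto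
  then show "wf {(x, y). x \<in> M n \<and> y \<in> M n \<and> (x, y) \<in> r \<and> x \<noteq> y}" using lin(5) by simp
qed

lemma leading_monomialI:
  assumes "well_ordered_by_arity M r" "n \<ge> 1" "keys f \<subseteq> M n"
    and "m \<in> keys f" "\<And>m'. m' \<in> keys f \<Longrightarrow> (m', m) \<in> r"
  shows "leading_monomial r f = m"
  unfolding leading_monomial_def
  using assms well_ordered_by_arityD(2)[OF assms(1,2)] by (intro the_equality) (auto simp: subset_iff)

lemma
  assumes wo: "well_ordered_by_arity M r" "n \<ge> 1" and f: "keys f \<subseteq> M n" "f \<noteq> 0"
  shows leading_monomial_in_keys: "leading_monomial r f \<in> keys f"
    and leading_monomial_greatest:
      "m' \<in> keys f \<Longrightarrow> (m', leading_monomial r f) \<in> r"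
proof -
  have "\<exists>m\<in>S. \<forall>m'\<in>S. (m', m) \<in> r" if "finite S" "S \<noteq> {}" "S \<subseteq> M n" for S
    using that
  proof (induction rule: finite_ne_induct)
    case (singleton x)
    then show ?case using well_ordered_by_arityD(1)[OF wo] by auto
  next
    case (insert x F)
    then obtain m where m: "m \<in> F" "\<forall>m'\<in>F. (m', m) \<in> r" by auto
    show ?case
    proof (cases "(x, m) \<in> r")
      case False
      then have "(m, x) \<in> r" using well_ordered_by_arityD(3)[OF wo, of x m] insert.prems m by auto
      then have "\<forall>m'\<in>F. (m', x) \<in> r"
        using well_ordered_by_arityD(4)[OF wo, of _ m x] insert.prems m by auto
      then show ?thesis using well_ordered_by_arityD(1)[OF wo, of x] insert.prems by auto
    qed (use m in auto)
  qed
  then obtain m where m: "m \<in> keys f" "\<forall>m'\<in>keys f. (m', m) \<in> r"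
    using f finite_keys[of f] by (metis keys_eq_empty)
  then have "leading_monomial r f = m" using leading_monomialI[OF wo f(1)] by blast
  with m show "leading_monomial r f \<in> keys f"
    "m' \<in> keys f \<Longrightarrow> (m', leading_monomial r f) \<in> r" by auto
qed

lemma lookup_sum_single:
  assumes "finite S" "inj_on F S"
  shows "Poly_Mapping.lookup (\<Sum>s\<in>S. Poly_Mapping.single (F s) (c s)) x =
    (if x \<in> F ` S then c (the_inv_into S F x) else 0)"
proof -
  have "Poly_Mapping.lookup (\<Sum>s\<in>S. Poly_Mapping.single (F s) (c s)) x =
      (\<Sum>s\<in>S. if F s = x then c s else 0)"
    by (simp add: Poly_Mapping.lookup_sum lookup_single when_def)
  also have "\<dots> = (if x \<in> F ` S then c (the_inv_into S F x) else 0)"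
  proof (cases "x \<in> F ` S")
    case True
    then obtain s where s: "s \<in> S" "x = F s" by auto
    then have "(\<Sum>t\<in>S. if F t = x then c t else 0) = (\<Sum>t\<in>S. if t = s then c t else 0)"
      using assms(2) by (intro sum.cong) (auto simp: inj_on_def)
    then show ?thesis using s assms by (simp add: the_inv_into_f_f)
  next
    case False
    then show ?thesis by (auto intro!: sum.neutral)
  qed
  finally show ?thesis .
qed

text \<open>\<open>f' F\<close> is the linear extension of \<open>F\<close> applied to
  \<open>f\<close>. Injectivity prevents cancellation, and monotonicity sends the largest key to the
  largest. It is meant for grafting with one argument fixed.\<close>

lemma leading_monomial_image:
  fixes f :: "'m \<Rightarrow>\<^sub>0 'k::comm_monoid_add"
  defines "f' F \<equiv> (\<Sum>s\<in>keys f. Poly_Mapping.single (F s) (Poly_Mapping.lookup f s))"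
  assumes wo: "well_ordered_by_arity M r" and "k \<ge> 1" "n \<ge> 1"
    and f: "f \<noteq> 0" "keys f \<subseteq> M k"
    and F: "inj_on F (M k)" "F ` M k \<subseteq> M n"
      "\<And>s s'. s \<in> M k \<Longrightarrow> s' \<in> M k \<Longrightarrow> (s, s') \<in> r \<Longrightarrow> (F s, F s') \<in> r"
  shows "f' F \<noteq> 0" "keys (f' F) \<subseteq> M n"
    "leading_monomial r (f' F) = F (leading_monomial r f)"
proof -
  have inj: "inj_on F (keys f)" using F(1) f(2) inj_on_subset by blast
  have keys: "keys (f' F) = F ` keys f"
  proof (rule set_eqI)
    fix x
    show "x \<in> keys (f' F) \<longleftrightarrow> x \<in> F ` keys f"
      unfolding in_keys_iff f'_def lookup_sum_single[OF finite_keys inj]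
      using the_inv_into_into[OF inj _ subset_refl] by (auto simp: in_keys_iff)
  qed
  then show "f' F \<noteq> 0" using f(1) by (metis image_is_empty keys_eq_empty)
  show sub: "keys (f' F) \<subseteq> M n" using keys F(2) f(2) by auto
  note lm = leading_monomial_in_keys[OF wo \<open>k \<ge> 1\<close> f(2,1)]
    leading_monomial_greatest[OF wo \<open>k \<ge> 1\<close> f(2,1)]
  show "leading_monomial r (f' F) = F (leading_monomial r f)"
    using lm(1) by (intro leading_monomialI[OF wo \<open>n \<ge> 1\<close> sub])
      (auto simp: keys intro!: F(3) lm(2) subsetD[OF f(2)])
qed

lemma lookup_sum_single_id:
  "finite S \<Longrightarrow> Poly_Mapping.lookup (\<Sum>s\<in>S. Poly_Mapping.single s (c s)) x = (if x \<in> S then c x else 0)"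
  by (simp add: Poly_Mapping.lookup_sum lookup_single when_def)

lemma poly_mapping_sum_singles:
  "f = (\<Sum>m\<in>keys f. Poly_Mapping.single m (Poly_Mapping.lookup f m))"
  by (rule poly_mapping_eqI) (simp add: lookup_sum_single_id in_keys_iff)

text \<open>The normal monomials \<open>N\<close> map to a basis. A relation among them would be a
  kernel element with normal leading monomial; a monomial outside \<open>N\<close> is rewritten by
  smaller ones, which terminates as the order is well-founded. Nothing here refers to trees, so it
  serves both cases.\<close>

lemma dim_eq_card_normal:
  fixes V :: "('k::field, 'v::ab_group_add, 'z) collection_scheme"
    and \<phi> :: "('m \<Rightarrow>\<^sub>0 'k) \<Rightarrow> 'v"
  assumes vs: "vector_space (lin_scale V)"
    and wo: "well_ordered_by_arity M r" "n \<ge> 1"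
    and add: "\<And>x y. keys x \<subseteq> M n \<Longrightarrow> keys y \<subseteq> M n \<Longrightarrow>
      \<phi> (x + y) = \<phi> x + \<phi> y"
    and scale: "\<And>c x. keys x \<subseteq> M n \<Longrightarrow>
      \<phi> (scale_poly_mapping c x) = lin_scale V c (\<phi> x)"
    and surj: "\<phi> ` {f. keys f \<subseteq> M n} = graded_part V n"
    and N: "N \<subseteq> M n"
    and normal: "\<And>f. keys f \<subseteq> M n \<Longrightarrow> \<phi> f = 0 \<Longrightarrow> f \<noteq> 0 \<Longrightarrow>
      leading_monomial r f \<notin> N"
    and reducible: "\<And>m. m \<in> M n \<Longrightarrow> m \<notin> N \<Longrightarrow> \<exists>f. keys f \<subseteq> M n \<and> \<phi> f = 0 \<and>
      f \<noteq> 0 \<and> leading_monomial r f = m"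
    and fin: "finite_dimensional_part V n"
  shows "finite N \<and> dim_part V n = card N"
proof -
  interpret vector_space "lin_scale V" by (rule vs)
  define e where "e m = \<phi> (Poly_Mapping.single m 1)" for m
  have \<phi>0: "\<phi> 0 = 0" using add[of 0 0] by simp
  have single: "\<phi> (Poly_Mapping.single m c) = lin_scale V c (e m)" if "m \<in> M n" for m c
  proof -
    have "Poly_Mapping.single m c = scale_poly_mapping c (Poly_Mapping.single m 1)"
      by (rule poly_mapping_eqI)
        (simp add: scale_poly_mapping_def Poly_Mapping.map.rep_eq lookup_single when_def)
    then show ?thesis using scale[of "Poly_Mapping.single m 1" c] that by (simp add: e_def)
  qed
  have sum_keys: "keys (\<Sum>m\<in>S. Poly_Mapping.single m (c m)) \<subseteq> S" if "finite S" for S c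
    using that by (auto simp: in_keys_iff lookup_sum_single_id split: if_splits)
  have rep: "\<phi> (\<Sum>m\<in>S. Poly_Mapping.single m (c m)) = (\<Sum>m\<in>S. lin_scale V (c m) (e m))"
    if "finite S" "S \<subseteq> M n" for S c
    using that
  proof (induction S rule: finite_induct)
    case (insert x S)
    then show ?case using sum_keys[of S c] by (simp add: add single) (subst add, auto simp: single)
  qed (simp add: \<phi>0)
  have rep_f: "\<phi> f = (\<Sum>m\<in>keys f. lin_scale V (Poly_Mapping.lookup f m) (e m))"
    if "keys f \<subseteq> M n" for f
    using rep[OF finite_keys that, of "Poly_Mapping.lookup f"] by (simp flip: poly_mapping_sum_singles)
  have zero: "c m = 0" if S: "finite S" "S \<subseteq> N" and 0: "(\<Sum>m\<in>S. lin_scale V (c m) (e m)) = 0"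
    and m: "m \<in> S" for S c m
  proof -
    define f where "f = (\<Sum>m\<in>S. Poly_Mapping.single m (c m))"
    have keys: "keys f \<subseteq> S" unfolding f_def using S by (intro sum_keys)
    have "\<phi> f = 0" unfolding f_def using rep[of S c] S N 0 by auto
    have "f = 0"
    proof (rule ccontr)
      assume "f \<noteq> 0"
      then have "leading_monomial r f \<in> keys f"
        using keys S N by (intro leading_monomial_in_keys[OF wo]) auto
      moreover have "leading_monomial r f \<notin> N"
        using keys S N \<open>\<phi> f = 0\<close> \<open>f \<noteq> 0\<close> by (intro normal) auto
      ultimately show False using keys S by auto
    qed
    moreover have "Poly_Mapping.lookup f m = c m"
      unfolding f_def using S m by (simp add: lookup_sum_single_id)
    ultimately show ?thesis by simp
  qed
  \<comment> \<open>Wanted besides independence of the image set, which does not notice two normal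
    monomials with the same image.\<close>
  have inj: "inj_on e N"
  proof (rule inj_onI, rule ccontr)
    fix a b assume ab: "a \<in> N" "b \<in> N" "e a = e b" "a \<noteq> b"
    then have "(1 :: 'k) = 0" using zero[of "{a, b}" "\<lambda>m. if m = a then 1 else - 1" a] by simp
    then show False by simp
  qed
  have indep: "independent (e ` N)"
    unfolding dependent_explicit
  proof (intro notI, elim exE conjE bexE)
    fix T u v assume T: "finite T" "T \<subseteq> e ` N" "(\<Sum>v\<in>T. lin_scale V (u v) v) = 0" "v \<in> T" "u v \<noteq> 0"
    then obtain S where S: "S \<subseteq> N" "finite S" "T = e ` S" by (meson finite_subset_image)
    then have "(\<Sum>m\<in>S. lin_scale V (u (e m)) (e m)) = 0"
      using T(3) inj inj_on_subset by (subst (asm) S(3), subst (asm) sum.reindex) auto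
    then have "\<forall>m\<in>S. u (e m) = 0" using zero[of S "\<lambda>m. u (e m)"] S by auto
    then show False using T S by auto
  qed
  have e_in: "e m \<in> graded_part V n" if "m \<in> M n" for m
    using that unfolding surj[symmetric] e_def by (intro imageI) auto
  \<comment> \<open>Finite dimensionality enters here: it bounds the independent set and so makes
    \<open>N\<close> finite.\<close>
  obtain B where B: "finite B" "span B = graded_part V n"
    using fin by (auto simp: finite_dimensional_part_def)
  have eN: "e ` N \<subseteq> span B" using e_in N B by auto
  have "finite (e ` N)" using independent_span_bound[OF B(1) indep eN] by simp
  then have finN: "finite N" using inj by (rule finite_imageD)
  have e_span: "m \<in> M n \<Longrightarrow> e m \<in> span (e ` N)" for m
    using well_ordered_by_arityD(5)[OF wo]
  proof (induction m rule: wf_induct_rule)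
    case (less m)
    show ?case
    proof (cases "m \<in> N")
      case False
      then obtain f where f: "keys f \<subseteq> M n" "\<phi> f = 0" "f \<noteq> 0" "leading_monomial r f = m"
        using reducible less.prems by blast
      let ?c = "Poly_Mapping.lookup f"
      have m: "m \<in> keys f"
        using leading_monomial_in_keys[OF wo f(1,3)] f(4) by simp
      have "lin_scale V (?c m) (e m) + (\<Sum>m'\<in>keys f - {m}. lin_scale V (?c m') (e m')) = 0"
        using rep_f[OF f(1)] f(2) m by (simp add: sum.remove[of _ m])
      then have *: "lin_scale V (?c m) (e m) =
          - (\<Sum>m'\<in>keys f - {m}. lin_scale V (?c m') (e m'))"
        by (simp add: eq_neg_iff_add_eq_0)
      have "e m' \<in> span (e ` N)" if "m' \<in> keys f - {m}" for m'
        using that less f leading_monomial_greatest[OF wo f(1,3), of m'] by auto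
      then have "lin_scale V (?c m) (e m) \<in> span (e ` N)"
        unfolding * by (intro span_neg span_sum span_scale) auto
      then have "lin_scale V (1 / ?c m) (lin_scale V (?c m) (e m)) \<in> span (e ` N)"
        by (rule span_scale)
      then show ?thesis using m by (simp add: in_keys_iff)
    qed (simp add: span_base)
  qed
  have "span (e ` N) = span (graded_part V n)"
  proof
    have "graded_part V n \<subseteq> span (e ` N)"
    proof
      fix x assume "x \<in> graded_part V n"
      then obtain f where f: "x = \<phi> f" "keys f \<subseteq> M n" by (auto simp flip: surj)
      show "x \<in> span (e ` N)"
        unfolding f(1) rep_f[OF f(2)] using f(2) e_span by (intro span_sum span_scale) auto
    qed
    then show "span (graded_part V n) \<subseteq> span (e ` N)" by (metis span_mono span_span)
    show "span (e ` N) \<subseteq> span (graded_part V n)"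
      using e_in N by (intro span_mono) auto
  qed
  then have "dim (graded_part V n) = card (e ` N)" by (rule dim_eq_card[OF _ indep])
  then show ?thesis using finN card_image[OF inj] by (simp add: dim_part_def)
qed

lemma bilinear_extension_single_right:
  "bilinear_extension h f (Poly_Mapping.single t (1 :: 'k::semiring_1)) =
    (\<Sum>s\<in>keys f. Poly_Mapping.single (h s t) (Poly_Mapping.lookup f s))"
  by (simp add: bilinear_extension_def)

lemma bilinear_extension_single_left:
  "bilinear_extension h (Poly_Mapping.single s (1 :: 'k::semiring_1)) g =
    (\<Sum>t\<in>keys g. Poly_Mapping.single (h s t) (Poly_Mapping.lookup g t))"
  by (simp add: bilinear_extension_def)

lemma bilinear_extension_0:
  "bilinear_extension h 0 g = 0" "bilinear_extension h f 0 = 0"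
  by (simp_all add: bilinear_extension_def)

lemma collection_hom_0:
  assumes "collection_hom V W \<phi>" "n \<ge> 1" "0 \<in> graded_part V n"
  shows "\<phi> n 0 = 0"
proof -
  have "\<phi> n (0 + 0) = \<phi> n 0 + \<phi> n 0" using assms unfolding collection_hom_def by blast
  then show ?thesis by simp
qed

text \<open>That the target composition \<open>c\<close> vanishes at 0 is obtained from the morphism
  property itself, evaluated at 0.\<close>

lemma bilinear_extension_kernel:
  assumes "\<And>x y. keys x \<subseteq> A \<Longrightarrow> keys y \<subseteq> B \<Longrightarrow> \<phi> (bilinear_extension h x y) = c (\<phi>\<^sub>1 x) (\<phi>\<^sub>2 y)"
    and "\<phi> 0 = 0" "\<phi>\<^sub>1 0 = 0" "\<phi>\<^sub>2 0 = 0" and f: "keys f \<subseteq> A" and g: "keys g \<subseteq> B"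
    and "\<phi>\<^sub>1 f = 0 \<or> \<phi>\<^sub>2 g = 0"
  shows "\<phi> (bilinear_extension h f g) = 0"
proof -
  have "c 0 (\<phi>\<^sub>2 g) = 0" "c (\<phi>\<^sub>1 f) 0 = 0"
    using assms(1)[of 0 g] assms(1)[of f 0] assms(2-4) f g by (simp_all add: bilinear_extension_0)
  then show ?thesis using assms(1)[OF f g] assms(7) by auto
qed


section \<open>Connected subtrees\<close>

lemma subtree_context:
  "s \<in> subtrees v \<Longrightarrow> \<exists>C. one_hole C \<and> v = C s"
proof (induction v)
  case (Leaf x)
  then show ?case using one_hole_id by fastforce
next
  case (Node g ts)
  show ?case
  proof (cases "s = Node g ts")
    case True
    then show ?thesis using one_hole_id by blast
  next
    case False
    then obtain t where t: "t \<in> set ts" "s \<in> subtrees t" using Node.prems by auto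
    then obtain C where C: "one_hole C" "t = C s" using Node.IH by blast
    obtain us vs where "ts = us @ t # vs" using t split_list by metis
    then have "Node g ts = Node g (us @ C s # vs)" using C by simp
    then show ?thesis using one_hole_Node[OF C(1), of g us vs] by blast
  qed
qed

text \<open>The leaves of \<open>u\<close> are filled one after the other, each time in a context.\<close>

lemma rooted_cut_transfer:
  assumes cut: "\<And>C s. one_hole C \<Longrightarrow> V (C s) \<Longrightarrow>
      V (C (Leaf (lab s))) \<and> (P (C (Leaf (lab s))) \<longrightarrow> P (C s))"
    and "rooted_cut lab u s" "one_hole C" "V (C s)"
  shows "V (C u) \<and> (P (C u) \<longrightarrow> P (C s))"
  using assms(2-)
proof (induction arbitrary: C rule: rooted_cut.induct)
  case (cut v)
  then show ?case using assms(1) by blast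
next
  case (keep us vs g)
  \<comment> \<open>Siblings are filled from left to right; \<open>ps\<close> are those already
    filled.\<close>
  have "V (C (Node g (ps @ us))) \<and> (P (C (Node g (ps @ us))) \<longrightarrow> P (C (Node g (ps @ vs))))"
    if "V (C (Node g (ps @ vs)))" for ps
    using keep.IH that
  proof (induction arbitrary: ps rule: list_all2_induct)
    case (Cons u us v vs)
    from Cons.IH[of "ps @ [v]"] Cons.prems
    have 1: "V (C (Node g (ps @ v # us)))"
      "P (C (Node g (ps @ v # us))) \<longrightarrow> P (C (Node g (ps @ v # vs)))" by auto
    have "one_hole (\<lambda>t. C (Node g (ps @ t # us)))"
      using one_hole_comp[OF keep.prems(1) one_hole_Node[OF one_hole_id, of g ps us]] .
    with Cons.hyps 1 show ?case by blast
  qed simp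
  from this[of "[]"] keep.prems show ?case by simp
qed

text \<open>Reduces divisibility to grafting at a single leaf: by \<open>cut\<close> the leaves of
  \<open>u\<close> are filled, by \<open>sub\<close> the result is put into a context.
  \<open>V\<close> is the validity of the intermediate trees. The main use has for \<open>P\<close>
  the property of being a leading monomial of a kernel element.\<close>

lemma connected_subtree_transfer:
  assumes cut: "\<And>C s. one_hole C \<Longrightarrow> V (C s) \<Longrightarrow>
      V (C (Leaf (lab s))) \<and> (P (C (Leaf (lab s))) \<longrightarrow> P (C s))"
    and sub: "\<And>C s. one_hole C \<Longrightarrow> V (C s) \<Longrightarrow> V s \<and> (P s \<longrightarrow> P (C s))"
    and "connected_subtree lab u v" "V v"
  shows "V u \<and> (P u \<longrightarrow> P v)"
proof -
  obtain s where s: "s \<in> subtrees v" "rooted_cut lab u s"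
    using assms(3) by (auto simp: connected_subtree_def)
  obtain C where C: "one_hole C" "v = C s" using subtree_context[OF s(1)] by blast
  have "V s" "P s \<longrightarrow> P v" using sub[OF C(1)] C(2) assms(4) by auto
  moreover have "V u \<and> (P u \<longrightarrow> P s)"
    using rooted_cut_transfer[where C = "\<lambda>t. t", of V lab P, OF _ s(2) one_hole_id \<open>V s\<close>] cut
    by blast
  ultimately show ?thesis by blast
qed


section \<open>Trees avoiding finitely many patterns\<close>

lemma rooted_cut_simps [simp]:
  "rooted_cut lab (Node g us) (Node h vs) \<longleftrightarrow> g = h \<and> list_all2 (rooted_cut lab) us vs"
  "rooted_cut lab (Node g us) (Leaf a) \<longleftrightarrow> False"
  "rooted_cut lab (Leaf b) v \<longleftrightarrow> b = lab v"
  by (subst rooted_cut.simps, force)+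

lemma connected_subtree_Node:
  "connected_subtree lab w (Node g ts) \<longleftrightarrow>
    rooted_cut lab w (Node g ts) \<or> (\<exists>t\<in>set ts. connected_subtree lab w t)"
  by (auto simp: connected_subtree_def)

section \<open>Truncations as states of the automaton\<close>

fun height_le :: "nat \<Rightarrow> ('g, 'l) ptree \<Rightarrow> bool" where
  "height_le d (Leaf a) \<longleftrightarrow> True"
| "height_le 0 (Node g ts) \<longleftrightarrow> False"
| "height_le (Suc d) (Node g ts) \<longleftrightarrow> (\<forall>t\<in>set ts. height_le d t)"

lemma height_le_mono: "height_le d t \<Longrightarrow> d \<le> e \<Longrightarrow> height_le e t"
proof (induction d t arbitrary: e rule: height_le.induct)
  case (3 d g ts)
  then show ?case by (cases e) auto
qed auto

lemma height_le_size: "height_le (size t) t"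
proof (induction t)
  case (Node g ts)
  have "height_le (size_list size ts) t" if "t \<in> set ts" for t
    using height_le_mono[OF Node[OF that]] size_list_estimation'[OF that, of "size t" size] by simp
  then show ?case by simp
qed simp

fun trunc :: "nat \<Rightarrow> ('g, unit) ptree \<Rightarrow> ('g, unit) ptree" where
  "trunc d (Leaf a) = Leaf ()"
| "trunc 0 (Node g ts) = Leaf ()"
| "trunc (Suc d) (Node g ts) = Node g (map (trunc d) ts)"

lemma trunc_0 [simp]: "trunc 0 t = Leaf ()"
  by (cases t) auto

lemma trunc_trunc_Suc: "trunc d (trunc (Suc d) t) = trunc d t"
proof (induction d arbitrary: t)
  case (Suc d)
  then show ?case by (cases t) (auto simp: comp_def)
qed simp

text \<open>A pattern of height at most \<open>d\<close> looks only at vertices of depth less than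
  \<open>d\<close>. That \<open>trunc\<close> confuses vertices at depth \<open>d\<close> with
  leaves is harmless, as a leaf of a pattern matches any subtree.\<close>

lemma rooted_cut_trunc:
  "height_le d w \<Longrightarrow> rooted_cut (\<lambda>_. ()) w (trunc d s) \<longleftrightarrow> rooted_cut (\<lambda>_. ()) w s"
proof (induction d w arbitrary: s rule: height_le.induct)
  case (3 d g ws)
  show ?case
  proof (cases s)
    case (Node h ss)
    have "list_all2 (\<lambda>w s. rooted_cut (\<lambda>_. ()) w (trunc d s)) ws ss =
        list_all2 (rooted_cut (\<lambda>_. ())) ws ss"
      using 3 by (auto simp: list_all2_conv_all_nth)
    then show ?thesis by (simp add: Node list_all2_map2)
  qed simp
qed auto

definition avoiding :: "(nat \<Rightarrow> 'g set) \<Rightarrow> ('g, unit) ptree set \<Rightarrow> ('g, unit) ptree set" where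
  "avoiding \<Gamma> W = {t. labelled_by \<Gamma> t \<and> (\<forall>w\<in>W. \<not> ns_divides w t)}"

lemma finite_trunc_image:
  assumes "finitely_many_generators \<Gamma>"
  shows "finite (trunc d ` {t. labelled_by \<Gamma> t})"
proof (induction d)
  case 0
  have "trunc 0 ` {t. labelled_by \<Gamma> t} \<subseteq> {Leaf ()}" by auto
  then show ?case by (rule finite_subset) simp
next
  case (Suc d)
  let ?T = "\<lambda>d. trunc d ` {t. labelled_by \<Gamma> t}"
  let ?S = "insert (Leaf ()) (\<Union>(k, g)\<in>(SIGMA n:{1..}. \<Gamma> n).
    Node g ` {ts. set ts \<subseteq> ?T d \<and> length ts = k})"
  have "?T (Suc d) \<subseteq> ?S"
  proof
    fix x assume "x \<in> ?T (Suc d)"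
    then obtain t where t: "x = trunc (Suc d) t" "labelled_by \<Gamma> t" by auto
    show "x \<in> ?S"
    proof (cases t)
      case (Node g ts)
      then have "(length ts, g) \<in> (SIGMA n:{1..}. \<Gamma> n)" using t by (cases ts) auto
      moreover have "x \<in> Node g ` {ts'. set ts' \<subseteq> ?T d \<and> length ts' = length ts}"
        using t Node by (intro image_eqI[of _ _ "map (trunc d) ts"]) auto
      ultimately show ?thesis by blast
    qed (use t in auto)
  qed
  moreover have "finite ?S"
    using assms Suc unfolding finitely_many_generators_def
    by (auto intro!: finite_lists_length_eq)
  ultimately show ?case by (rule finite_subset)
qed

text \<open>The state is a truncation deeper than all patterns. Those of the children determine that
  of the vertex, hence whether a pattern occurs at the root; occurrences further down lie in a child
  and are excluded there.\<close>

lemma tree_language_avoiding: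
  assumes \<Gamma>: "finitely_many_generators \<Gamma>" and W: "finite W"
    and fin: "\<And>n. finite {t \<in> avoiding \<Gamma> W. arity t = n}"
  obtains st :: "('g, unit) ptree \<Rightarrow> ('g, unit) ptree" where "tree_language (avoiding \<Gamma> W) st"
proof -
  \<comment> \<open>The sum of the sizes bounds each size and thus each height.\<close>
  define d where "d = (\<Sum>w\<in>W. size w)"
  have d: "height_le (Suc d) w" if "w \<in> W" for w
    using W that member_le_sum[of w W size] by (intro height_le_mono[OF height_le_size])
      (auto simp: d_def le_Suc_eq)
  have "tree_language (avoiding \<Gamma> W) (trunc (Suc d))"
  proof
    show "finite (trunc (Suc d) ` avoiding \<Gamma> W)"
      using finite_trunc_image[OF \<Gamma>, of "Suc d"] by (rule rev_finite_subset) (auto simp: avoiding_def)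
    have "{(g, length ts) |g ts. Node g ts \<in> avoiding \<Gamma> W} \<subseteq> prod.swap ` (SIGMA n:{1..}. \<Gamma> n)"
    proof
      fix x assume "x \<in> {(g, length ts) |g ts. Node g ts \<in> avoiding \<Gamma> W}"
      then obtain g ts where x: "x = (g, length ts)" "Node g ts \<in> avoiding \<Gamma> W" by blast
      then have "labelled_by \<Gamma> (Node g ts)" by (simp add: avoiding_def)
      with x(1) show "x \<in> prod.swap ` (SIGMA n:{1..}. \<Gamma> n)"
        by (intro image_eqI[of _ _ "(length ts, g)"]) (auto simp: Suc_le_eq)
    qed
    then show "finite {(g, length ts) |g ts. Node g ts \<in> avoiding \<Gamma> W}"
      by (rule finite_subset) (use \<Gamma> in \<open>simp add: finitely_many_generators_def\<close>)
    show "finite {t \<in> avoiding \<Gamma> W. arity t = n}" for n by (rule fin)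
    show "ts \<noteq> [] \<and> set ts \<subseteq> avoiding \<Gamma> W" if "Node g ts \<in> avoiding \<Gamma> W" for g ts
      using that by (auto simp: avoiding_def ns_divides_def connected_subtree_Node)
  next
    fix g ts ts' assume ts: "Node g ts \<in> avoiding \<Gamma> W" "set ts' \<subseteq> avoiding \<Gamma> W"
      and eq: "map (trunc (Suc d)) ts' = map (trunc (Suc d)) ts"
    \<comment> \<open>One level less is enough: truncating a vertex at \<open>Suc d\<close>
      truncates its children at \<open>d\<close>.\<close>
    from eq have "map (trunc d \<circ> trunc (Suc d)) ts' = map (trunc d \<circ> trunc (Suc d)) ts"
      by (simp flip: map_map)
    then have eq': "trunc (Suc d) (Node g ts') = trunc (Suc d) (Node g ts)"
      by (simp add: trunc_trunc_Suc comp_def)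
    have len: "length ts' = length ts" using eq by (metis length_map)
    have "\<not> rooted_cut (\<lambda>_. ()) w (Node g ts')" if "w \<in> W" for w
      using rooted_cut_trunc[OF d[OF that], of "Node g ts"]
        rooted_cut_trunc[OF d[OF that], of "Node g ts'"] ts(1) that
      unfolding eq' by (auto simp: avoiding_def ns_divides_def connected_subtree_Node)
    then have "Node g ts' \<in> avoiding \<Gamma> W"
      using ts len by (auto simp: avoiding_def ns_divides_def connected_subtree_Node)
    with eq' show "Node g ts' \<in> avoiding \<Gamma> W \<and> trunc (Suc d) (Node g ts') = trunc (Suc d) (Node g ts)"
      by simp
  qed
  then show ?thesis by (rule that)
qed

lemma labelled_by_one_hole:
  assumes "one_hole C"
  shows "labelled_by \<Gamma> (C s) \<Longrightarrow> labelled_by \<Gamma> s"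
    and "labelled_by \<Gamma> (C s) \<Longrightarrow> labelled_by \<Gamma> t \<Longrightarrow> labelled_by \<Gamma> (C t)"
  using assms by (induction rule: one_hole.induct) auto


section \<open>The non-symmetric case\<close>

lemma ns_graft_list_append:
  assumes "1 \<le> i" "i \<le> arity v"
  shows "ns_graft_list (forest_arity us + i) (us @ v # vs) t = us @ ns_graft i v t # vs"
  using assms by (induction us) auto

text \<open>Turns a context into a leaf number, in terms of which grafting and admissible orders are
  formulated; \<open>one_hole_ns_graft\<close> is the way back.\<close>

lemma ns_graft_one_hole:
  assumes "one_hole C"
  obtains i where "1 \<le> i" "i \<le> arity (C (Leaf ()))" "\<And>s. ns_graft i (C (Leaf ())) s = C s"
proof -
  from assms have "\<exists>i\<ge>1. i \<le> arity (C (Leaf ())) \<and> (\<forall>s. ns_graft i (C (Leaf ())) s = C s)"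
  proof induction
    case one_hole_id
    show ?case by (rule exI[of _ 1]) simp
  next
    case (one_hole_Node C g us vs)
    then obtain i where "1 \<le> i" "i \<le> arity (C (Leaf ()))" "\<forall>s. ns_graft i (C (Leaf ())) s = C s"
      by blast
    then show ?case
      by (intro exI[of _ "forest_arity us + i"])
        (auto simp: ns_graft_list_append length_concat comp_def)
  qed
  then show ?thesis using that by blast
qed

lemma forest_arity_split:
  assumes "1 \<le> i" "i \<le> forest_arity ts"
  obtains us t vs j where "ts = us @ t # vs" "i = forest_arity us + j" "1 \<le> j" "j \<le> arity t"
proof -
  from assms have "\<exists>us t vs j. ts = us @ t # vs \<and> i = forest_arity us + j \<and> 1 \<le> j \<and> j \<le> arity t"
  proof (induction ts arbitrary: i)
    case (Cons t ts)
    show ?case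
    proof (cases "i \<le> arity t")
      case True
      then show ?thesis using Cons.prems
        by (intro exI[of _ "[]"] exI[of _ t] exI[of _ ts] exI[of _ i]) auto
    next
      case False
      then obtain us u vs j where "ts = us @ u # vs" "i - arity t = forest_arity us + j" "1 \<le> j"
        "j \<le> arity u" using Cons.IH[of "i - arity t"] Cons.prems by force
      then show ?thesis using False
        by (intro exI[of _ "t # us"] exI[of _ u] exI[of _ vs] exI[of _ j]) auto
    qed
  qed simp
  then show ?thesis using that by blast
qed

lemma one_hole_ns_graft:
  assumes "1 \<le> i" "i \<le> arity s"
  obtains C where "one_hole C" "s = C (Leaf ())" "\<And>t. ns_graft i s t = C t"
proof -
  from assms have "\<exists>C. one_hole C \<and> s = C (Leaf ()) \<and> (\<forall>t. ns_graft i s t = C t)"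
  proof (induction s arbitrary: i)
    case (Leaf a)
    then show ?case by (intro exI[of _ "\<lambda>t. t"]) (auto intro: one_hole_id)
  next
    case (Node g ts)
    have "i \<le> forest_arity ts" using Node.prems by (simp add: length_concat comp_def)
    then obtain us t vs j where split: "ts = us @ t # vs" "i = forest_arity us + j" "1 \<le> j" "j \<le> arity t"
      using forest_arity_split Node.prems(1) by metis
    then obtain C where "one_hole C" "t = C (Leaf ())" "\<forall>s. ns_graft j t s = C s"
      using Node.IH[of t j] by auto
    then show ?case
      using split
      by (intro exI[of _ "\<lambda>s. Node g (us @ C s # vs)"]) (auto simp: ns_graft_list_append
          intro: one_hole_Node)
  qed
  then show ?thesis using that by blast
qed

lemma ns_graft_closed:
  assumes "1 \<le> i" "i \<le> n" "s \<in> ns_monomials \<Gamma> n" "t \<in> ns_monomials \<Gamma> m"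
  shows "ns_graft i s t \<in> ns_monomials \<Gamma> (n + m - 1)"
proof -
  obtain C where C: "one_hole C" "s = C (Leaf ())" "\<And>t. ns_graft i s t = C t"
    using one_hole_ns_graft[of i s] assms by (auto simp: ns_monomials_def)
  obtain k where "\<And>t. arity (C t) = arity t + k" using one_hole_arity[OF C(1)] by blast
  then show ?thesis
    using assms(3,4) labelled_by_one_hole(2)[OF C(1)] C(2,3) by (auto simp: ns_monomials_def)
qed

lemma ns_graft_inj_right:
  assumes "1 \<le> i" "i \<le> arity s" "ns_graft i s t = ns_graft i s t'"
  shows "t = t'"
  using one_hole_ns_graft[OF assms(1,2)] one_hole_inj assms(3) by metis

lemma ns_graft_size:
  assumes "1 \<le> i" "i \<le> arity s"
  shows "size (ns_graft i s t) + size (Leaf () :: ('g, unit) ptree) = size t + size s"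
    and "arity (ns_graft i s t) + 1 = arity s + arity t"
proof -
  obtain C where C: "one_hole C" "s = C (Leaf ())" "\<And>t. ns_graft i s t = C t"
    using one_hole_ns_graft[OF assms] by blast
  obtain k where "\<And>t. size (C t) = size t + k" using one_hole_size[OF C(1)] by blast
  then show "size (ns_graft i s t) + size (Leaf () :: ('g, unit) ptree) = size t + size s"
    using C by simp
  obtain k where "\<And>t. arity (C t) = arity t + k" using one_hole_arity[OF C(1)] by blast
  then show "arity (ns_graft i s t) + 1 = arity s + arity t" using C by simp
qed

lemma size_list_neq_0: "size_list f xs = 0 \<longleftrightarrow> xs = []"
  by (cases xs) auto

text \<open>The descents to leaf \<open>i\<close> in \<open>s\<close> and \<open>s'\<close> never
  part: otherwise a child of one tree would be a graft into the corresponding child of the other and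
  yet have fewer leaves than it, which is impossible since \<open>t\<close> has a leaf. A leaf
  against a vertex is excluded by size.\<close>

lemma ns_graft_inj_left:
  assumes "1 \<le> i" "i \<le> arity s" "i \<le> arity s'" "arity t \<ge> 1" "ns_graft i s t = ns_graft i s' t"
  shows "s = s'"
  using assms(1-3,5)
proof (induction s arbitrary: s' i)
  case (Leaf a)
  have "size s' = size (Leaf () :: ('g, unit) ptree)"
    using ns_graft_size(1)[of i s' t] Leaf.prems by simp
  then show ?case using Leaf.prems by (cases s') (auto simp: size_list_neq_0)
next
  case (Node g ss)
  show ?case
  proof (cases s')
    case (Leaf b)
    then have "size (Node g ss) = size (Leaf () :: ('g, unit) ptree)"
      using Node.prems ns_graft_size(1)[of i "Node g ss" t] by simp
    then show ?thesis using Node.prems by (auto simp: size_list_neq_0)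
  next
    case s': (Node h ss')
    have "ss = ss'" if "1 \<le> i" "i \<le> forest_arity ss" "i \<le> forest_arity ss'"
      "ns_graft_list i ss t = ns_graft_list i ss' t" for i
      using that Node.IH
    proof (induction ss arbitrary: ss' i)
      case Nil
      from Nil.prems(1,2) show ?case by simp
    next
      case (Cons a ss)
      from Cons.prems(1,3) obtain b bs where ss': "ss' = b # bs" by (cases ss') auto
      consider "i \<le> arity a" "i \<le> arity b" | "i \<le> arity a" "arity b < i" | "arity a < i" "i \<le> arity b"
        | "arity a < i" "arity b < i" by linarith
      then show ?case
      proof cases
        case 1
        then have "ns_graft i a t = ns_graft i b t" "ss = bs" using Cons.prems(4) ss' by simp_all
        then show ?thesis using Cons.prems(1,5) 1 ss' by simp
      next
        case 2
        then have "b = ns_graft i a t" using Cons.prems(4) ss' by simp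
        then show ?thesis using ns_graft_size(2)[of i a t] 2 Cons.prems(1) assms(4) by simp
      next
        case 3
        then have "a = ns_graft i b t" using Cons.prems(4) ss' by simp
        then show ?thesis using ns_graft_size(2)[of i b t] 3 Cons.prems(1) assms(4) by simp
      next
        case 4
        then have ab: "a = b" "ns_graft_list (i - arity b) ss t = ns_graft_list (i - arity b) bs t"
          using Cons.prems(4) ss' by auto
        have "ss = bs"
        proof (rule Cons.IH)
          show "ns_graft_list (i - arity b) ss t = ns_graft_list (i - arity b) bs t" by (rule ab(2))
          show "x = s'" if "x \<in> set ss" "1 \<le> i" "i \<le> arity x" "i \<le> arity s'"
            "ns_graft i x t = ns_graft i s' t" for x s' i
            using Cons.prems(5)[of x i s'] that by simp
        qed (use Cons.prems(1-3) 4 ss' ab(1) in auto)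
        then show ?thesis using ab(1) ss' by simp
      qed
    qed
    moreover have "i \<le> forest_arity ss" "i \<le> forest_arity ss'"
      using Node.prems s' by (auto simp: length_concat comp_def)
    ultimately show ?thesis using Node.prems s' by simp
  qed
qed

section \<open>Leading monomials of the ideal of relations and dimensions\<close>

lemma kernel_part_free_ns:
  "kernel_part (free_ns_operad \<Gamma>) \<phi> n = {f. keys f \<subseteq> ns_monomials \<Gamma> n \<and> \<phi> n f = 0}"
  by (simp add: kernel_part_def free_ns_operad_def)

lemma ns_operad_hom_kernel:
  fixes \<phi> :: "nat \<Rightarrow> (('g, unit) ptree \<Rightarrow>\<^sub>0 'k::field) \<Rightarrow> 'v::ab_group_add"
  assumes hom: "ns_operad_hom (free_ns_operad \<Gamma>) P \<phi>"
    and "1 \<le> i" "i \<le> n" "1 \<le> m"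
    and f: "keys f \<subseteq> ns_monomials \<Gamma> n" and g: "keys g \<subseteq> ns_monomials \<Gamma> m"
    and "\<phi> n f = 0 \<or> \<phi> m g = 0"
  shows "\<phi> (n + m - 1) (bilinear_extension (ns_graft i) f g) = 0"
proof -
  let ?F = "free_ns_operad \<Gamma> :: ('k, ('g, unit) ptree \<Rightarrow>\<^sub>0 'k) ns_operad"
  have part: "x \<in> graded_part ?F k \<longleftrightarrow> keys x \<subseteq> ns_monomials \<Gamma> k" for x k
    by (simp add: free_ns_operad_def)
  have zero: "\<phi> k 0 = 0" if "k \<ge> 1" for k
    using hom that by (intro collection_hom_0[of ?F P]) (simp_all add: ns_operad_hom_def part)
  have comp: "\<phi> (n + m - 1) (bilinear_extension (ns_graft i) x y) = op_comp P n m i (\<phi> n x) (\<phi> m y)"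
    if "keys x \<subseteq> ns_monomials \<Gamma> n" "keys y \<subseteq> ns_monomials \<Gamma> m" for x y
  proof -
    have "op_comp ?F n m i x y = bilinear_extension (ns_graft i) x y" by (simp add: free_ns_operad_def)
    then show ?thesis using hom that assms(2-4) unfolding ns_operad_hom_def part by metis
  qed
  show ?thesis
    using zero[of n] zero[of m] zero[of "n + m - 1"] assms(2-4)
    by (intro bilinear_extension_kernel[where \<phi> = "\<phi> (n + m - 1)"
          and \<phi>\<^sub>1 = "\<phi> n" and \<phi>\<^sub>2 = "\<phi> m" and c = "op_comp P n m i", OF comp _ _ _ f g assms(7)]) simp_all
qed

text \<open>The kernel is an ideal, and grafting with a fixed monomial is injective and monotone. So
  a kernel element with leading monomial \<open>w\<close> can be carried to \<open>v\<close>,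
  filling the leaves of \<open>w\<close> one by one and then adding the outer context.\<close>

lemma ns_leading_monomial_divides:
  fixes \<phi> :: "nat \<Rightarrow> (('g, unit) ptree \<Rightarrow>\<^sub>0 'k::field) \<Rightarrow> 'v::ab_group_add"
  assumes hom: "ns_operad_hom (free_ns_operad \<Gamma>) P \<phi>"
    and r: "ns_admissible_order \<Gamma> r"
    and "ns_divides w v" and v: "v \<in> ns_monomials \<Gamma> n"
    and w: "f \<in> kernel_part (free_ns_operad \<Gamma>) \<phi> (arity w)" "f \<noteq> 0" "leading_monomial r f = w"
  shows "\<exists>f\<in>kernel_part (free_ns_operad \<Gamma>) \<phi> n. f \<noteq> 0 \<and> leading_monomial r f = v"
proof -
  have wo: "well_ordered_by_arity (ns_monomials \<Gamma>) r"
    and mono: "\<And>n m i s s' t t'. 1 \<le> i \<Longrightarrow> i \<le> n \<Longrightarrow> 1 \<le> m \<Longrightarrow> s \<in> ns_monomials \<Gamma> n \<Longrightarrow>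
      s' \<in> ns_monomials \<Gamma> n \<Longrightarrow> (s, s') \<in> r \<Longrightarrow> t \<in> ns_monomials \<Gamma> m \<Longrightarrow> t' \<in> ns_monomials \<Gamma> m \<Longrightarrow>
      (t, t') \<in> r \<Longrightarrow> (ns_graft i s t, ns_graft i s' t') \<in> r"
    using r unfolding ns_admissible_order_def by blast+
  have refl: "(t, t) \<in> r" if "t \<in> ns_monomials \<Gamma> n" "n \<ge> 1" for t n
    using well_ordered_by_arityD(1)[OF wo] that by blast
  define P where "P t \<longleftrightarrow> (\<exists>f\<in>kernel_part (free_ns_operad \<Gamma>) \<phi> (arity t). f \<noteq> 0 \<and>
    leading_monomial r f = t)" for t
  \<comment> \<open>Both moves of the transfer at once: \<open>s\<close> is grafted onto a kernel
    element led by the context with an empty hole, or a kernel element led by \<open>s\<close> is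
    grafted into the context.\<close>
  have step: "labelled_by \<Gamma> (C (Leaf ())) \<and> labelled_by \<Gamma> s \<and> (P (C (Leaf ())) \<longrightarrow> P (C s)) \<and> (P s \<longrightarrow> P (C s))"
    if C: "one_hole C" and Cs: "labelled_by \<Gamma> (C s)" for C s
  proof -
    have lab: "labelled_by \<Gamma> s" "labelled_by \<Gamma> (C (Leaf ()))"
      using labelled_by_one_hole(1)[OF C Cs] labelled_by_one_hole(2)[OF C Cs, of "Leaf ()"] by simp_all
    obtain i where i: "1 \<le> i" "i \<le> arity (C (Leaf ()))" "\<And>s. ns_graft i (C (Leaf ())) s = C s"
      using ns_graft_one_hole[OF C] by blast
    let ?l = "C (Leaf ())"
    let ?n = "arity ?l" and ?m = "arity s"
    have mon: "?l \<in> ns_monomials \<Gamma> ?n" "s \<in> ns_monomials \<Gamma> ?m" using lab by (auto simp: ns_monomials_def)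
    have ge: "?n \<ge> 1" "?m \<ge> 1" using lab arity_ge_1 by blast+
    have ar: "arity (C s) = ?n + ?m - 1" using ns_graft_size(2)[OF i(1,2), of s] i(3) by simp
    have ge': "?n + ?m - 1 \<ge> 1" using ge by simp
    have "P (C s)" if Pl: "P ?l"
    proof -
      obtain f where f: "keys f \<subseteq> ns_monomials \<Gamma> ?n" "\<phi> ?n f = 0" "f \<noteq> 0"
        "leading_monomial r f = ?l"
        using Pl by (auto simp: P_def kernel_part_free_ns)
      have inj: "inj_on (\<lambda>x. ns_graft i x s) (ns_monomials \<Gamma> ?n)"
      proof (rule inj_onI)
        fix x y assume "x \<in> ns_monomials \<Gamma> ?n" "y \<in> ns_monomials \<Gamma> ?n" "ns_graft i x s = ns_graft i y s"
        then show "x = y"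
          using i(2) ge(2) by (intro ns_graft_inj_left[OF i(1), of x y s]) (simp_all add: ns_monomials_def)
      qed
      have closed: "(\<lambda>x. ns_graft i x s) ` ns_monomials \<Gamma> ?n \<subseteq> ns_monomials \<Gamma> (?n + ?m - 1)"
        using ns_graft_closed[OF i(1,2) _ mon(2)] by blast
      let ?g = "bilinear_extension (ns_graft i) f (Poly_Mapping.single s 1)"
      note im = leading_monomial_image[OF wo ge(1) ge' f(3,1) inj closed
          mono[OF i(1,2) ge(2) _ _ _ mon(2) mon(2) refl[OF mon(2) ge(2)]]]
      have "?g \<noteq> 0"
        unfolding bilinear_extension_single_right by (rule im(1))
      moreover have "keys ?g \<subseteq> ns_monomials \<Gamma> (?n + ?m - 1)"
        unfolding bilinear_extension_single_right by (rule im(2))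
      moreover have "leading_monomial r ?g = ns_graft i (leading_monomial r f) s"
        unfolding bilinear_extension_single_right by (rule im(3))
      moreover have "\<phi> (?n + ?m - 1) ?g = 0"
        using mon f by (intro ns_operad_hom_kernel[OF hom i(1,2) ge(2)]) auto
      ultimately show ?thesis
        unfolding P_def ar kernel_part_free_ns by (intro bexI[of _ ?g]) (simp_all add: f(4) i(3))
    qed
    moreover have "P (C s)" if Ps: "P s"
    proof -
      obtain f where f: "keys f \<subseteq> ns_monomials \<Gamma> ?m" "\<phi> ?m f = 0" "f \<noteq> 0"
        "leading_monomial r f = s"
        using Ps by (auto simp: P_def kernel_part_free_ns)
      have inj: "inj_on (\<lambda>x. ns_graft i ?l x) (ns_monomials \<Gamma> ?m)"
        using ns_graft_inj_right[OF i(1,2)] by (intro inj_onI) auto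
      have closed: "(\<lambda>x. ns_graft i ?l x) ` ns_monomials \<Gamma> ?m \<subseteq> ns_monomials \<Gamma> (?n + ?m - 1)"
        using ns_graft_closed[OF i(1,2) mon(1)] by blast
      let ?g = "bilinear_extension (ns_graft i) (Poly_Mapping.single ?l 1) f"
      note im = leading_monomial_image[OF wo ge(2) ge' f(3,1) inj closed
          mono[OF i(1,2) ge(2) mon(1) mon(1) refl[OF mon(1) ge(1)]]]
      have "?g \<noteq> 0"
        unfolding bilinear_extension_single_left by (rule im(1))
      moreover have "keys ?g \<subseteq> ns_monomials \<Gamma> (?n + ?m - 1)"
        unfolding bilinear_extension_single_left by (rule im(2))
      moreover have "leading_monomial r ?g = ns_graft i ?l (leading_monomial r f)"
        unfolding bilinear_extension_single_left by (rule im(3))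
      moreover have "\<phi> (?n + ?m - 1) ?g = 0"
        using mon f by (intro ns_operad_hom_kernel[OF hom i(1,2) ge(2)]) auto
      ultimately show ?thesis
        unfolding P_def ar kernel_part_free_ns by (intro bexI[of _ ?g]) (simp_all add: f(4) i(3))
    qed
    ultimately show ?thesis using lab by blast
  qed
  have "labelled_by \<Gamma> w \<and> (P w \<longrightarrow> P v)"
  proof (rule connected_subtree_transfer[where lab = "\<lambda>_. ()"])
    show "connected_subtree (\<lambda>_. ()) w v" using assms(3) by (simp add: ns_divides_def)
    show "labelled_by \<Gamma> v" using v by (simp add: ns_monomials_def)
  qed (use step in blast)+
  moreover have "P w" unfolding P_def using w by blast
  ultimately have "P v" by blast
  then show ?thesis using v by (simp add: P_def ns_monomials_def)
qed

text \<open>Zero is removed from \<open>G\<close> because \<open>groebner_basis\<close> allows it as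
  an element, while its \<open>leading_monomial\<close> is an unspecified value.\<close>

lemma ns_dim_part:
  fixes P :: "('k::field, 'v::ab_group_add) ns_operad" and \<Gamma> :: "nat \<Rightarrow> 'g set"
  assumes P: "ns_operad P" and pres: "ns_presentation \<Gamma> P \<phi>"
    and r: "ns_admissible_order \<Gamma> r"
    and G: "groebner_basis ns_divides r (kernel_part (free_ns_operad \<Gamma>) \<phi>) G"
    and n: "n \<ge> 1" and fin: "finite_dimensional_part P n"
  defines "N \<equiv> {t \<in> avoiding \<Gamma> (leading_monomial r ` (G - {0})). arity t = n}"
  shows "finite N \<and> dim_part P n = card N"
proof (rule dim_eq_card_normal)
  interpret ns_operad P by (rule P)
  let ?F = "free_ns_operad \<Gamma> :: ('k, ('g, unit) ptree \<Rightarrow>\<^sub>0 'k) ns_operad"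
  have hom: "ns_operad_hom ?F P \<phi>" and surj: "surjective_on_parts ?F P \<phi>"
    using pres by (auto simp: ns_presentation_def)
  then have coll: "collection_hom ?F P \<phi>" by (simp add: ns_operad_hom_def)
  have part: "graded_part ?F n = {f. keys f \<subseteq> ns_monomials \<Gamma> n}" for n
    by (simp add: free_ns_operad_def)
  have sc: "lin_scale ?F = scale_poly_mapping" by (simp add: free_ns_operad_def)
  show "vector_space (lin_scale P)" by (rule vector_space)
  show wo: "well_ordered_by_arity (ns_monomials \<Gamma>) r" using r by (simp add: ns_admissible_order_def)
  show "n \<ge> 1" by (rule n)
  show "\<phi> n (x + y) = \<phi> n x + \<phi> n y"
    if "keys x \<subseteq> ns_monomials \<Gamma> n" "keys y \<subseteq> ns_monomials \<Gamma> n" for x y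
    using coll that n unfolding collection_hom_def part by blast
  show "\<phi> n (scale_poly_mapping c x) = lin_scale P c (\<phi> n x)"
    if "keys x \<subseteq> ns_monomials \<Gamma> n" for c x
    using coll that n unfolding collection_hom_def part sc by blast
  show "\<phi> n ` {f. keys f \<subseteq> ns_monomials \<Gamma> n} = graded_part P n"
    using surj n part unfolding surjective_on_parts_def by blast
  show "N \<subseteq> ns_monomials \<Gamma> n" by (auto simp: N_def avoiding_def ns_monomials_def)
  show "finite_dimensional_part P n" by (rule fin)
  show "leading_monomial r f \<notin> N"
    if "keys f \<subseteq> ns_monomials \<Gamma> n" "\<phi> n f = 0" and f0: "f \<noteq> 0" for f
  proof -
    have "f \<in> kernel_part ?F \<phi> n" using that by (simp add: kernel_part_free_ns)
    then obtain g where "g \<in> G" "g \<noteq> 0" "ns_divides (leading_monomial r g) (leading_monomial r f)"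
      using G n f0 unfolding groebner_basis_def by blast
    then show ?thesis by (auto simp: N_def avoiding_def)
  qed
  show "\<exists>f. keys f \<subseteq> ns_monomials \<Gamma> n \<and> \<phi> n f = 0 \<and> f \<noteq> 0 \<and> leading_monomial r f = m"
    if m: "m \<in> ns_monomials \<Gamma> n" "m \<notin> N" for m
  proof -
    obtain g where g: "g \<in> G" "g \<noteq> 0" "ns_divides (leading_monomial r g) m"
      using m by (auto simp: N_def avoiding_def ns_monomials_def)
    obtain k where k: "k \<ge> 1" "g \<in> kernel_part ?F \<phi> k"
      using G g(1) unfolding groebner_basis_def by auto
    then have "leading_monomial r g \<in> ns_monomials \<Gamma> k"
      using leading_monomial_in_keys[OF wo k(1) _ g(2)] by (auto simp: kernel_part_free_ns)
    then have "g \<in> kernel_part ?F \<phi> (arity (leading_monomial r g))"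
      using k by (simp add: ns_monomials_def)
    from ns_leading_monomial_divides[OF hom r g(3) m(1) this g(2) refl]
    show ?thesis by (auto simp: kernel_part_free_ns)
  qed
qed

text \<open>Formulated along an arithmetic progression, since the lower bound \<open>2 ^ k\<close>
  is available only for such arities.\<close>

lemma poly_less_two_power:
  fixes p :: "real poly"
  obtains k where "poly p (real (a + k * b)) < 2 ^ k"
proof -
  define q where "q = pcompose p [:real a, real b:]"
  have q: "poly p (real (a + k * b)) = (\<Sum>i\<le>degree q. coeff q i * real k ^ i)" for k
  proof -
    have "poly p (real (a + k * b)) = poly q (real k)"
      by (simp add: q_def poly_pcompose mult.commute)
    then show ?thesis by (simp add: poly_altdef)
  qed
  have "(\<lambda>k. real k ^ i / 2 ^ k) \<longlonglongrightarrow> 0" for i :: nat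
  proof -
    have "filterlim (\<lambda>k. real k * ln 2) at_top sequentially"
      by (rule filterlim_at_top_mult_tendsto_pos[OF tendsto_const _ filterlim_real_sequentially]) simp
    then have "(\<lambda>k. (real k * ln 2) ^ i / exp (real k * ln 2)) \<longlonglongrightarrow> 0"
      by (rule filterlim_compose[OF tendsto_power_div_exp_0])
    then have "(\<lambda>k. (1 / ln 2) ^ i * ((real k * ln 2) ^ i / exp (real k * ln 2))) \<longlonglongrightarrow> (1 / ln 2) ^ i * 0"
      by (intro tendsto_mult tendsto_const)
    moreover have "(1 / ln 2) ^ i * ((real k * ln 2) ^ i / exp (real k * ln 2)) = real k ^ i / 2 ^ k"
      for k by (simp add: power_mult_distrib power_divide exp_of_nat_mult)
    ultimately show ?thesis by simp
  qed
  then have "(\<lambda>k. \<Sum>i\<le>degree q. coeff q i * (real k ^ i / 2 ^ k)) \<longlonglongrightarrow> (\<Sum>i\<le>degree q. coeff q i * 0)"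
    by (intro tendsto_sum tendsto_mult tendsto_const)
  then have "(\<lambda>k. \<Sum>i\<le>degree q. coeff q i * (real k ^ i / 2 ^ k)) \<longlonglongrightarrow> 0" by simp
  then have "eventually (\<lambda>k. (\<Sum>i\<le>degree q. coeff q i * (real k ^ i / 2 ^ k)) < 1) sequentially"
    by (rule order_tendstoD) simp
  then obtain k where k: "(\<Sum>i\<le>degree q. coeff q i * (real k ^ i / 2 ^ k)) < 1"
    by (auto simp: eventually_sequentially)
  have "(\<Sum>i\<le>degree q. coeff q i * (real k ^ i / 2 ^ k)) = poly p (real (a + k * b)) / 2 ^ k"
    unfolding q by (simp add: sum_divide_distrib)
  then have "poly p (real (a + k * b)) < 2 ^ k" using k by simp
  then show ?thesis by (rule that)
qed

lemma weight_1: "weight (\<lambda>_ _. 1) t = 1"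
proof (induction t)
  case (Node g ts)
  then have "forest_weight (\<lambda>_ _. 1) (\<lambda>_ _. 1) ts = 1" by (induction ts) auto
  then show ?case by (simp add: weight_Node)
qed simp

theorem ns_rational_series:
  fixes P :: "('k::field, 'v::ab_group_add) ns_operad" and \<Gamma> :: "nat \<Rightarrow> 'g set"
    and p :: "real poly"
  assumes P: "ns_operad P" and pres: "ns_presentation \<Gamma> P \<phi>" and \<Gamma>: "finitely_many_generators \<Gamma>"
    and r: "ns_admissible_order \<Gamma> r"
    and G: "groebner_basis ns_divides r (kernel_part (free_ns_operad \<Gamma>) \<phi>) G" "finite G"
    and bound: "dims_bounded_by P (\<lambda>n. poly p (real n))"
  shows "rational_series (generating_series P)"
proof -
  define W where "W = leading_monomial r ` (G - {0})"
  define L where "L = avoiding \<Gamma> W"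
  have fin_dim: "finite {t \<in> L. arity t = n} \<and> dim_part P n = card {t \<in> L. arity t = n}" if "n \<ge> 1" for n
    using ns_dim_part[OF P pres r G(1) that] bound that
    by (simp add: dims_bounded_by_def L_def W_def)
  have L0: "{t \<in> L. arity t = 0} = {}" using leaves_neq_Nil by (auto simp: L_def avoiding_def)
  have fin: "finite {t \<in> L. arity t = n}" for n
    using fin_dim[of n] L0 by (cases "n = 0") (metis finite.emptyI, simp)
  obtain st :: "('g, unit) ptree \<Rightarrow> ('g, unit) ptree" where "tree_language L st"
    using tree_language_avoiding[OF \<Gamma>, of W] fin G(2) by (auto simp: L_def W_def)
  then interpret tree_language L st .
  \<comment> \<open>Two recursive children of one vertex contradict the polynomial bound.\<close>
  have single: False if node: "Node g (us @ a # vs @ b # ws) \<in> L"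
    and a: "(st (Node g (us @ a # vs @ b # ws)), st a) \<in> step\<^sup>*"
    and b: "(st (Node g (us @ a # vs @ b # ws)), st b) \<in> step\<^sup>*" for g us a vs b ws
  proof -
    obtain c d where cd: "\<And>k. 2 ^ k \<le> card {t \<in> L. arity t = c + k * d}"
      using exponential_growth[OF node a b] by blast
    obtain k where k: "poly p (real (c + k * d)) < 2 ^ k" using poly_less_two_power by blast
    \<comment> \<open>The bound on dimensions holds from arity 1 on; this arity is positive because
      some tree attains it.\<close>
    have "{t \<in> L. arity t = c + k * d} \<noteq> {}"
      using cd[of k] by (metis card.empty not_le zero_less_numeral zero_less_power)
    then have "c + k * d \<ge> 1" using arity_pos by force
    then have "2 ^ k \<le> dim_part P (c + k * d)" using fin_dim cd by simp
    then have "2 ^ k \<le> real (dim_part P (c + k * d))" by (simp flip: of_nat_le_iff)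
    also have "\<dots> \<le> poly p (real (c + k * d))"
      using bound \<open>c + k * d \<ge> 1\<close> unfolding dims_bounded_by_def by blast
    finally show False using k by simp
  qed
  have "rational_series (gf (\<lambda>_ _. 1) X)" if "X \<in> st ` L" for X
  proof (rule rational_gf[OF _ _ _ that])
    fix F G :: "rat fps" assume "rational_series F" "rational_series G"
    then have "rational_series (F * G)" by (rule rational_series_mult)
    also have "F * G = Abs_fps (\<lambda>n. \<Sum>i\<le>n. of_nat 1 * F $ i * G $ (n - i))"
      by (simp add: fps_eq_iff fps_mult_nth atLeast0AtMost)
    finally show "rational_series (Abs_fps (\<lambda>n. \<Sum>i\<le>n. of_nat 1 * F $ i * G $ (n - i)))" .
  next
    fix g us t vs u assume *: "Node g (us @ t # vs) \<in> L"
      "(st (Node g (us @ t # vs)), st t) \<in> step\<^sup>*" "u \<in> set us \<union> set vs"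
    show "(st (Node g (us @ t # vs)), st u) \<notin> step\<^sup>*"
    proof
      assume u: "(st (Node g (us @ t # vs)), st u) \<in> step\<^sup>*"
      from *(3) consider "u \<in> set us" | "u \<in> set vs" by blast
      then show False
      proof cases
        case 1
        then obtain xs ys where "us = xs @ u # ys" by (meson split_list)
        then show False using single[of g xs u ys t vs] *(1,2) u by simp
      next
        case 2
        then obtain xs ys where "vs = xs @ u # ys" by (meson split_list)
        then show False using single[of g us t xs u ys] *(1,2) u by simp
      qed
    qed
  qed simp
  then have "rational_series (Abs_fps (\<lambda>n. of_nat (\<Sum>t\<in>{t \<in> L. arity t = n}. weight (\<lambda>_ _. 1) t)) :: rat fps)"
    by (rule rational_total_gf)
  also have "Abs_fps (\<lambda>n. of_nat (\<Sum>t\<in>{t \<in> L. arity t = n}. weight (\<lambda>_ _. 1) t)) = generating_series P"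
  proof (rule fps_ext)
    fix n
    have "(\<Sum>t\<in>{t \<in> L. arity t = n}. weight (\<lambda>_ _. 1) t) = (if n = 0 then 0 else dim_part P n)"
      unfolding weight_1 using fin_dim[of n] L0 by (cases "n = 0") (simp_all only: sum.empty, simp_all)
    then show "Abs_fps (\<lambda>n. of_nat (\<Sum>t\<in>{t \<in> L. arity t = n}. weight (\<lambda>_ _. 1) t)) $ n =
        generating_series P $ n"
      unfolding generating_series_def fps_nth_Abs_fps by simp
  qed
  finally show ?thesis .
qed


section \<open>Ranks\<close>

text \<open>On \<open>A\<close> this is the inverse of \<open>nth_smallest A\<close>, which also
  counts from 1.\<close>

definition rank :: "nat set \<Rightarrow> nat \<Rightarrow> nat" where
  "rank A a = card {b \<in> A. b \<le> a}"

lemma rank_mono: assumes "finite A" shows "strict_mono_on A (rank A)"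
proof (rule strict_mono_onI)
  fix a b assume "a \<in> A" "b \<in> A" "a < b"
  then have "{c \<in> A. c \<le> a} \<subseteq> {c \<in> A. c \<le> b}" "b \<in> {c \<in> A. c \<le> b} - {c \<in> A. c \<le> a}" by auto
  then have "{c \<in> A. c \<le> a} \<subset> {c \<in> A. c \<le> b}" by blast
  then show "rank A a < rank A b" unfolding rank_def using assms by (intro psubset_card_mono) auto
qed

lemma rank_in: "finite A \<Longrightarrow> a \<in> A \<Longrightarrow> rank A a \<in> {1..card A}"
  unfolding rank_def by (auto simp: Suc_le_eq card_gt_0_iff intro!: card_mono)

lemma rank_image: assumes "finite A" shows "rank A ` A = {1..card A}"
proof (rule card_subset_eq)
  show "rank A ` A \<subseteq> {1..card A}" using rank_in[OF assms] by auto
  show "card (rank A ` A) = card {1..card A}"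
    using card_image[OF strict_mono_on_imp_inj_on[OF rank_mono[OF assms]]] by simp
qed simp

lemma rank_interval: "a \<in> {1..n} \<Longrightarrow> rank {1..n} a = a"
proof -
  assume "a \<in> {1..n}"
  then have "{b \<in> {1..n}. b \<le> a} = {1..a}" by auto
  then show ?thesis by (simp add: rank_def)
qed

lemma rank_strict_mono_image:
  assumes "strict_mono_on A f" "a \<in> A" shows "rank (f ` A) (f a) = rank A a"
proof -
  have "{b \<in> f ` A. b \<le> f a} = f ` {b \<in> A. b \<le> a}"
    using strict_mono_on_less_eq[OF assms(1)] assms(2) by auto
  moreover have "inj_on f {b \<in> A. b \<le> a}"
    using strict_mono_on_imp_inj_on[OF assms(1)] by (rule inj_on_subset) auto
  ultimately show ?thesis by (simp add: rank_def card_image)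
qed

lemma nth_smallest_rank: assumes "finite A" "a \<in> A" shows "nth_smallest A (rank A a) = a"
proof -
  let ?xs = "sorted_list_of_set A"
  obtain i where i: "i < length ?xs" "?xs ! i = a"
    using assms by (metis in_set_conv_nth set_sorted_list_of_set)
  have sorted: "?xs ! j < ?xs ! k" if "j < k" "k < length ?xs" for j k
    using sorted_wrt_nth_less[OF strict_sorted_list_of_set] that by blast
  have "{b \<in> A. b \<le> a} = (\<lambda>j. ?xs ! j) ` {..i}"
  proof (intro equalityI subsetI)
    fix b assume b: "b \<in> {b \<in> A. b \<le> a}"
    then obtain j where j: "j < length ?xs" "?xs ! j = b"
      using assms by (metis (mono_tags, lifting) in_set_conv_nth mem_Collect_eq set_sorted_list_of_set)
    then have "j \<le> i" using sorted[of i j] i b by fastforce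
    then show "b \<in> (\<lambda>j. ?xs ! j) ` {..i}" using j by auto
  next
    fix b assume "b \<in> (\<lambda>j. ?xs ! j) ` {..i}"
    then obtain j where j: "j \<le> i" "b = ?xs ! j" by auto
    then have "b \<in> A" using i assms by (metis le_less_trans nth_mem set_sorted_list_of_set)
    moreover have "b \<le> a" using sorted[of j i] i j by (cases "j = i") auto
    ultimately show "b \<in> {b \<in> A. b \<le> a}" by simp
  qed
  moreover have "inj_on (\<lambda>j. ?xs ! j) {..i}"
    using i by (intro inj_on_nth) auto
  ultimately have "rank A a = Suc i" by (simp add: rank_def card_image)
  then show ?thesis using i by (simp add: nth_smallest_def)
qed

lemma
  assumes "finite A"
  shows nth_smallest_mono: "strict_mono_on {1..card A} (nth_smallest A)"
    and nth_smallest_image: "nth_smallest A ` {1..card A} = A"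
proof -
  show "strict_mono_on {1..card A} (nth_smallest A)"
  proof (rule strict_mono_onI)
    fix i j assume "i \<in> {1..card A}" "j \<in> {1..card A}" "i < j"
    then obtain a b where "a \<in> A" "b \<in> A" "i = rank A a" "j = rank A b"
      using rank_image[OF assms] by blast
    then show "nth_smallest A i < nth_smallest A j"
      using nth_smallest_rank[OF assms] strict_mono_on_less[OF rank_mono[OF assms]] \<open>i < j\<close> by auto
  qed
  have "nth_smallest A ` {1..card A} = (\<lambda>a. nth_smallest A (rank A a)) ` A"
    unfolding rank_image[OF assms, symmetric] by (simp add: image_image)
  then show "nth_smallest A ` {1..card A} = A" using nth_smallest_rank[OF assms] by simp
qed

text \<open>Standardizing a part \<open>T\<close> by itself and then spreading it over the ranks of
  \<open>T\<close> in \<open>V\<close> amounts to standardizing within \<open>V\<close>. This is how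
  the relabellings in a shuffle composition cancel.\<close>

lemma nth_smallest_rank_subset:
  assumes "finite V" "T \<subseteq> V" "a \<in> T" shows "nth_smallest (rank V ` T) (rank T a) = rank V a"
proof -
  have "strict_mono_on T (rank V)"
    using rank_mono[OF assms(1)] assms(2) by (auto simp: strict_mono_on_def)
  then have "rank T a = rank (rank V ` T) (rank V a)" using assms(3) by (simp add: rank_strict_mono_image)
  then show ?thesis
    using nth_smallest_rank[of "rank V ` T" "rank V a"] assms finite_subset by auto
qed

lemma Min_strict_mono_image:
  assumes "finite A" "A \<noteq> {}" "strict_mono_on A (f :: nat \<Rightarrow> nat)" shows "Min (f ` A) = f (Min A)"
proof (rule Min_eqI)
  fix y assume "y \<in> f ` A"
  then obtain a where a: "a \<in> A" "y = f a" by auto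
  then show "f (Min A) \<le> y" using strict_mono_on_less_eq[OF assms(3), of "Min A" a] assms(1,2) by simp
qed (use assms in auto)


section \<open>Relabelling of leaves\<close>

lemma set2_ptree_eq: "set2_ptree t = set (leaves t)"
  by (induction t) auto

lemma map_ptree_cong_leaves: "(\<And>a. a \<in> set (leaves t) \<Longrightarrow> f a = g a) \<Longrightarrow> map_ptree h f t = map_ptree h g t"
  by (intro ptree.map_cong) (auto simp: set2_ptree_eq)

lemma leaves_map_ptree: "leaves (map_ptree h f t) = map f (leaves t)"
  by (induction t) (auto simp: map_concat comp_def cong: map_cong)

lemma labelled_by_map_ptree [simp]: "labelled_by \<Gamma> (map_ptree id f t) = labelled_by \<Gamma> t"
  by (induction t) auto

lemma replace_leaves_Leaf: "replace_leaves (\<lambda>a. Leaf (h a)) t = map_ptree id h t"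
  by (induction t) auto

lemma replace_leaves_map_ptree: "replace_leaves f (map_ptree id h t) = replace_leaves (\<lambda>a. f (h a)) t"
  by (induction t) auto

lemma leaves_replace_leaves: "leaves (replace_leaves f t) = concat (map (\<lambda>a. leaves (f a)) (leaves t))"
proof (induction t)
  case (Node g ts)
  then show ?case by (induction ts) auto
qed simp

lemma labelled_by_replace_leaves:
  "labelled_by \<Gamma> t \<Longrightarrow> (\<And>a. a \<in> set (leaves t) \<Longrightarrow> labelled_by \<Gamma> (f a)) \<Longrightarrow>
    labelled_by \<Gamma> (replace_leaves f t)"
  by (induction t) auto

text \<open>The minima of the inserted trees are ordered like the leaves they replace, so the
  overall minimum lies in the tree inserted at the minimal leaf.\<close>

lemma min_leaf_replace_leaves:
  assumes "leaves t \<noteq> []" "\<And>a. a \<in> set (leaves t) \<Longrightarrow> leaves (f a) \<noteq> []"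
    and mono: "strict_mono_on (set (leaves t)) (\<lambda>a. min_leaf (f a))"
  shows "min_leaf (replace_leaves f t) = min_leaf (f (min_leaf t))"
proof -
  let ?A = "set (leaves t)"
  have in_A: "min_leaf t \<in> ?A" using assms(1) by (auto simp: min_leaf_def)
  have "set (leaves (replace_leaves f t)) = (\<Union>a\<in>?A. set (leaves (f a)))"
    by (simp add: leaves_replace_leaves)
  moreover have "Min (\<Union>a\<in>?A. set (leaves (f a))) = min_leaf (f (min_leaf t))"
  proof (rule Min_eqI)
    fix y assume "y \<in> (\<Union>a\<in>?A. set (leaves (f a)))"
    then obtain a where a: "a \<in> ?A" "y \<in> set (leaves (f a))" by blast
    then have "min_leaf t \<le> a" by (simp add: min_leaf_def)
    then have "min_leaf (f (min_leaf t)) \<le> min_leaf (f a)"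
      using strict_mono_on_less_eq[OF mono in_A a(1)] by simp
    also have "\<dots> \<le> y" using a by (simp add: min_leaf_def)
    finally show "min_leaf (f (min_leaf t)) \<le> y" .
  next
    show "min_leaf (f (min_leaf t)) \<in> (\<Union>a\<in>?A. set (leaves (f a)))"
      using in_A assms(2)[OF in_A] by (intro UN_I[OF in_A]) (auto simp: min_leaf_def[of "f _"])
  qed simp
  ultimately show ?thesis by (simp add: min_leaf_def[of "replace_leaves f t"])
qed

text \<open>The conditions at the old vertices compare only minima, and these keep their
  order.\<close>

lemma shuffle_ordered_replace_leaves:
  assumes "labelled_by \<Gamma> t" "shuffle_ordered t"
    and "\<And>a. a \<in> set (leaves t) \<Longrightarrow> leaves (f a) \<noteq> [] \<and> shuffle_ordered (f a)"
    and "strict_mono_on (set (leaves t)) (\<lambda>a. min_leaf (f a))"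
  shows "shuffle_ordered (replace_leaves f t)"
  using assms
proof (induction t)
  case (Node g ts)
  have mono: "strict_mono_on (set (leaves t)) (\<lambda>a. min_leaf (f a))" if "t \<in> set ts" for t
    using Node.prems(4) that by (auto simp: strict_mono_on_def)
  have min: "min_leaf (replace_leaves f t) = min_leaf (f (min_leaf t))" if "t \<in> set ts" for t
    using that Node.prems mono leaves_neq_Nil[of \<Gamma> t] by (intro min_leaf_replace_leaves) auto
  have in_leaves: "min_leaf t \<in> set (leaves (Node g ts))" if "t \<in> set ts" for t
    using that Node.prems(1) leaves_neq_Nil[of \<Gamma> t] by (auto simp: min_leaf_def intro!: bexI[of _ t])
  have "sorted_wrt (\<lambda>s t. min_leaf s < min_leaf t) ts"
    using Node.prems(2) by (simp add: sorted_wrt_map)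
  then have "sorted_wrt (\<lambda>s t. min_leaf (replace_leaves f s) < min_leaf (replace_leaves f t)) ts"
    by (rule sorted_wrt_mono_rel[rotated])
      (use min in_leaves strict_mono_onD[OF Node.prems(4)] in auto)
  moreover have "shuffle_ordered (replace_leaves f t)" if "t \<in> set ts" for t
    using Node.IH[OF that] Node.prems mono[OF that] that by auto
  ultimately show ?case by (simp add: sorted_wrt_map)
qed simp

lemma min_leaf_Leaf [simp]: "min_leaf (Leaf a) = a"
  by (simp add: min_leaf_def)

lemma min_leaf_in: "leaves t \<noteq> [] \<Longrightarrow> min_leaf t \<in> set (leaves t)"
  by (simp add: min_leaf_def)

lemma shuffle_ordered_map_ptree:
  assumes "labelled_by \<Gamma> t" "shuffle_ordered t" "strict_mono_on (set (leaves t)) h"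
  shows "shuffle_ordered (map_ptree id h t)" "min_leaf (map_ptree id h t) = h (min_leaf t)"
proof -
  show "shuffle_ordered (map_ptree id h t)"
    using shuffle_ordered_replace_leaves[OF assms(1,2), of "\<lambda>a. Leaf (h a)"] assms(3)
    by (simp add: replace_leaves_Leaf)
  show "min_leaf (map_ptree id h t) = h (min_leaf t)"
    using min_leaf_replace_leaves[of t "\<lambda>a. Leaf (h a)"] leaves_neq_Nil[OF assms(1)] assms(3)
    by (simp add: replace_leaves_Leaf)
qed

text \<open>Trees as in the definition of shuffle monomials, but with an arbitrary set of leaf labels; the
  shuffle monomial which they represent is their standardization.\<close>

definition shuffle_tree :: "(nat \<Rightarrow> 'g set) \<Rightarrow> ('g, nat) ptree \<Rightarrow> bool" where
  "shuffle_tree \<Gamma> t \<longleftrightarrow> labelled_by \<Gamma> t \<and> distinct (leaves t) \<and> shuffle_ordered t"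

definition standardize :: "('g, nat) ptree \<Rightarrow> ('g, nat) ptree" where
  "standardize t = map_ptree id (rank (set (leaves t))) t"

lemma shuffle_monomials_alt:
  "t \<in> shuffle_monomials \<Gamma> n \<longleftrightarrow> shuffle_tree \<Gamma> t \<and> set (leaves t) = {1..n}"
  by (auto simp: shuffle_monomials_def shuffle_tree_def)

lemma arity_shuffle_monomial: "t \<in> shuffle_monomials \<Gamma> n \<Longrightarrow> arity t = n"
  by (auto simp: shuffle_monomials_def dest!: distinct_card)

lemma standardize_monomial: "shuffle_tree \<Gamma> t \<Longrightarrow> standardize t \<in> shuffle_monomials \<Gamma> (arity t)"
  using rank_mono[of "set (leaves t)"] rank_image[of "set (leaves t)"]
    strict_mono_on_imp_inj_on[OF rank_mono[of "set (leaves t)"]]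
    shuffle_ordered_map_ptree(1)[of \<Gamma> t "rank (set (leaves t))"] distinct_card[of "leaves t"]
  by (auto simp: shuffle_monomials_def shuffle_tree_def standardize_def leaves_map_ptree distinct_map)

lemma standardize_map_ptree:
  assumes "strict_mono_on (set (leaves t)) f" shows "standardize (map_ptree id f t) = standardize t"
proof -
  have "standardize (map_ptree id f t) = map_ptree id (rank (f ` set (leaves t)) \<circ> f) t"
    by (simp add: standardize_def leaves_map_ptree ptree.map_comp)
  also have "\<dots> = standardize t"
    unfolding standardize_def using rank_strict_mono_image[OF assms]
    by (intro map_ptree_cong_leaves) auto
  finally show ?thesis .
qed

lemma map_ptree_ident: "(\<And>a. a \<in> set (leaves t) \<Longrightarrow> f a = a) \<Longrightarrow> map_ptree id f t = t"
  using map_ptree_cong_leaves[of t f "\<lambda>x. x" id] by (simp add: ptree.map_ident id_def)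

lemma standardize_shuffle_monomial: "t \<in> shuffle_monomials \<Gamma> n \<Longrightarrow> standardize t = t"
  unfolding standardize_def using rank_interval
  by (intro map_ptree_ident) (auto simp: shuffle_monomials_def)

lemma order_isomorphic_standardize: "shuffle_tree \<Gamma> u \<Longrightarrow> order_isomorphic (standardize u) u"
proof -
  assume "shuffle_tree \<Gamma> u"
  let ?A = "set (leaves u)"
  have "u = map_ptree id (nth_smallest ?A) (standardize u)"
    unfolding standardize_def ptree.map_comp id_comp
    by (rule map_ptree_ident[symmetric]) (simp add: nth_smallest_rank)
  moreover have "strict_mono_on (set (leaves (standardize u))) (nth_smallest ?A)"
    using nth_smallest_mono[of ?A] by (simp add: standardize_def leaves_map_ptree rank_image)
  ultimately show ?thesis unfolding order_isomorphic_def by blast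
qed

lemma standardize_if_order_isomorphic:
  assumes "order_isomorphic w u" "w \<in> shuffle_monomials \<Gamma> n" shows "standardize u = w"
  using assms standardize_map_ptree standardize_shuffle_monomial by (metis order_isomorphic_def)


section \<open>Shuffle compositions and contexts\<close>

lemma one_hole_shuffle_ordered:
  assumes "one_hole C" "shuffle_ordered (C s)" shows "shuffle_ordered s"
  using assms by (induction rule: one_hole.induct) auto

lemma min_leaf_one_hole:
  assumes "one_hole C" "leaves s \<noteq> []" "leaves t \<noteq> []" "min_leaf s = min_leaf t"
  shows "min_leaf (C s) = min_leaf (C t)"
proof -
  obtain as bs where C: "\<And>t. leaves (C t) = as @ leaves t @ bs"
    using one_hole_leaves[OF assms(1)] by blast
  have "min_leaf (C t) = (if as @ bs = [] then min_leaf t else min (Min (set (as @ bs))) (min_leaf t))"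
    if "leaves t \<noteq> []" for t
  proof -
    have "set (leaves (C t)) = set (as @ bs) \<union> set (leaves t)" by (auto simp: C)
    then show ?thesis
      unfolding min_leaf_def using that by (simp add: Min_Un del: set_append)
  qed
  then show ?thesis using assms by simp
qed

text \<open>A vertex above the hole sees the filling only through its minimal leaf; this is why a
  cut-off subtree may be represented by its minimum.\<close>

lemma one_hole_shuffle_ordered_replace:
  assumes "one_hole C" "leaves s \<noteq> []" "leaves t \<noteq> []" "min_leaf s = min_leaf t"
    and "shuffle_ordered (C s)" "shuffle_ordered t"
  shows "shuffle_ordered (C t)"
  using assms
proof (induction rule: one_hole.induct)
  case (one_hole_Node C g us vs)
  then show ?case using min_leaf_one_hole[OF one_hole_Node.hyps, of s t] by auto
qed simp

lemma shuffle_tree_one_hole: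
  assumes "one_hole C" "shuffle_tree \<Gamma> (C s)"
  shows "shuffle_tree \<Gamma> s" "shuffle_tree \<Gamma> (C (Leaf (min_leaf s)))"
proof -
  obtain as bs where C: "\<And>t. leaves (C t) = as @ leaves t @ bs"
    using one_hole_leaves[OF assms(1)] by blast
  show s: "shuffle_tree \<Gamma> s"
    using assms one_hole_shuffle_ordered[OF assms(1)] labelled_by_one_hole(1)[OF assms(1)]
    by (simp add: shuffle_tree_def C)
  then have "leaves s \<noteq> []" using leaves_neq_Nil by (auto simp: shuffle_tree_def)
  then have min: "min_leaf s \<in> set (leaves s)" by (simp add: min_leaf_def)
  have "labelled_by \<Gamma> (C (Leaf (min_leaf s)))"
    using assms labelled_by_one_hole(2)[OF assms(1), of \<Gamma> s "Leaf (min_leaf s)"]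
    by (simp add: shuffle_tree_def)
  moreover have "shuffle_ordered (C (Leaf (min_leaf s)))"
    by (rule one_hole_shuffle_ordered_replace[OF assms(1), of s])
      (use assms(2) \<open>leaves s \<noteq> []\<close> in \<open>auto simp: shuffle_tree_def\<close>)
  ultimately show "shuffle_tree \<Gamma> (C (Leaf (min_leaf s)))"
    using assms(2) min by (auto simp: shuffle_tree_def C)
qed

text \<open>Distinctness makes the hole the only leaf labelled \<open>\<mu>\<close>, so
  \<open>G\<close> inserts \<open>s\<close> there and merely relabels all other leaves.\<close>

lemma replace_leaves_one_hole:
  assumes "one_hole C" "distinct (leaves (C (Leaf \<mu>)))" "G \<mu> = map_ptree id h s"
    and "\<And>a. a \<in> set (leaves (C (Leaf \<mu>))) \<Longrightarrow> a \<noteq> \<mu> \<Longrightarrow> G a = Leaf (h a)"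
  shows "replace_leaves G (C (Leaf \<mu>)) = map_ptree id h (C s)"
  using assms
proof (induction rule: one_hole.induct)
  case (one_hole_Node C g us vs)
  obtain as bs where C: "\<And>t. leaves (C t) = as @ leaves t @ bs"
    using one_hole_leaves[OF one_hole_Node.hyps] by blast
  have rest: "replace_leaves G u = map_ptree id h u" if "u \<in> set us \<union> set vs" for u
  proof -
    have "G a = Leaf (h a)" if "a \<in> set (leaves u)" for a
    proof (rule one_hole_Node.prems(3))
      show "a \<in> set (leaves (Node g (us @ C (Leaf \<mu>) # vs)))"
        using that \<open>u \<in> set us \<union> set vs\<close> by auto
      show "a \<noteq> \<mu>" using one_hole_Node.prems(1) that \<open>u \<in> set us \<union> set vs\<close> by (auto simp: C)
    qed
    then have "replace_leaves G u = replace_leaves (\<lambda>a. Leaf (h a)) u"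
    proof (induction u)
      case (Node x ts)
      then show ?case by (auto intro!: map_cong)
    qed simp
    then show ?thesis by (simp add: replace_leaves_Leaf)
  qed
  have "replace_leaves G (C (Leaf \<mu>)) = map_ptree id h (C s)"
    using one_hole_Node.prems by (intro one_hole_Node.IH) auto
  then show ?case using rest by (simp add: id_def)
qed simp

text \<open>The shuffle counterpart of \<open>ns_graft_one_hole\<close>. Here \<open>B\<close>
  consists of the ranks, among all leaves, of the leaves of the inner tree.\<close>

lemma standardize_one_hole:
  assumes C: "one_hole C" and valid: "shuffle_tree \<Gamma> (C s)"
  defines "l \<equiv> C (Leaf (min_leaf s))"
  obtains B where "B \<in> shuffle_index (arity l) (arity s)"
    "standardize (C s) = shuffle_graft (arity l) (arity s) B (standardize l) (standardize s)"
    "arity (C s) = arity l + arity s - 1"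
proof -
  define V S \<mu> where "V = set (leaves (C s))" and "S = set (leaves s)" and "\<mu> = min_leaf s"
  define M where "M = set (leaves l)"
  define B where "B = rank V ` S"
  let ?n = "arity l" and ?m = "arity s"
  obtain as bs where leaves: "\<And>t. leaves (C t) = as @ leaves t @ bs"
    using one_hole_leaves[OF C] by blast
  have fin: "finite V" "finite S" "finite M" by (simp_all add: V_def S_def M_def)
  note trees = shuffle_tree_one_hole[OF C valid, folded l_def]
  then have "leaves s \<noteq> []" using leaves_neq_Nil by (auto simp: shuffle_tree_def)
  then have \<mu>: "\<mu> \<in> S" "\<mu> = Min S" by (simp_all add: \<mu>_def S_def min_leaf_def)
  have SV: "S \<subseteq> V" and M: "M = insert \<mu> (V - S)"
    using valid by (auto simp: S_def V_def M_def l_def leaves \<mu>_def shuffle_tree_def)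
  then have MV: "M \<subseteq> V" using \<mu> by auto
  have card: "card V = ?n + ?m - 1" "card S = ?m"
    using valid trees distinct_card[of "leaves s"] distinct_card[of "leaves (C s)"]
    by (auto simp: V_def S_def shuffle_tree_def leaves l_def)
  have inj: "inj_on (rank V) V" using strict_mono_on_imp_inj_on[OF rank_mono[OF fin(1)]] .
  have mono: "strict_mono_on S (rank V)" "strict_mono_on M (rank V)"
    using rank_mono[OF fin(1)] SV MV by (auto simp: strict_mono_on_def)
  have ran: "rank V ` V = {1..?n + ?m - 1}" using rank_image[OF fin(1)] card by simp
  have MinB: "Min B = rank V \<mu>"
    unfolding B_def \<mu>(2) using \<mu>(1) by (intro Min_strict_mono_image fin mono) auto
  have "rank V ` V - rank V ` S = rank V ` (V - S)"
    using inj SV by (simp add: inj_on_image_set_diff[of _ V])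
  then have lower: "lower_labels ?n ?m B = rank V ` M"
    unfolding lower_labels_def ran[symmetric] using MinB by (simp add: M B_def)
  \<comment> \<open>No label of \<open>S\<close> lies below its minimum \<open>\<mu>\<close>, so
    dropping the rest of \<open>S\<close> keeps the rank of \<open>\<mu>\<close>. Hence the replaced
    leaf of the standardized lower tree is the one labelled \<open>Min B\<close>.\<close>
  have rank\<mu>: "rank M \<mu> = rank V \<mu>"
  proof -
    have "{b \<in> M. b \<le> \<mu>} = {b \<in> V. b \<le> \<mu>}"
      using SV \<mu> Min_le[OF fin(2)] by (auto simp: M intro: antisym)
    then show ?thesis by (simp add: rank_def)
  qed
  have rank_neq: "rank M a \<noteq> Min B" if "a \<in> M" "a \<noteq> \<mu>" for a
    using strict_mono_on_imp_inj_on[OF rank_mono[OF fin(3)]] that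
    by (auto simp: MinB rank\<mu>[symmetric] M inj_on_def)
  define F where "F j = (if j = Min B then map_ptree id (nth_smallest B) (standardize s)
    else Leaf (nth_smallest (lower_labels ?n ?m B) j))" for j
  have "shuffle_graft ?n ?m B (standardize l) (standardize s) = replace_leaves (\<lambda>a. F (rank M a)) l"
    by (simp add: shuffle_graft_def F_def[abs_def] standardize_def[of l] M_def replace_leaves_map_ptree)
  also have "\<dots> = map_ptree id (rank V) (C s)"
    unfolding l_def
  proof (rule replace_leaves_one_hole[OF C])
    show "distinct (leaves (C (Leaf (min_leaf s))))" using trees(2) by (simp add: shuffle_tree_def l_def)
    have "F (rank M \<mu>) = map_ptree id (nth_smallest B \<circ> rank S) s"
      by (simp add: F_def rank\<mu> MinB standardize_def ptree.map_comp S_def)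
    also have "\<dots> = map_ptree id (rank V) s"
      using nth_smallest_rank_subset[OF fin(1) SV]
      by (intro map_ptree_cong_leaves) (simp add: B_def S_def)
    finally show "F (rank M (min_leaf s)) = map_ptree id (rank V) s" by (simp add: \<mu>_def)
    show "F (rank M a) = Leaf (rank V a)"
      if "a \<in> set (leaves (C (Leaf (min_leaf s))))" "a \<noteq> min_leaf s" for a
    proof -
      have a: "a \<in> M" "a \<noteq> \<mu>" using that by (simp_all add: M_def l_def \<mu>_def)
      then show ?thesis using rank_neq[OF a] nth_smallest_rank_subset[OF fin(1) MV a(1)]
        by (simp add: F_def lower)
    qed
  qed
  also have "\<dots> = standardize (C s)" by (simp add: standardize_def V_def)
  finally have std: "standardize (C s) = shuffle_graft ?n ?m B (standardize l) (standardize s)" by simp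
  have "B \<in> shuffle_index ?n ?m"
    using ran SV card_image[OF strict_mono_on_imp_inj_on[OF mono(1)]] card
    by (auto simp: shuffle_index_def B_def)
  moreover have "arity (C s) = ?n + ?m - 1" by (simp add: l_def leaves)
  ultimately show ?thesis using that std by blast
qed

section \<open>Shuffle grafts of monomials: closure and injectivity\<close>

lemma shuffle_index_facts:
  assumes "1 \<le> n" "1 \<le> m" "B \<in> shuffle_index n m"
  shows "finite B" "B \<noteq> {}" "card B = m" "B \<subseteq> {1..n + m - 1}"
    "finite (lower_labels n m B)" "card (lower_labels n m B) = n"
    "Min B \<in> {1..n}" "nth_smallest (lower_labels n m B) (Min B) = Min B"
    "nth_smallest B 1 = Min B"
proof -
  let ?M = "lower_labels n m B"
  show B: "card B = m" "B \<subseteq> {1..n + m - 1}" using assms(3) by (auto simp: shuffle_index_def)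
  show fin: "finite B" using B(2) finite_subset by blast
  show ne: "B \<noteq> {}" using B(1) assms(2) by auto
  have min: "Min B \<in> B" using fin ne by simp
  show fM: "finite ?M" by (simp add: lower_labels_def)
  show cM: "card ?M = n"
    using assms(1,2) B fin min by (simp add: lower_labels_def card_Diff_subset)
  \<comment> \<open>Labels below \<open>Min B\<close> do not belong to \<open>B\<close> and so all
    remain; thus \<open>Min B\<close> is its own rank among the lower labels.\<close>
  have "{b \<in> ?M. b \<le> Min B} = {1..Min B}"
    using fin B min by (auto simp: lower_labels_def) (metis Min_le le_antisym)
  then have r: "rank ?M (Min B) = Min B" by (simp add: rank_def)
  have inM: "Min B \<in> ?M" by (simp add: lower_labels_def)
  show "Min B \<in> {1..n}" using rank_in[OF fM inM] r cM by simp
  show "nth_smallest ?M (Min B) = Min B" using nth_smallest_rank[OF fM inM] r by simp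
  have "{b \<in> B. b \<le> Min B} = {Min B}" using fin min by (auto intro: antisym)
  then have "rank B (Min B) = 1" by (simp add: rank_def)
  then show "nth_smallest B 1 = Min B" using nth_smallest_rank[OF fin min] by simp
qed

definition graft_leaf :: "nat \<Rightarrow> nat \<Rightarrow> nat set \<Rightarrow> ('g, nat) ptree \<Rightarrow> nat \<Rightarrow> ('g, nat) ptree" where
  "graft_leaf n m B t j = (if j = Min B then map_ptree id (nth_smallest B) t
    else Leaf (nth_smallest (lower_labels n m B) j))"

lemma shuffle_graft_eq: "shuffle_graft n m B s t = replace_leaves (graft_leaf n m B t) s"
  by (simp add: shuffle_graft_def graft_leaf_def[abs_def])

lemma leaves_graft_leaf:
  assumes "1 \<le> n" "1 \<le> m" "B \<in> shuffle_index n m" and t: "t \<in> shuffle_monomials \<Gamma> m" and j: "j \<in> {1..n}"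
  shows "set (leaves (graft_leaf n m B t j)) =
      (if j = Min B then B else {nth_smallest (lower_labels n m B) j})"
    and "arity (graft_leaf n m B t j) = (if j = Min B then m else 1)"
    and "min_leaf (graft_leaf n m B t j) = nth_smallest (lower_labels n m B) j"
    and "shuffle_ordered (graft_leaf n m B t j)"
    and "labelled_by \<Gamma> (graft_leaf n m B t j)"
proof -
  note facts = shuffle_index_facts[OF assms(1-3)]
  have t': "set (leaves t) = {1..m}" "labelled_by \<Gamma> t" "shuffle_ordered t" "arity t = m"
    using t arity_shuffle_monomial[OF t] by (auto simp: shuffle_monomials_def)
  have mono: "strict_mono_on (set (leaves t)) (nth_smallest B)"
    using nth_smallest_mono[OF facts(1)] by (simp add: t' facts(3))
  show "set (leaves (graft_leaf n m B t j)) =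
      (if j = Min B then B else {nth_smallest (lower_labels n m B) j})"
    using nth_smallest_image[OF facts(1)] by (simp add: graft_leaf_def leaves_map_ptree t' facts(3))
  show "arity (graft_leaf n m B t j) = (if j = Min B then m else 1)"
    by (simp add: graft_leaf_def leaves_map_ptree t')
  have "min_leaf t = 1" unfolding min_leaf_def t' using assms(2) by (intro Min_eqI) auto
  then show "min_leaf (graft_leaf n m B t j) = nth_smallest (lower_labels n m B) j"
    using shuffle_ordered_map_ptree(2)[OF t'(2,3) mono] facts(8,9) by (simp add: graft_leaf_def)
  show "shuffle_ordered (graft_leaf n m B t j)"
    using shuffle_ordered_map_ptree(1)[OF t'(2,3) mono] by (simp add: graft_leaf_def)
  show "labelled_by \<Gamma> (graft_leaf n m B t j)" using t' by (simp add: graft_leaf_def)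
qed

lemma shuffle_graft_closed:
  assumes "1 \<le> n" "1 \<le> m" "B \<in> shuffle_index n m"
    and s: "s \<in> shuffle_monomials \<Gamma> n" and t: "t \<in> shuffle_monomials \<Gamma> m"
  shows "shuffle_graft n m B s t \<in> shuffle_monomials \<Gamma> (n + m - 1)"
proof -
  note facts = shuffle_index_facts[OF assms(1-3)]
  note leaf = leaves_graft_leaf[OF assms(1-3) t]
  let ?M = "lower_labels n m B"
  let ?f = "graft_leaf n m B t"
  have s': "set (leaves s) = {1..n}" "labelled_by \<Gamma> s" "shuffle_ordered s" "distinct (leaves s)"
    using s by (auto simp: shuffle_monomials_def)
  have lab: "labelled_by \<Gamma> (replace_leaves ?f s)"
    using s' leaf(5) by (intro labelled_by_replace_leaves) auto
  have neq: "leaves (?f j) \<noteq> []" if "j \<in> {1..n}" for j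
    using leaf(2)[OF that] assms(2) by (auto split: if_splits)
  have mono: "strict_mono_on {1..n} (\<lambda>j. min_leaf (?f j))"
    using nth_smallest_mono[OF facts(5)] leaf(3) by (auto simp: strict_mono_on_def facts(6))
  have ord: "shuffle_ordered (replace_leaves ?f s)"
    using s' leaf(4) neq mono by (intro shuffle_ordered_replace_leaves[of \<Gamma>]) auto
  have "nth_smallest ?M ` ({1..n} - {Min B}) = ?M - {Min B}"
    using strict_mono_on_imp_inj_on[OF nth_smallest_mono[OF facts(5)]] facts(7,8)
      nth_smallest_image[OF facts(5)]
    by (simp add: facts(6) inj_on_image_set_diff[of _ "{1..n}"])
  also have "\<dots> = {1..n + m - 1} - B"
    using facts(1,2) by (auto simp: lower_labels_def)
  finally have img: "nth_smallest ?M ` ({1..n} - {Min B}) = {1..n + m - 1} - B" .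
  have "set (leaves (replace_leaves ?f s)) = (\<Union>j\<in>{1..n}. set (leaves (?f j)))"
    by (simp add: leaves_replace_leaves s')
  also have "\<dots> = (\<Union>j\<in>{1..n}. if j = Min B then B else {nth_smallest ?M j})"
    using leaf(1) by simp
  also have "\<dots> = B \<union> nth_smallest ?M ` ({1..n} - {Min B})"
    using facts(7) by (auto split: if_splits)
  also have "\<dots> = {1..n + m - 1}" using img facts(4) by auto
  finally have set: "set (leaves (replace_leaves ?f s)) = {1..n + m - 1}" .
  \<comment> \<open>Distinctness is obtained by counting: there are as many leaves as
    labels.\<close>
  have "arity (replace_leaves ?f s) = sum_list (map (\<lambda>j. arity (?f j)) (leaves s))"
    by (simp add: leaves_replace_leaves length_concat comp_def)
  also have "\<dots> = (\<Sum>j\<in>{1..n}. if j = Min B then m else 1)"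
    using leaf(2) by (subst sum_list_distinct_conv_sum_set[OF s'(4)]) (simp add: s')
  also have "\<dots> = m + (\<Sum>j\<in>{1..n} - {Min B}. 1)"
    using facts(7) by (subst sum.remove[of _ "Min B"]) (auto intro!: sum.cong)
  also have "\<dots> = n + m - 1" using facts(7) assms(1) by simp
  finally have "distinct (leaves (replace_leaves ?f s))"
    using set by (intro card_distinct) simp
  then show ?thesis using lab ord set by (simp add: shuffle_monomials_def shuffle_graft_eq)
qed

lemma size_map_ptree [simp]: "size (map_ptree id f t) = size t"
  by (induction t) (auto simp: size_list_conv_sum_list comp_def cong: map_cong)

lemma size_replace_leaves_ge: "a \<in> set (leaves t) \<Longrightarrow> size (f a) \<le> size (replace_leaves f t)"
proof (induction t)
  case (Node g ts)
  then obtain t where t: "t \<in> set ts" "a \<in> set (leaves t)" by auto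
  then have "size (f a) \<le> size (replace_leaves f t)" using Node.IH by blast
  also have "\<dots> \<le> size_list size (map (replace_leaves f) ts)"
    using t by (intro size_list_estimation'[OF _ order_refl]) auto
  finally show ?case by simp
qed simp

text \<open>Where one tree has a leaf and the other one a vertex, that vertex can only belong to the tree
  which has replaced the leaf; but then this tree would properly contain itself.\<close>

lemma replace_leaves_inj:
  assumes disj: "\<And>a b. a \<in> D \<Longrightarrow> b \<in> D \<Longrightarrow> a \<noteq> b \<Longrightarrow> set (leaves (f a)) \<inter> set (leaves (f b)) = {}"
    and ne: "\<And>a. a \<in> D \<Longrightarrow> leaves (f a) \<noteq> []"
    and "labelled_by \<Gamma> s" "labelled_by \<Gamma> t" "set (leaves s) \<subseteq> D" "set (leaves t) \<subseteq> D"
    and "replace_leaves f s = replace_leaves f t"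
  shows "s = t"
proof -
  have no: False if a: "a \<in> D" and N: "labelled_by \<Gamma> (Node g ts)" "set (leaves (Node g ts)) \<subseteq> D"
    and eq: "f a = replace_leaves f (Node g ts)" for a g ts
  proof -
    obtain t where t: "t \<in> set ts" "leaves t \<noteq> []" using N(1) leaves_neq_Nil by (cases ts) auto
    then obtain b where b: "b \<in> set (leaves t)" by (cases "leaves t") auto
    then have bD: "b \<in> D" "b \<in> set (leaves (Node g ts))" using t N(2) by auto
    have "set (leaves (f b)) \<subseteq> set (leaves (replace_leaves f (Node g ts)))"
      using bD(2) unfolding leaves_replace_leaves by auto
    then have "set (leaves (f b)) \<subseteq> set (leaves (f a))" by (simp only: eq)
    then have "a = b" using disj[OF a bD(1)] ne[OF bD(1)] by (cases "leaves (f b)") auto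
    have "size (f b) \<le> size (replace_leaves f t)" using b by (rule size_replace_leaves_ge)
    also have "\<dots> \<le> size_list size (map (replace_leaves f) ts)"
      using t by (intro size_list_estimation'[OF _ order_refl]) auto
    also have "\<dots> < size (f a)" by (simp add: eq)
    finally show False using \<open>a = b\<close> by simp
  qed
  show ?thesis
    using assms(3-)
  proof (induction s arbitrary: t)
    case (Leaf a)
    show ?case
    proof (cases t)
      case (Leaf b)
      then have "f a = f b" using Leaf.prems by simp
      then have "a = b" using disj[of a b] ne[of a] Leaf.prems Leaf by (cases "leaves (f a)") auto
      then show ?thesis using Leaf by simp
    next
      case (Node g ts)
      then show ?thesis using no[of a g ts] Leaf.prems by simp
    qed
  next
    case (Node g ss)
    show ?case
    proof (cases t)
      case (Leaf b)
      then show ?thesis using no[of b g ss] Node.prems by simp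
    next
      case t: (Node h ts)
      have "ss = ts"
      proof (rule nth_equalityI)
        have eq: "map (replace_leaves f) ss = map (replace_leaves f) ts" using Node.prems(5) t by simp
        then show len: "length ss = length ts" by (rule map_eq_imp_length_eq)
        fix i assume i: "i < length ss"
        then have "ss ! i \<in> set ss" "ts ! i \<in> set ts" using len by simp_all
        moreover have "replace_leaves f (ss ! i) = replace_leaves f (ts ! i)"
          using eq i len by (metis nth_map)
        ultimately show "ss ! i = ts ! i"
          using Node.prems(1-4) t by (intro Node.IH) auto
      qed
      then show ?thesis using Node.prems t by simp
    qed
  qed
qed

text \<open>The label sets inserted at different leaves are disjoint: \<open>B\<close> at
  \<open>Min B\<close>, and single labels outside \<open>B\<close> elsewhere. So
  \<open>replace_leaves_inj\<close> applies.\<close>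

lemma shuffle_graft_inj_left:
  assumes "1 \<le> n" "1 \<le> m" "B \<in> shuffle_index n m" and t: "t \<in> shuffle_monomials \<Gamma> m"
  shows "inj_on (\<lambda>s. shuffle_graft n m B s t) (shuffle_monomials \<Gamma> n)"
proof (rule inj_onI)
  fix s s' assume s: "s \<in> shuffle_monomials \<Gamma> n" "s' \<in> shuffle_monomials \<Gamma> n"
    and eq: "shuffle_graft n m B s t = shuffle_graft n m B s' t"
  note facts = shuffle_index_facts[OF assms(1-3)]
  note leaf = leaves_graft_leaf[OF assms(1-4)]
  let ?M = "lower_labels n m B"
  have inj: "inj_on (nth_smallest ?M) {1..n}"
    using strict_mono_on_imp_inj_on[OF nth_smallest_mono[OF facts(5)]] by (simp add: facts(6))
  have lower: "nth_smallest ?M j \<notin> B" if "j \<in> {1..n}" "j \<noteq> Min B" for j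
  proof -
    have "nth_smallest ?M j \<in> ?M" using nth_smallest_image[OF facts(5)] that by (auto simp: facts(6))
    moreover have "nth_smallest ?M j \<noteq> Min B"
      using inj that facts(7,8) by (metis inj_onD)
    ultimately show ?thesis by (simp add: lower_labels_def)
  qed
  show "s = s'"
  proof (rule replace_leaves_inj[where D = "{1..n}" and f = "graft_leaf n m B t" and \<Gamma> = \<Gamma>])
    show "replace_leaves (graft_leaf n m B t) s = replace_leaves (graft_leaf n m B t) s'"
      using eq by (simp add: shuffle_graft_eq)
    show "leaves (graft_leaf n m B t a) \<noteq> []" if "a \<in> {1..n}" for a
      using leaf(2)[OF that] assms(2) by (auto split: if_splits)
    show "set (leaves (graft_leaf n m B t a)) \<inter> set (leaves (graft_leaf n m B t b)) = {}"
      if "a \<in> {1..n}" "b \<in> {1..n}" "a \<noteq> b" for a b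
      using leaf(1)[OF that(1)] leaf(1)[OF that(2)] lower[OF that(1)] lower[OF that(2)]
        inj_onD[OF inj _ that(1,2)] that(3) by auto
  qed (use s in \<open>auto simp: shuffle_monomials_def\<close>)
qed

lemma shuffle_graft_inj_right:
  assumes "1 \<le> n" "1 \<le> m" "B \<in> shuffle_index n m" and s: "s \<in> shuffle_monomials \<Gamma> n"
  shows "inj_on (\<lambda>t. shuffle_graft n m B s t) (shuffle_monomials \<Gamma> m)"
proof (rule inj_onI)
  fix t t' assume t: "t \<in> shuffle_monomials \<Gamma> m" "t' \<in> shuffle_monomials \<Gamma> m"
    and eq: "shuffle_graft n m B s t = shuffle_graft n m B s t'"
  note facts = shuffle_index_facts[OF assms(1-3)]
  have "f a = f' a" if "replace_leaves f s = replace_leaves f' s" "a \<in> set (leaves s)" for f f' a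
    using that by (induction s) auto
  from this[OF eq[unfolded shuffle_graft_eq], of "Min B"]
  have eq': "map_ptree id (nth_smallest B) t = map_ptree id (nth_smallest B) t'"
    using s facts(7) by (simp add: graft_leaf_def shuffle_monomials_def)
  have inj: "inj_on (nth_smallest B) {1..m}"
    using strict_mono_on_imp_inj_on[OF nth_smallest_mono[OF facts(1)]] by (simp add: facts(3))
  show "t = t'"
    by (rule ptree.inj_map_strong[OF _ _ eq'])
      (use t inj_onD[OF inj] in \<open>auto simp: set2_ptree_eq shuffle_monomials_def\<close>)
qed


section \<open>Leading monomials in the shuffle operad\<close>

lemma kernel_part_free_shuffle:
  "kernel_part (free_shuffle_operad \<Gamma>) \<phi> n =
    {f. keys f \<subseteq> shuffle_monomials \<Gamma> n \<and> \<phi> n f = 0}"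
  by (simp add: kernel_part_def free_shuffle_operad_def)

lemma shuffle_operad_hom_kernel:
  fixes \<phi> :: "nat \<Rightarrow> (('g, nat) ptree \<Rightarrow>\<^sub>0 'k::field) \<Rightarrow> 'v::ab_group_add"
  assumes hom: "shuffle_operad_hom (free_shuffle_operad \<Gamma>) P \<phi>"
    and "1 \<le> n" "1 \<le> m" "B \<in> shuffle_index n m"
    and f: "keys f \<subseteq> shuffle_monomials \<Gamma> n"
    and g: "keys g \<subseteq> shuffle_monomials \<Gamma> m"
    and "\<phi> n f = 0 \<or> \<phi> m g = 0"
  shows "\<phi> (n + m - 1) (bilinear_extension (shuffle_graft n m B) f g) = 0"
proof -
  let ?F = "free_shuffle_operad \<Gamma> :: ('k, ('g, nat) ptree \<Rightarrow>\<^sub>0 'k) shuffle_operad"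
  have part: "x \<in> graded_part ?F k \<longleftrightarrow> keys x \<subseteq> shuffle_monomials \<Gamma> k" for x k
    by (simp add: free_shuffle_operad_def)
  have zero: "\<phi> k 0 = 0" if "k \<ge> 1" for k
    using hom that by (intro collection_hom_0[of ?F P]) (simp_all add: shuffle_operad_hom_def part)
  have comp: "\<phi> (n + m - 1) (bilinear_extension (shuffle_graft n m B) x y) =
      sh_comp P n m B (\<phi> n x) (\<phi> m y)"
    if "keys x \<subseteq> shuffle_monomials \<Gamma> n" "keys y \<subseteq> shuffle_monomials \<Gamma> m" for x y
  proof -
    have "sh_comp ?F n m B x y = bilinear_extension (shuffle_graft n m B) x y"
      by (simp add: free_shuffle_operad_def)
    then show ?thesis using hom that assms(2-4) unfolding shuffle_operad_hom_def part by metis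
  qed
  show ?thesis
    using zero[of n] zero[of m] zero[of "n + m - 1"] assms(2-4)
    by (intro bilinear_extension_kernel[where \<phi> = "\<phi> (n + m - 1)"
          and \<phi>\<^sub>1 = "\<phi> n" and \<phi>\<^sub>2 = "\<phi> m" and c = "sh_comp P n m B", OF comp _ _ _ f g assms(7)]) simp_all
qed

lemma shuffle_tree_arity: "shuffle_tree \<Gamma> t \<Longrightarrow> arity t \<ge> 1"
  using arity_ge_1 by (auto simp: shuffle_tree_def)

lemma connected_subtree_shuffle_tree:
  assumes "connected_subtree min_leaf u v" "shuffle_tree \<Gamma> v" shows "shuffle_tree \<Gamma> u"
  using connected_subtree_transfer[where lab = min_leaf and V = "shuffle_tree \<Gamma>" and P = "\<lambda>_. True"]
    assms shuffle_tree_one_hole by blast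

text \<open>The transfer argument of the planar case. The trees met on the way carry arbitrary label
  sets, so the property carried along speaks of their standardizations.\<close>

lemma shuffle_leading_monomial_divides:
  fixes \<phi> :: "nat \<Rightarrow> (('g, nat) ptree \<Rightarrow>\<^sub>0 'k::field) \<Rightarrow> 'v::ab_group_add"
  assumes hom: "shuffle_operad_hom (free_shuffle_operad \<Gamma>) Q \<phi>"
    and r: "shuffle_admissible_order \<Gamma> r"
    and divides: "shuffle_divides w v" and v: "v \<in> shuffle_monomials \<Gamma> n"
    and w: "w \<in> shuffle_monomials \<Gamma> k" "f \<in> kernel_part (free_shuffle_operad \<Gamma>) \<phi> k" "f \<noteq> 0"
      "leading_monomial r f = w"
  shows "\<exists>f\<in>kernel_part (free_shuffle_operad \<Gamma>) \<phi> n. f \<noteq> 0 \<and> leading_monomial r f = v"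
proof -
  have wo: "well_ordered_by_arity (shuffle_monomials \<Gamma>) r"
    and mono: "\<And>n m B s s' t t'. 1 \<le> n \<Longrightarrow> 1 \<le> m \<Longrightarrow> B \<in> shuffle_index n m \<Longrightarrow>
      s \<in> shuffle_monomials \<Gamma> n \<Longrightarrow> s' \<in> shuffle_monomials \<Gamma> n \<Longrightarrow> (s, s') \<in> r \<Longrightarrow>
      t \<in> shuffle_monomials \<Gamma> m \<Longrightarrow> t' \<in> shuffle_monomials \<Gamma> m \<Longrightarrow> (t, t') \<in> r \<Longrightarrow>
      (shuffle_graft n m B s t, shuffle_graft n m B s' t') \<in> r"
    using r unfolding shuffle_admissible_order_def by blast+
  have refl: "(t, t) \<in> r" if "t \<in> shuffle_monomials \<Gamma> n" "n \<ge> 1" for t n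
    using well_ordered_by_arityD(1)[OF wo] that by blast
  define P where "P t \<longleftrightarrow> (\<exists>f\<in>kernel_part (free_shuffle_operad \<Gamma>) \<phi> (arity t). f \<noteq> 0 \<and>
    leading_monomial r f = standardize t)" for t
  have step: "shuffle_tree \<Gamma> (C (Leaf (min_leaf s))) \<and> shuffle_tree \<Gamma> s \<and>
      (P (C (Leaf (min_leaf s))) \<longrightarrow> P (C s)) \<and> (P s \<longrightarrow> P (C s))"
    if C: "one_hole C" and Cs: "shuffle_tree \<Gamma> (C s)" for C s
  proof -
    let ?l = "C (Leaf (min_leaf s))"
    let ?n = "arity ?l" and ?m = "arity s"
    note valid = shuffle_tree_one_hole[OF C Cs]
    obtain B where B: "B \<in> shuffle_index ?n ?m"
      "standardize (C s) = shuffle_graft ?n ?m B (standardize ?l) (standardize s)"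
      "arity (C s) = ?n + ?m - 1" using standardize_one_hole[OF C Cs] by blast
    have mon: "standardize ?l \<in> shuffle_monomials \<Gamma> ?n" "standardize s \<in> shuffle_monomials \<Gamma> ?m"
      using standardize_monomial valid by blast+
    have ge: "?n \<ge> 1" "?m \<ge> 1" using shuffle_tree_arity valid by blast+
    have ge': "?n + ?m - 1 \<ge> 1" using ge by simp
    note comp = shuffle_graft_closed[OF ge B(1)]
    have "P (C s)" if Pl: "P ?l"
    proof -
      obtain f where f: "keys f \<subseteq> shuffle_monomials \<Gamma> ?n" "\<phi> ?n f = 0" "f \<noteq> 0"
        "leading_monomial r f = standardize ?l"
        using Pl by (auto simp: P_def kernel_part_free_shuffle)
      have closed: "(\<lambda>x. shuffle_graft ?n ?m B x (standardize s)) ` shuffle_monomials \<Gamma> ?n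
          \<subseteq> shuffle_monomials \<Gamma> (?n + ?m - 1)"
        using comp mon(2) by blast
      let ?g = "bilinear_extension (shuffle_graft ?n ?m B) f (Poly_Mapping.single (standardize s) 1)"
      note im = leading_monomial_image[OF wo ge(1) ge' f(3,1) shuffle_graft_inj_left[OF ge B(1) mon(2)]
          closed mono[OF ge B(1) _ _ _ mon(2) mon(2) refl[OF mon(2) ge(2)]]]
      have "?g \<noteq> 0" unfolding bilinear_extension_single_right by (rule im(1))
      moreover have "keys ?g \<subseteq> shuffle_monomials \<Gamma> (?n + ?m - 1)"
        unfolding bilinear_extension_single_right by (rule im(2))
      moreover have "leading_monomial r ?g =
          shuffle_graft ?n ?m B (leading_monomial r f) (standardize s)"
        unfolding bilinear_extension_single_right by (rule im(3))
      moreover have "\<phi> (?n + ?m - 1) ?g = 0"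
        using mon f by (intro shuffle_operad_hom_kernel[OF hom ge B(1)]) auto
      ultimately show ?thesis
        unfolding P_def B(2,3) kernel_part_free_shuffle
        by (intro bexI[of _ ?g]) (simp_all only: f(4), simp_all)
    qed
    moreover have "P (C s)" if Ps: "P s"
    proof -
      obtain f where f: "keys f \<subseteq> shuffle_monomials \<Gamma> ?m" "\<phi> ?m f = 0" "f \<noteq> 0"
        "leading_monomial r f = standardize s"
        using Ps by (auto simp: P_def kernel_part_free_shuffle)
      have closed: "(\<lambda>x. shuffle_graft ?n ?m B (standardize ?l) x) ` shuffle_monomials \<Gamma> ?m
          \<subseteq> shuffle_monomials \<Gamma> (?n + ?m - 1)"
        using comp mon(1) by blast
      let ?g = "bilinear_extension (shuffle_graft ?n ?m B) (Poly_Mapping.single (standardize ?l) 1) f"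
      note im = leading_monomial_image[OF wo ge(2) ge' f(3,1) shuffle_graft_inj_right[OF ge B(1) mon(1)]
          closed mono[OF ge B(1) mon(1) mon(1) refl[OF mon(1) ge(1)]]]
      have "?g \<noteq> 0" unfolding bilinear_extension_single_left by (rule im(1))
      moreover have "keys ?g \<subseteq> shuffle_monomials \<Gamma> (?n + ?m - 1)"
        unfolding bilinear_extension_single_left by (rule im(2))
      moreover have "leading_monomial r ?g =
          shuffle_graft ?n ?m B (standardize ?l) (leading_monomial r f)"
        unfolding bilinear_extension_single_left by (rule im(3))
      moreover have "\<phi> (?n + ?m - 1) ?g = 0"
        using mon f by (intro shuffle_operad_hom_kernel[OF hom ge B(1)]) auto
      ultimately show ?thesis
        unfolding P_def B(2,3) kernel_part_free_shuffle
        by (intro bexI[of _ ?g]) (simp_all only: f(4), simp_all)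
    qed
    ultimately show ?thesis using valid by blast
  qed
  obtain u where u: "connected_subtree min_leaf u v" "order_isomorphic w u"
    using divides by (auto simp: shuffle_divides_def)
  have std: "standardize u = w" using standardize_if_order_isomorphic[OF u(2) w(1)] .
  have v': "shuffle_tree \<Gamma> v" using v by (simp add: shuffle_monomials_alt)
  have "shuffle_tree \<Gamma> u \<and> (P u \<longrightarrow> P v)"
    by (rule connected_subtree_transfer[where lab = min_leaf and V = "shuffle_tree \<Gamma>" and P = P,
          OF _ _ u(1) v']) (use step in blast)+
  moreover have "arity u = k"
    using arity_shuffle_monomial[OF w(1)] by (simp flip: std add: standardize_def leaves_map_ptree)
  ultimately have "P v" using w std by (auto simp: P_def)
  then show ?thesis
    using standardize_shuffle_monomial[OF v] arity_shuffle_monomial[OF v] by (simp add: P_def)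
qed


section \<open>Planar skeletons\<close>

lemma skeleton_simps [simp]:
  "skeleton (Leaf a) = Leaf ()" "skeleton (Node g ts) = Node g (map skeleton ts)"
  by (simp_all add: skeleton_def[abs_def])

lemma arity_skeleton [simp]: "arity (skeleton t) = arity t"
  by (simp add: skeleton_def leaves_map_ptree)

lemma labelled_by_skeleton [simp]: "labelled_by \<Gamma> (skeleton t) = labelled_by \<Gamma> t"
  by (simp add: skeleton_def)

lemma skeleton_map_ptree: "skeleton (map_ptree id f t) = skeleton t"
  by (simp add: skeleton_def ptree.map_comp comp_def id_def)

lemma subtrees_skeleton: "subtrees (skeleton v) = skeleton ` subtrees v"
  by (induction v) auto

text \<open>The shapes of the connected subtrees do not depend on leaf labels; \<open>lab\<close>
  merely prescribes the labels at the cut inputs of the lift.\<close>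

lemma rooted_cut_skeleton:
  "rooted_cut (\<lambda>_. ()) x (skeleton s) \<longleftrightarrow> (\<exists>u. rooted_cut lab u s \<and> skeleton u = x)"
proof
  show "\<exists>u. rooted_cut lab u s \<and> skeleton u = x" if "rooted_cut (\<lambda>_. ()) x (skeleton s)"
    using that
  proof (induction s arbitrary: x)
    case (Leaf a)
    then have "x = Leaf ()" by (cases x) auto
    then show ?case by (intro exI[of _ "Leaf (lab (Leaf a))"]) simp
  next
    case (Node g ss)
    show ?case
    proof (cases x)
      case (Leaf b)
      then show ?thesis by (intro exI[of _ "Leaf (lab (Node g ss))"]) simp
    next
      case (Node h xs)
      then have h: "h = g" "list_all2 (\<lambda>x s. rooted_cut (\<lambda>_. ()) x (skeleton s)) xs ss"
        using Node.prems by (auto simp: list_all2_map2)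
      then have "list_all2 (\<lambda>x s. \<exists>u. rooted_cut lab u s \<and> skeleton u = x) xs ss"
        using Node.IH by (auto simp: list_all2_conv_all_nth)
      then have "\<exists>us. list_all2 (rooted_cut lab) us ss \<and> map skeleton us = xs"
      proof (induction xs ss rule: list_all2_induct)
        case (Cons x xs s ss)
        then obtain u us where "rooted_cut lab u s" "skeleton u = x"
          "list_all2 (rooted_cut lab) us ss" "map skeleton us = xs" by blast
        then show ?case by (intro exI[of _ "u # us"]) simp
      qed simp
      then obtain us where "list_all2 (rooted_cut lab) us ss" "map skeleton us = xs" by blast
      then show ?thesis using h Node by (intro exI[of _ "Node g us"]) simp
    qed
  qed
next
  assume "\<exists>u. rooted_cut lab u s \<and> skeleton u = x"
  then obtain u where u: "rooted_cut lab u s" "skeleton u = x" by blast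
  from u(1) have "rooted_cut (\<lambda>_. ()) (skeleton u) (skeleton s)"
  proof induction
    case (keep us vs g)
    then show ?case by (auto simp: list_all2_map1 list_all2_map2 elim!: list_all2_mono)
  qed simp
  then show "rooted_cut (\<lambda>_. ()) x (skeleton s)" using u(2) by simp
qed

lemma ns_divides_skeleton:
  "ns_divides x (skeleton v) \<longleftrightarrow> (\<exists>u. connected_subtree min_leaf u v \<and> skeleton u = x)"
  unfolding ns_divides_def connected_subtree_def subtrees_skeleton
  by (simp add: rooted_cut_skeleton[where lab = min_leaf]) blast

text \<open>By regularity a pattern is recognised by its skeleton: a subtree \<open>u\<close> with
  the skeleton of some \<open>w\<close> in \<open>M\<close> has its own standardization in
  \<open>M\<close>, and this divides \<open>v\<close>. Avoidance thus becomes a property of planar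
  trees.\<close>

lemma shuffle_regular_divides_iff:
  assumes M: "M \<subseteq> (\<Union>n\<in>{1..}. shuffle_monomials \<Gamma> n)" and reg: "shuffle_regular \<Gamma> M"
    and v: "shuffle_tree \<Gamma> v"
  shows "(\<exists>w\<in>M. shuffle_divides w v) \<longleftrightarrow> (\<exists>x\<in>skeleton ` M. ns_divides x (skeleton v))"
proof
  assume "\<exists>w\<in>M. shuffle_divides w v"
  then obtain w u where w: "w \<in> M" "connected_subtree min_leaf u v" "order_isomorphic w u"
    by (auto simp: shuffle_divides_def)
  then have "skeleton u = skeleton w" by (auto simp: order_isomorphic_def skeleton_map_ptree)
  then show "\<exists>x\<in>skeleton ` M. ns_divides x (skeleton v)" using w by (auto simp: ns_divides_skeleton)
next
  assume "\<exists>x\<in>skeleton ` M. ns_divides x (skeleton v)"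
  then obtain w u where w: "w \<in> M" "connected_subtree min_leaf u v" "skeleton u = skeleton w"
    by (auto simp: ns_divides_skeleton)
  have u: "shuffle_tree \<Gamma> u" using connected_subtree_shuffle_tree[OF w(2) v] .
  have "skeleton (standardize u) = skeleton w"
    using w(3) by (simp add: standardize_def skeleton_map_ptree)
  then have "standardize u \<in> M"
    using reg w(1) standardize_monomial[OF u] shuffle_tree_arity[OF u]
    unfolding shuffle_regular_def by blast
  moreover have "shuffle_divides (standardize u) v"
    using w(2) order_isomorphic_standardize[OF u] by (auto simp: shuffle_divides_def)
  ultimately show "\<exists>w\<in>M. shuffle_divides w v" by blast
qed


section \<open>Counting shuffle labellings\<close>

text \<open>The label set is arbitrary because the recursion passes to the blocks of the
  children.\<close>

definition labellings :: "('g, unit) ptree \<Rightarrow> nat set \<Rightarrow> ('g, nat) ptree set" where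
  "labellings t A = {v. distinct (leaves v) \<and> set (leaves v) = A \<and> shuffle_ordered v \<and> skeleton v = t}"

definition forest_labellings :: "('g, unit) ptree list \<Rightarrow> nat set \<Rightarrow> ('g, nat) ptree list set" where
  "forest_labellings ts A = {vs. distinct (concat (map leaves vs)) \<and> set (concat (map leaves vs)) = A \<and>
    (\<forall>v\<in>set vs. shuffle_ordered v) \<and> sorted_wrt (<) (map min_leaf vs) \<and> map skeleton vs = ts}"

lemma labellings_Node: "labellings (Node g ts) A = Node g ` forest_labellings ts A"
proof (intro equalityI subsetI)
  fix v assume "v \<in> labellings (Node g ts) A"
  then show "v \<in> Node g ` forest_labellings ts A"
    by (cases v) (auto simp: labellings_def forest_labellings_def)
qed (auto simp: labellings_def forest_labellings_def)

text \<open>The block of the first tree consists of the minimum and an arbitrary subset of the other labels.\<close>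

lemma forest_labellings_Cons:
  assumes "\<forall>u\<in>set (t # ts). leaves u \<noteq> []" "finite A" "A \<noteq> {}"
  shows "bij_betw (\<lambda>(X, v, vs). v # vs)
    (SIGMA X:{X. X \<subseteq> A \<and> Min A \<in> X \<and> card X = arity t}. labellings t X \<times> forest_labellings ts (A - X))
    (forest_labellings (t # ts) A)"
proof (rule bij_betw_byWitness[where f' = "\<lambda>vs. (set (leaves (hd vs)), hd vs, tl vs)"])
  have ne: "leaves v \<noteq> []" if "skeleton v \<in> set (t # ts)" for v
    using assms(1) that arity_skeleton[of v] by (metis length_0_conv)
  show "(\<lambda>(X, v, vs). v # vs) `
      (SIGMA X:{X. X \<subseteq> A \<and> Min A \<in> X \<and> card X = arity t}. labellings t X \<times> forest_labellings ts (A - X))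
      \<subseteq> forest_labellings (t # ts) A"
  proof clarify
    fix X v vs assume X: "X \<subseteq> A" "Min A \<in> X" and v: "v \<in> labellings t X"
      and vs: "vs \<in> forest_labellings ts (A - X)"
    have "min_leaf v = Min A"
      unfolding min_leaf_def using X v assms(2) by (intro Min_eqI) (auto simp: labellings_def)
    moreover have "Min A < min_leaf u" if "u \<in> set vs" for u
    proof -
      have "skeleton u \<in> set ts" using vs that by (auto simp: forest_labellings_def)
      then have "min_leaf u \<in> set (leaves u)" using ne[of u] by (intro min_leaf_in) auto
      then have "min_leaf u \<in> A - X" using vs that by (auto simp: forest_labellings_def)
      then show ?thesis using X(2) assms(2) by (metis DiffD1 DiffD2 Min_le le_neq_implies_less)
    qed
    ultimately show "v # vs \<in> forest_labellings (t # ts) A"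
      using X v vs by (auto simp: labellings_def forest_labellings_def)
  qed
  show "(\<lambda>vs. (set (leaves (hd vs)), hd vs, tl vs)) ` forest_labellings (t # ts) A
      \<subseteq> (SIGMA X:{X. X \<subseteq> A \<and> Min A \<in> X \<and> card X = arity t}. labellings t X \<times> forest_labellings ts (A - X))"
  proof (rule image_subsetI)
    fix us assume us: "us \<in> forest_labellings (t # ts) A"
    then obtain v vs where v: "us = v # vs" "skeleton v = t" "map skeleton vs = ts"
      by (auto simp: forest_labellings_def)
    have lv: "distinct (leaves v)" "set (leaves v) \<subseteq> A" "shuffle_ordered v"
      "set (concat (map leaves vs)) = A - set (leaves v)"
      using us v(1) by (auto simp: forest_labellings_def)
    \<comment> \<open>Were the least label in a later tree, the minimum of the first tree would have
      to be smaller still.\<close>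
    have "Min A \<in> set (leaves v)"
    proof (rule ccontr)
      assume "Min A \<notin> set (leaves v)"
      moreover have "Min A \<in> A" using assms(2,3) by simp
      ultimately obtain u where u: "u \<in> set vs" "Min A \<in> set (leaves u)" using lv(4) by auto
      have "min_leaf v < min_leaf u" using us v(1) u(1) by (auto simp: forest_labellings_def)
      also have "\<dots> \<le> Min A" using u(2) by (simp add: min_leaf_def)
      finally have "min_leaf v < Min A" .
      moreover have "min_leaf v \<in> A" using min_leaf_in[OF ne[of v]] lv(2) v(2) by auto
      ultimately show False using assms(2) by (meson Min_le not_less)
    qed
    moreover have "card (set (leaves v)) = arity t"
      using distinct_card[OF lv(1)] v(2) arity_skeleton[of v] by simp
    moreover have "v \<in> labellings t (set (leaves v))" using lv v by (simp add: labellings_def)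
    moreover have "vs \<in> forest_labellings ts (A - set (leaves v))"
      using us v lv(4) by (simp add: forest_labellings_def)
    ultimately show "(set (leaves (hd us)), hd us, tl us) \<in>
        (SIGMA X:{X. X \<subseteq> A \<and> Min A \<in> X \<and> card X = arity t}.
          labellings t X \<times> forest_labellings ts (A - X))"
      using lv(2) v(1) by simp
  qed
qed (auto simp: labellings_def forest_labellings_def)

lemma card_first_blocks:
  assumes "finite A" "A \<noteq> {}" "card A = m + n" "m \<ge> 1"
  shows "card {X. X \<subseteq> A \<and> Min A \<in> X \<and> card X = m} = block_choices m n"
proof -
  let ?A = "A - {Min A}"
  have Min: "Min A \<in> A" using assms by simp
  have "bij_betw (insert (Min A)) {X. X \<subseteq> ?A \<and> card X = m - 1} {X. X \<subseteq> A \<and> Min A \<in> X \<and> card X = m}"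
  proof (rule bij_betw_byWitness[where f' = "\<lambda>X. X - {Min A}"])
    show "insert (Min A) ` {X. X \<subseteq> ?A \<and> card X = m - 1} \<subseteq> {X. X \<subseteq> A \<and> Min A \<in> X \<and> card X = m}"
    proof clarify
      fix X assume X: "X \<subseteq> ?A" "card X = m - 1"
      then have "finite X" "Min A \<notin> X" using assms(1) finite_subset by auto
      then show "insert (Min A) X \<subseteq> A \<and> Min A \<in> insert (Min A) X \<and> card (insert (Min A) X) = m"
        using X Min assms(4) by auto
    qed
  qed auto
  then have "card {X. X \<subseteq> A \<and> Min A \<in> X \<and> card X = m} = card {X. X \<subseteq> ?A \<and> card X = m - 1}"
    by (simp add: bij_betw_same_card)
  also have "\<dots> = card ?A choose (m - 1)" using assms(1) by (intro n_subsets) simp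
  also have "card ?A = m + n - 1" using assms Min by simp
  finally show ?thesis by (simp add: block_choices_def)
qed

text \<open>The labellings of a block and of the remaining labels are counted by numbers that depend
  on the sizes only, so the sum over all blocks becomes a product.\<close>

lemma card_labellings:
  fixes t :: "('g, unit) ptree"
  assumes "labelled_by \<Gamma> t" "finite A" "card A = arity t"
  shows "finite (labellings t A) \<and> card (labellings t A) = shuffle_weight t"
  using assms
proof (induction t arbitrary: A)
  case (Leaf a)
  then obtain b where A: "A = {b}" by (auto simp: card_1_singleton_iff)
  have "v \<in> labellings (Leaf a) A \<longleftrightarrow> v = Leaf b" for v :: "('g, nat) ptree"
    by (cases v) (auto simp: labellings_def A)
  then have "labellings (Leaf a :: ('g, unit) ptree) A = {Leaf b}" by blast
  then show ?case by simp
next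
  case (Node g ts)
  have "finite (forest_labellings ts A) \<and>
      card (forest_labellings ts A) = shuffle_forest_weight ts"
    if "\<forall>t\<in>set ts. labelled_by \<Gamma> t" "finite A" "card A = forest_arity ts" for A
    using that Node.IH
  proof (induction ts arbitrary: A)
    case Nil
    then have "forest_labellings ([] :: ('g, unit) ptree list) A = {[]}" by (auto simp: forest_labellings_def)
    then show ?case by simp
  next
    case (Cons t ts)
    have t: "labelled_by \<Gamma> t" "arity t \<ge> 1" using Cons.prems(1) arity_ge_1[of \<Gamma> t] by auto
    have A: "A \<noteq> {}" "card A = arity t + forest_arity ts" using Cons.prems(3) t(2) by auto
    let ?S = "{X. X \<subseteq> A \<and> Min A \<in> X \<and> card X = arity t}"
    have finS: "finite ?S" using Cons.prems(2) by simp
    have first: "finite (labellings t X) \<and> card (labellings t X) = shuffle_weight t"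
      if "X \<in> ?S" for X
      using Cons.prems(2,4) t(1) that finite_subset[of X A] by auto
    have rest: "finite (forest_labellings ts (A - X)) \<and>
        card (forest_labellings ts (A - X)) = shuffle_forest_weight ts"
      if X: "X \<in> ?S" for X
    proof (rule Cons.IH)
      show "card (A - X) = forest_arity ts"
        using X A(2) Cons.prems(2) finite_subset[of X A] by (auto simp: card_Diff_subset)
    qed (use Cons.prems in auto)
    have ne: "\<forall>u\<in>set (t # ts). leaves u \<noteq> []" using Cons.prems(1) leaves_neq_Nil by blast
    note bij = forest_labellings_Cons[OF ne Cons.prems(2) A(1)]
    let ?D = "SIGMA X:?S. labellings t X \<times> forest_labellings ts (A - X)"
    have "finite ?D" using finS first rest by (intro finite_SigmaI) auto
    then have "finite (forest_labellings (t # ts) A)" using bij_betw_finite[OF bij] by blast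
    moreover have "card (forest_labellings (t # ts) A) = card ?D" using bij_betw_same_card[OF bij] ..
    moreover have "card ?D = (\<Sum>X\<in>?S. card (labellings t X \<times> forest_labellings ts (A - X)))"
      using finS first rest by (intro card_SigmaI) auto
    moreover have "\<dots> = (\<Sum>X\<in>?S. shuffle_weight t * shuffle_forest_weight ts)"
      using first rest by (intro sum.cong refl) (simp add: card_cartesian_product)
    moreover have "\<dots> = block_choices (arity t) (forest_arity ts) *
        (shuffle_weight t * shuffle_forest_weight ts)"
      using card_first_blocks[OF Cons.prems(2) A t(2)] by simp
    ultimately show ?case by (simp add: mult.assoc)
  qed
  from this[of A] have "finite (forest_labellings ts A) \<and>
      card (forest_labellings ts A) = shuffle_forest_weight ts"
    using Node.prems by (simp add: length_concat comp_def)
  then show ?case by (simp add: labellings_Node weight_Node card_image inj_on_def)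
qed

lemma labellings_interval:
  "labelled_by \<Gamma> t \<Longrightarrow> arity t = n \<Longrightarrow>
    labellings t {1..n} = {v \<in> shuffle_monomials \<Gamma> n. skeleton v = t}"
  by (auto simp: labellings_def shuffle_monomials_def)


section \<open>The shuffle regular case\<close>

lemma shuffle_dim_part:
  fixes Q :: "('k::field, 'v::ab_group_add) ns_operad" and \<Gamma> :: "nat \<Rightarrow> 'g set"
  assumes Q: "ns_operad Q"
    and hom: "shuffle_operad_hom (free_shuffle_operad \<Gamma>) (shuffle_operad_of Q \<rho>) \<phi>"
    and surj: "surjective_on_parts (free_shuffle_operad \<Gamma>) (shuffle_operad_of Q \<rho>) \<phi>"
    and r: "shuffle_admissible_order \<Gamma> r"
    and G: "groebner_basis shuffle_divides r (kernel_part (free_shuffle_operad \<Gamma>) \<phi>) G" "0 \<notin> G"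
    and n: "n \<ge> 1" and fin: "finite_dimensional_part Q n"
  defines "N \<equiv> {v \<in> shuffle_monomials \<Gamma> n. \<forall>w\<in>leading_monomial r ` G. \<not> shuffle_divides w v}"
  shows "finite N \<and> dim_part Q n = card N"
proof (rule dim_eq_card_normal)
  interpret ns_operad Q by (rule Q)
  let ?F = "free_shuffle_operad \<Gamma> :: ('k, ('g, nat) ptree \<Rightarrow>\<^sub>0 'k) shuffle_operad"
  have coll: "collection_hom ?F (shuffle_operad_of Q \<rho>) \<phi>"
    using hom by (simp add: shuffle_operad_hom_def)
  have part: "graded_part ?F n = {f. keys f \<subseteq> shuffle_monomials \<Gamma> n}" for n
    by (simp add: free_shuffle_operad_def)
  have sc: "lin_scale ?F = scale_poly_mapping" by (simp add: free_shuffle_operad_def)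
  have Q_simps: "lin_scale (shuffle_operad_of Q \<rho>) = lin_scale Q"
    "graded_part (shuffle_operad_of Q \<rho>) = graded_part Q" by (simp_all add: shuffle_operad_of_def)
  show "vector_space (lin_scale Q)" by (rule vector_space)
  show wo: "well_ordered_by_arity (shuffle_monomials \<Gamma>) r"
    using r by (simp add: shuffle_admissible_order_def)
  show "n \<ge> 1" by (rule n)
  show "\<phi> n (x + y) = \<phi> n x + \<phi> n y"
    if "keys x \<subseteq> shuffle_monomials \<Gamma> n" "keys y \<subseteq> shuffle_monomials \<Gamma> n" for x y
    using coll that n unfolding collection_hom_def part by blast
  show "\<phi> n (scale_poly_mapping c x) = lin_scale Q c (\<phi> n x)"
    if "keys x \<subseteq> shuffle_monomials \<Gamma> n" for c x
    using coll that n unfolding collection_hom_def part sc Q_simps by blast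
  show "\<phi> n ` {f. keys f \<subseteq> shuffle_monomials \<Gamma> n} = graded_part Q n"
    using surj n unfolding surjective_on_parts_def part Q_simps by blast
  show "N \<subseteq> shuffle_monomials \<Gamma> n" by (auto simp: N_def)
  show "finite_dimensional_part Q n" by (rule fin)
  show "leading_monomial r f \<notin> N"
    if "keys f \<subseteq> shuffle_monomials \<Gamma> n" "\<phi> n f = 0" and f0: "f \<noteq> 0" for f
  proof -
    have "f \<in> kernel_part ?F \<phi> n" using that by (simp add: kernel_part_free_shuffle)
    then obtain g where "g \<in> G" "shuffle_divides (leading_monomial r g) (leading_monomial r f)"
      using G n f0 unfolding groebner_basis_def by blast
    then show ?thesis by (auto simp: N_def)
  qed
  show "\<exists>f. keys f \<subseteq> shuffle_monomials \<Gamma> n \<and> \<phi> n f = 0 \<and> f \<noteq> 0 \<and> leading_monomial r f = m"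
    if m: "m \<in> shuffle_monomials \<Gamma> n" "m \<notin> N" for m
  proof -
    obtain g where g: "g \<in> G" "shuffle_divides (leading_monomial r g) m"
      using m by (auto simp: N_def)
    then have "g \<noteq> 0" using G(2) by auto
    obtain k where k: "k \<ge> 1" "g \<in> kernel_part ?F \<phi> k"
      using G g(1) unfolding groebner_basis_def by auto
    then have "leading_monomial r g \<in> shuffle_monomials \<Gamma> k"
      using leading_monomial_in_keys[OF wo k(1) _ \<open>g \<noteq> 0\<close>] by (auto simp: kernel_part_free_shuffle)
    from shuffle_leading_monomial_divides[OF hom r g(2) m(1) this k(2) \<open>g \<noteq> 0\<close> refl]
    show ?thesis by (auto simp: kernel_part_free_shuffle)
  qed
qed

text \<open>Shifting by one turns \<open>block_choices (Suc i) (n - i)\<close> into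
  \<open>n choose i\<close>, the coefficient of the shuffle product. \<open>F $ 0 = 0\<close>
  removes the index 0, where the truncated subtractions in \<open>block_choices\<close> give a
  meaningless value.\<close>

lemma rational_block_convolution:
  fixes F G :: "rat fps"
  assumes "rational_series F" "rational_series G" "F $ 0 = 0"
  shows "rational_series (Abs_fps (\<lambda>n. \<Sum>i\<le>n. of_nat (block_choices i (n - i)) * F $ i * G $ (n - i)))"
    (is "rational_series ?H")
proof -
  have shift: "rational_series (fps_shift 1 F)"
  proof -
    obtain p q where pq: "q \<noteq> 0" "F * fps_of_poly q = fps_of_poly p"
      using assms(1) by (auto simp: rational_series_def)
    have F: "F = fps_X * fps_shift 1 F" using assms(3) by (simp add: fps_eq_iff fps_X_mult_nth)
    have "fps_shift 1 F * fps_of_poly ([:0, 1:] * q) = (fps_X * fps_shift 1 F) * fps_of_poly q"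
      by (simp add: fps_of_poly_mult fps_of_poly_fps_X mult_ac del: mult_pCons_left)
    also have "\<dots> = fps_of_poly p" by (simp only: F[symmetric] pq(2))
    finally have "fps_shift 1 F * fps_of_poly ([:0, 1:] * q) = fps_of_poly p" .
    moreover have "[:0, 1:] * q \<noteq> 0" using pq(1) by simp
    ultimately show ?thesis unfolding rational_series_def by blast
  qed
  have "fps_shift 1 ?H = shuffle_product (fps_shift 1 F) G"
  proof (rule fps_ext)
    fix n
    have "fps_shift 1 ?H $ n =
        (\<Sum>i\<in>{..Suc n}. of_nat (block_choices i (Suc n - i)) * F $ i * G $ (Suc n - i))" by simp
    also have "\<dots> = (\<Sum>i\<le>n. of_nat (block_choices (Suc i) (n - i)) * F $ Suc i * G $ (n - i))"
      using assms(3) by (subst sum.atMost_Suc_shift) simp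
    also have "\<dots> = (\<Sum>i\<le>n. of_nat (n choose i) * F $ Suc i * G $ (n - i))"
      by (intro sum.cong refl) (simp add: block_choices_def)
    finally show "fps_shift 1 ?H $ n = shuffle_product (fps_shift 1 F) G $ n"
      by (simp add: shuffle_product_def)
  qed
  moreover have "?H = fps_X * fps_shift 1 ?H"
    using assms(3) by (simp add: fps_eq_iff fps_X_mult_nth)
  moreover have "rational_series (fps_X * shuffle_product (fps_shift 1 F) G)"
    using shift assms(2) by (intro rational_series_mult rational_series_X rational_series_shuffle_product)
  ultimately show ?thesis by simp
qed

text \<open>The terms of the exponential series at \<open>a ^ d\<close> tend to 0.\<close>

lemma power_less_fact:
  fixes a :: real
  assumes "a > 0"
  obtains k where "a ^ (c + k * d) < fact k"
proof -
  have "(\<lambda>k. inverse (fact k) * (a ^ d) ^ k) \<longlonglongrightarrow> 0"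
    by (rule summable_LIMSEQ_zero[OF summable_exp])
  then have "eventually (\<lambda>k. inverse (fact k) * (a ^ d) ^ k < 1 / a ^ c) sequentially"
    by (rule order_tendstoD) (use assms in simp)
  then obtain k where "inverse (fact k) * (a ^ d) ^ k < 1 / a ^ c"
    by (auto simp: eventually_sequentially)
  then have "a ^ (c + k * d) < fact k"
    using assms by (simp add: field_simps power_add power_mult)
  then show ?thesis by (rule that)
qed

theorem shuffle_regular_rational_series:
  fixes Q :: "('k::field, 'v::ab_group_add) ns_operad" and \<Gamma> :: "nat \<Rightarrow> 'g set" and a :: real
  assumes Q: "ns_operad Q"
    and hom: "shuffle_operad_hom (free_shuffle_operad \<Gamma>) (shuffle_operad_of Q \<rho>) \<phi>"
    and surj: "surjective_on_parts (free_shuffle_operad \<Gamma>) (shuffle_operad_of Q \<rho>) \<phi>"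
    and \<Gamma>: "finitely_many_generators \<Gamma>"
    and r: "shuffle_admissible_order \<Gamma> r"
    and G: "groebner_basis shuffle_divides r (kernel_part (free_shuffle_operad \<Gamma>) \<phi>) G" "0 \<notin> G"
      "finite G"
    and reg: "shuffle_regular \<Gamma> (leading_monomial r ` G)"
    and bound: "a > 1" "dims_bounded_by Q (\<lambda>n. a ^ n)"
  shows "rational_series (generating_series Q)"
proof -
  define M where "M = leading_monomial r ` G"
  define L where "L = avoiding \<Gamma> (skeleton ` M)"
  define N where "N n = {v \<in> shuffle_monomials \<Gamma> n. \<forall>w\<in>M. \<not> shuffle_divides w v}" for n
  have wo: "well_ordered_by_arity (shuffle_monomials \<Gamma>) r"
    using r by (simp add: shuffle_admissible_order_def)
  have M: "M \<subseteq> (\<Union>n\<in>{1..}. shuffle_monomials \<Gamma> n)"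
  proof
    fix w assume "w \<in> M"
    then obtain g where g: "g \<in> G" "w = leading_monomial r g" by (auto simp: M_def)
    then obtain k where k: "k \<ge> 1" "keys g \<subseteq> shuffle_monomials \<Gamma> k"
      using G(1) by (auto simp: groebner_basis_def kernel_part_free_shuffle)
    have "g \<noteq> 0" using g(1) G(2) by auto
    then show "w \<in> (\<Union>n\<in>{1..}. shuffle_monomials \<Gamma> n)"
      using leading_monomial_in_keys[OF wo k] g(2) k by auto
  qed
  \<comment> \<open>Regularity turns normality into a condition on the skeleton alone, so that the
    planar language \<open>L\<close> governs the shuffle monomials.\<close>
  have N_iff: "v \<in> N n \<longleftrightarrow> v \<in> shuffle_monomials \<Gamma> n \<and> skeleton v \<in> L" for v n
    using shuffle_regular_divides_iff[OF M reg[folded M_def], of v]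
    by (auto simp: N_def L_def avoiding_def shuffle_monomials_alt shuffle_tree_def)
  have dim: "finite (N n) \<and> dim_part Q n = card (N n)" if "n \<ge> 1" for n
    using shuffle_dim_part[OF Q hom surj r G(1,2) that] bound(2) that
    by (simp add: dims_bounded_by_def N_def M_def)
  have lab: "labelled_by \<Gamma> t" if "t \<in> L" for t using that by (simp add: L_def avoiding_def)
  have labellings: "finite (labellings t {1..n}) \<and> card (labellings t {1..n}) = shuffle_weight t \<and>
      labellings t {1..n} = {v \<in> N n. skeleton v = t}"
    if "t \<in> L" "arity t = n" for t n
    using card_labellings[OF lab[OF that(1)], of "{1..n}"] labellings_interval[OF lab[OF that(1)] that(2)]
      that N_iff by auto
  have L0: "{t \<in> L. arity t = 0} = {}" using leaves_neq_Nil lab by auto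
  have fin: "finite {t \<in> L. arity t = n}" for n
  proof (cases "n = 0")
    case False
    \<comment> \<open>Every skeleton in \<open>L\<close> has at least one labelling, so finitely
      many normal monomials leave room for finitely many skeletons only.\<close>
    have "{t \<in> L. arity t = n} \<subseteq> skeleton ` N n"
    proof
      fix t assume t: "t \<in> {t \<in> L. arity t = n}"
      then have "card (labellings t {1..n}) \<ge> 1"
        using labellings[of t n] shuffle_weight_pos[OF lab, of t] by auto
      then have "labellings t {1..n} \<noteq> {}" by auto
      then obtain v where "v \<in> labellings t {1..n}" by blast
      then have "v \<in> N n" "skeleton v = t" using labellings[of t n] t by auto
      then show "t \<in> skeleton ` N n" by blast
    qed
    then show ?thesis using dim[of n] False by (meson finite_imageI finite_subset less_one not_le)
  qed (metis L0 finite.emptyI)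
  have sum: "(\<Sum>t\<in>{t \<in> L. arity t = n}. shuffle_weight t) = (if n = 0 then 0 else dim_part Q n)" for n
  proof (cases "n = 0")
    case False
    have "N n = (\<Union>t\<in>{t \<in> L. arity t = n}. labellings t {1..n})"
      using labellings N_iff arity_shuffle_monomial by auto
    then have "card (N n) = card (\<Union>t\<in>{t \<in> L. arity t = n}. labellings t {1..n})" by (rule arg_cong)
    also have "\<dots> = (\<Sum>t\<in>{t \<in> L. arity t = n}. card (labellings t {1..n}))"
    proof (rule card_UN_disjoint[OF fin])
      show "\<forall>t\<in>{t \<in> L. arity t = n}. finite (labellings t {1..n})" using labellings by blast
      show "\<forall>t\<in>{t \<in> L. arity t = n}. \<forall>u\<in>{t \<in> L. arity t = n}. t \<noteq> u \<longrightarrow>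
          labellings t {1..n} \<inter> labellings u {1..n} = {}"
        by (auto simp: labellings_def)
    qed
    also have "\<dots> = (\<Sum>t\<in>{t \<in> L. arity t = n}. shuffle_weight t)"
      using labellings by (intro sum.cong refl) blast
    finally show ?thesis using dim[of n] False by simp
  qed (simp only: L0 sum.empty refl if_True)
  obtain st :: "('g, unit) ptree \<Rightarrow> ('g, unit) ptree" where "tree_language L st"
    using tree_language_avoiding[OF \<Gamma>, of "skeleton ` M"] fin G(3) by (auto simp: L_def M_def)
  then interpret tree_language L st .
  \<comment> \<open>Otherwise the weighted count, which is the dimension, would grow factorially
    along an arithmetic progression and exceed the exponential bound.\<close>
  have good: "vs = [] \<and> (\<forall>u\<in>set us. arity u = 1)" if node: "Node g (us @ t # vs) \<in> L"
    and t: "(st (Node g (us @ t # vs)), st t) \<in> step\<^sup>*" for g us t vs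
  proof (rule ccontr)
    assume "\<not> (vs = [] \<and> (\<forall>u\<in>set us. arity u = 1))"
    moreover have "arity u \<ge> 1" if "u \<in> set us" for u
      using arity_pos child_closed[OF node] that by auto
    ultimately have "vs \<noteq> [] \<or> (\<exists>u\<in>set us. arity u \<ge> 2)" by fastforce
    then obtain c d where cd:
      "\<And>k. fact k \<le> (\<Sum>t\<in>{t \<in> L. arity t = c + k * d}. shuffle_weight t)"
      using factorial_growth[OF node t] by blast
    obtain k where k: "a ^ (c + k * d) < fact k" using power_less_fact[of a c d] bound(1) by auto
    have "fact k \<le> (if c + k * d = 0 then 0 else dim_part Q (c + k * d))" using cd[of k] unfolding sum .
    then have n: "c + k * d \<ge> 1" "fact k \<le> dim_part Q (c + k * d)"
      by (auto split: if_splits simp: Suc_le_eq)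
    then have "(fact k :: real) \<le> real (dim_part Q (c + k * d))" by (metis of_nat_fact of_nat_le_iff)
    also have "\<dots> \<le> a ^ (c + k * d)" using bound(2) n(1) unfolding dims_bounded_by_def by blast
    finally show False using k by simp
  qed
  have "rational_series (gf block_choices X)" if "X \<in> st ` L" for X
  proof (rule rational_gf[OF _ _ _ that])
    show "rational_series (Abs_fps (\<lambda>n. \<Sum>i\<le>n. of_nat (block_choices i (n - i)) * F $ i * G $ (n - i)))"
      if "rational_series F" "rational_series G" "F $ 0 = 0" for F G :: "rat fps"
      using that by (rule rational_block_convolution)
  next
    fix g us t vs assume *: "Node g (us @ t # vs) \<in> L" "(st (Node g (us @ t # vs)), st t) \<in> step\<^sup>*"
    have "arity t \<ge> 1" using arity_pos child_closed[OF *(1)] by auto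
    \<comment> \<open>All factors are 1: \<open>block_choices 1 _\<close> for the siblings,
      \<open>block_choices _ 0\<close> for the last child.\<close>
    then have "shuffle_forest_weight (us @ [t]) =
        forest_weight (\<lambda>_ _. 1) block_choices (us @ [t])" if "\<forall>u\<in>set us. arity u = 1"
      using that by (induction us) auto
    then show "shuffle_forest_weight (us @ t # vs) =
        forest_weight (\<lambda>_ _. 1) block_choices (us @ t # vs)" using good[OF *] by simp
    fix u assume u: "u \<in> set us \<union> set vs"
    show "(st (Node g (us @ t # vs)), st u) \<notin> step\<^sup>*"
    proof
      assume st: "(st (Node g (us @ t # vs)), st u) \<in> step\<^sup>*"
      have "u \<in> set us" using u good[OF *] by auto
      then obtain xs ys where "us = xs @ u # ys" by (meson split_list)
      \<comment> \<open>A second recursive child would stand to the left of \<open>t\<close>, but a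
        recursive child has nothing to its right.\<close>
      then show False using good[of g xs u "ys @ t # vs"] *(1) st by simp
    qed
  qed
  then have "rational_series
      (Abs_fps (\<lambda>n. of_nat (\<Sum>t\<in>{t \<in> L. arity t = n}. shuffle_weight t)) :: rat fps)"
    by (rule rational_total_gf)
  also have "Abs_fps (\<lambda>n. of_nat (\<Sum>t\<in>{t \<in> L. arity t = n}. shuffle_weight t)) = generating_series Q"
    unfolding sum generating_series_def by (auto simp: fps_eq_iff)
  finally show ?thesis .
qed


theorem theorem0p1p5:
  fixes P :: "('k::field_char_0, 'v::ab_group_add) ns_operad"
    and \<Gamma> :: "nat \<Rightarrow> 'g set"
    and \<phi> :: "nat \<Rightarrow> (('g, unit) ptree \<Rightarrow>\<^sub>0 'k) \<Rightarrow> 'v"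
    and r :: "(('g, unit) ptree \<times> ('g, unit) ptree) set"
    and G :: "(('g, unit) ptree \<Rightarrow>\<^sub>0 'k) set"
    and Q :: "('k, 'w::ab_group_add) ns_operad"
    and \<rho> :: "nat \<Rightarrow> (nat \<Rightarrow> nat) \<Rightarrow> 'w \<Rightarrow> 'w"
    and E :: "('k, 'e::ab_group_add) collection"
    and \<epsilon> :: "nat \<Rightarrow> (nat \<Rightarrow> nat) \<Rightarrow> 'e \<Rightarrow> 'e"
    and \<Upsilon> :: "nat \<Rightarrow> 'e set"
    and \<psi> :: "nat \<Rightarrow> 'e \<Rightarrow> 'w"
    and \<theta> :: "nat \<Rightarrow> (('e, nat) ptree \<Rightarrow>\<^sub>0 'k) \<Rightarrow> 'w"
    and s :: "(('e, nat) ptree \<times> ('e, nat) ptree) set"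
    and H :: "(('e, nat) ptree \<Rightarrow>\<^sub>0 'k) set"
  shows
    "(ns_operad P \<and>
      ns_presentation \<Gamma> P \<phi> \<and>
      finitely_many_generators \<Gamma> \<and>
      ns_admissible_order \<Gamma> r \<and>
      groebner_basis ns_divides r (kernel_part (free_ns_operad \<Gamma>) \<phi>) G \<and>
      finite G \<and>
      (\<exists>p :: real poly. dims_bounded_by P (\<lambda>n. poly p (real n)))
      \<longrightarrow> rational_series (generating_series P))
     \<and>
     (symmetric_operad Q \<rho> \<and>
      symmetric_presentation E \<epsilon> \<Upsilon> \<psi> Q \<rho> \<theta> \<and>
      finitely_many_generators \<Upsilon> \<and>
      shuffle_admissible_order \<Upsilon> s \<and>
      reduced_groebner_basis shuffle_divides s (kernel_part (free_shuffle_operad \<Upsilon>) \<theta>) H \<and>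
      finite H \<and>
      shuffle_regular \<Upsilon> (leading_monomial s ` H) \<and>
      (\<exists>a :: real. a > 1 \<and> dims_bounded_by Q (\<lambda>n. a ^ n))
      \<longrightarrow> rational_series (generating_series Q))"
proof (intro conjI impI, goal_cases)
  case 1
  then obtain p :: "real poly" where "dims_bounded_by P (\<lambda>n. poly p (real n))" by blast
  with 1 show ?case by (intro ns_rational_series[of P \<Gamma> \<phi> r G p]) simp_all
next
  case 2
  then obtain a :: real where a: "a > 1" "dims_bounded_by Q (\<lambda>n. a ^ n)" by blast
  show ?case
  proof (rule shuffle_regular_rational_series)
    show "ns_operad Q" using 2 by (simp add: symmetric_operad_def)
    show "shuffle_operad_hom (free_shuffle_operad \<Upsilon>) (shuffle_operad_of Q \<rho>) \<theta>"
      "surjective_on_parts (free_shuffle_operad \<Upsilon>) (shuffle_operad_of Q \<rho>) \<theta>"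
      using 2 by (simp_all add: symmetric_presentation_def)
    show "groebner_basis shuffle_divides s (kernel_part (free_shuffle_operad \<Upsilon>) \<theta>) H" "0 \<notin> H"
      using 2 by (auto simp: reduced_groebner_basis_def)
  qed (use 2 a in simp_all)
qed

end
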